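(* Let $\tau$ be the vocabulary consisting of the unary relation symbol $\textit{root}$ and a binary relation symbol $E$. There exists a class $\mathcal A$ of rooted path structures of vocabulary $\tau$ such that $p$-$\textsc{emb}(\mathcal A)$ and $p$-$\textsc{longshort}$ are pl-Turing reducible to each other.
   Context: A rooted path structure is a finite $\tau$-structure whose Gaifman graph (vertices the universe, distinct $a,a'$ adjacent iff they occur together in some tuple of some relation) is a path, and with $\textit{root}^{\mathbf P}$ a singleton containing an endpoint of that path. $p$-$\textsc{emb}(\mathcal A)$: given $\mathbf A\in\mathcal A$ and a $\tau$-structure $\mathbf B$, parameter $|A|$, decide whether there is an injective homomorphism (embedding) from $\mathbf A$ into $\mathbf B$. $p$-$\textsc{longshort}$: given a graph $\mathbf G$, vertices $s,t$ and $k,\ell\in\mathbb N$ with $k<\ell$, parameter $\ell$, decide whether $\mathbf G$ contains a path of length at least $\ell$ with endpoint $s$ or a path of length exactly $k$ connecting $s$ and $t$. A pl-Turing reduction from $(Q,\kappa)$ to $(Q',\kappa')$ is an oracle algorithm with oracle $Q'$ that decides $Q$ in space $f(\kappa(x))+O(\log|x|)$ for a computable $f$ and on input $x$ only queries $y$ with $\kappa'(y)\le g(\kappa(x))$ for a computable $g$. *)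

theory Defs
  imports Complex_Main "Graph_Theory.Pair_Digraph"
begin

section \<open>Structures over the vocabulary consisting of a unary root and a binary edge symbol\<close>

datatype vocab = Root | Edge

fun arity :: "vocab \<Rightarrow> nat" where
  "arity Root = 1"
| "arity Edge = 2"

record 'a struct =
  univ :: "'a set"
  interp :: "vocab \<Rightarrow> 'a list set"

definition finite_structure :: "'a struct \<Rightarrow> bool" where
  "finite_structure S \<longleftrightarrow> finite (univ S) \<and> univ S \<noteq> {} \<and>
     (\<forall>R. \<forall>t \<in> interp S R. length t = arity R \<and> set t \<subseteq> univ S)"

definition homomorphism :: "('a \<Rightarrow> 'b) \<Rightarrow> 'a struct \<Rightarrow> 'b struct \<Rightarrow> bool" where
  "homomorphism h A B \<longleftrightarrow> h ` univ A \<subseteq> univ B \<and>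
     (\<forall>R. \<forall>t \<in> interp A R. map h t \<in> interp B R)"

text \<open>Embeddings are injective homomorphisms; they need not reflect relations.\<close>

definition embedding :: "('a \<Rightarrow> 'b) \<Rightarrow> 'a struct \<Rightarrow> 'b struct \<Rightarrow> bool" where
  "embedding h A B \<longleftrightarrow> homomorphism h A B \<and> inj_on h (univ A)"

text \<open>An undirected graph is a symmetric loop-free digraph, as in \<^locale>\<open>pair_graph\<close>.\<close>

definition gaifman :: "'a struct \<Rightarrow> 'a pair_pre_digraph" where
  "gaifman S = \<lparr> pverts = univ S,
     parcs = {(a, b). a \<noteq> b \<and> (\<exists>R. \<exists>t \<in> interp S R. a \<in> set t \<and> b \<in> set t)} \<rparr>"

text \<open>The graph \<open>G\<close> consists of nothing but a path with endpoints \<open>u\<close> and \<open>v\<close>.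
  The one-vertex graph is a path, whose endpoints coincide.\<close>

definition path_graph :: "'a pair_pre_digraph \<Rightarrow> 'a \<Rightarrow> 'a \<Rightarrow> bool" where
  "path_graph G u v \<longleftrightarrow> (\<exists>p. pre_digraph.apath (with_proj G) u p v \<and>
     pverts G = set (pre_digraph.awalk_verts (with_proj G) u p) \<and>
     parcs G = set p \<union> (set p)\<inverse>)"

definition rooted_path_structure :: "'a struct \<Rightarrow> bool" where
  "rooted_path_structure P \<longleftrightarrow> finite_structure P \<and>
     (\<exists>u v r. path_graph (gaifman P) u v \<and> r \<in> {u, v} \<and> interp P Root = {[r]})"


section \<open>Parameterized problems and computable functions\<close>

datatype sym = Zero | One | Sep

text \<open>The underlying language, and the parameterization.\<close>

type_synonym param_problem = "sym list set \<times> (sym list \<Rightarrow> nat)"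

text \<open>\<open>general_recursive n F\<close>: on argument lists of length \<open>n\<close>, \<open>F\<close> is a total recursive
  function (Kleene: closure under composition, primitive recursion, and minimization
  of regular functions). Values of \<open>F\<close> on lists of other lengths are irrelevant.\<close>

inductive general_recursive :: "nat \<Rightarrow> (nat list \<Rightarrow> nat) \<Rightarrow> bool" where
  zero: "general_recursive n (\<lambda>_. 0)"
| succ: "general_recursive 1 (\<lambda>xs. Suc (xs ! 0))"
| proj: "i < n \<Longrightarrow> general_recursive n (\<lambda>xs. xs ! i)"
| comp: "general_recursive (length Fs) G \<Longrightarrow> \<forall>F \<in> set Fs. general_recursive n F \<Longrightarrow>
    general_recursive n (\<lambda>xs. G (map (\<lambda>F. F xs) Fs))"
| prim: "general_recursive n G \<Longrightarrow> general_recursive (n + 2) H \<Longrightarrow>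
    general_recursive (Suc n)
      (\<lambda>xs. rec_nat (G (tl xs)) (\<lambda>i r. H (i # r # tl xs)) (hd xs))"
| mini: "general_recursive (Suc n) G \<Longrightarrow>
    (\<And>xs. length xs = n \<Longrightarrow> \<exists>i. G (i # xs) = 0) \<Longrightarrow>
    general_recursive n (\<lambda>xs. LEAST i. G (i # xs) = 0)"

definition computable :: "(nat \<Rightarrow> nat) \<Rightarrow> bool" where
  "computable f \<longleftrightarrow> (\<exists>F. general_recursive 1 F \<and> (\<forall>i. f i = F [i]))"


section \<open>Deterministic oracle Turing machines\<close>

text \<open>A machine has a two-way read-only input tape, a fixed number of work tapes that are
  infinite to the right, and a write-only oracle tape to which symbols are appended. In the
  query state the word on the oracle tape is submitted, the tape is erased, and the machine
  continues in one of two answer states. As usual for space-bounded reductions, only the work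
  tapes count towards the space.\<close>

datatype dir = GoLeft | Stay | GoRight

datatype input_sym = LeftEnd | Symbol sym | RightEnd

record ('q, 'g) otm =
  states :: "'q set"
  start :: 'q
  accept :: 'q
  reject :: 'q
  query :: 'q
  answer_yes :: 'q
  answer_no :: 'q
  tape_count :: nat
  alphabet :: "'g set"
  blank :: 'g
  \<comment> \<open>from the state, the scanned input symbol and the scanned work symbols to: the new state,
    the input head movement, for each work tape the symbol written and the head movement,
    and the symbol appended to the oracle tape, if any\<close>
  delta :: "'q \<Rightarrow> input_sym \<Rightarrow> 'g list \<Rightarrow> 'q \<times> dir \<times> ('g \<times> dir) list \<times> sym option"

definition wf_otm :: "('q, 'g) otm \<Rightarrow> bool" where
  "wf_otm M \<longleftrightarrow> finite (states M) \<and>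
     {start M, accept M, reject M, query M, answer_yes M, answer_no M} \<subseteq> states M \<and>
     accept M \<noteq> reject M \<and> query M \<notin> {accept M, reject M} \<and>
     finite (alphabet M) \<and> blank M \<in> alphabet M \<and>
     (\<forall>q \<in> states M. \<forall>a gs. length gs = tape_count M \<and> set gs \<subseteq> alphabet M \<longrightarrow>
        (case delta M q a gs of (q', d, acts, out) \<Rightarrow>
           q' \<in> states M \<and> length acts = tape_count M \<and> fst ` set acts \<subseteq> alphabet M))"

record ('q, 'g) config =
  state :: 'q
  input_pos :: nat
  work :: "(nat \<times> (nat \<Rightarrow> 'g)) list"  \<comment> \<open>head position and contents of each work tape\<close>
  oracle_tape :: "sym list"

definition initial :: "('q, 'g) otm \<Rightarrow> ('q, 'g) config" where
  "initial M = \<lparr> state = start M, input_pos = 0,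
     work = replicate (tape_count M) (0, \<lambda>_. blank M), oracle_tape = [] \<rparr>"

text \<open>The input \<open>x\<close> occupies positions \<open>1, \<dots>, length x\<close>, between two end markers.\<close>

definition read_input :: "sym list \<Rightarrow> nat \<Rightarrow> input_sym" where
  "read_input x i =
     (if i = 0 then LeftEnd else if i \<le> length x then Symbol (x ! (i - 1)) else RightEnd)"

fun move :: "dir \<Rightarrow> nat \<Rightarrow> nat" where
  "move GoLeft i = i - 1"
| "move Stay i = i"
| "move GoRight i = Suc i"

definition step :: "('q, 'g) otm \<Rightarrow> sym list set \<Rightarrow> sym list \<Rightarrow>
    ('q, 'g) config \<Rightarrow> ('q, 'g) config" where
  "step M Q x c =
     (if state c \<in> {accept M, reject M} then c
      else if state c = query M then
        c\<lparr> state := (if oracle_tape c \<in> Q then answer_yes M else answer_no M),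
           oracle_tape := [] \<rparr>
      else
        (case delta M (state c) (read_input x (input_pos c)) (map (\<lambda>(h, t). t h) (work c)) of
          (q, d, acts, out) \<Rightarrow>
            \<lparr> state = q,
              input_pos = min (move d (input_pos c)) (Suc (length x)),
              work = map2 (\<lambda>(h, t) (g, e). (move e h, t(h := g))) (work c) acts,
              oracle_tape = oracle_tape c @ (case out of None \<Rightarrow> [] | Some b \<Rightarrow> [b]) \<rparr>))"

definition run :: "('q, 'g) otm \<Rightarrow> sym list set \<Rightarrow> sym list \<Rightarrow> nat \<Rightarrow> ('q, 'g) config" where
  "run M Q x n = (step M Q x ^^ n) (initial M)"

definition decides :: "('q, 'g) otm \<Rightarrow> sym list set \<Rightarrow> sym list set \<Rightarrow> bool" where
  "decides M Q' Q \<longleftrightarrow>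
     (\<forall>x. \<exists>n. state (run M Q' x n) = (if x \<in> Q then accept M else reject M))"

text \<open>Every work tape head stays within the first \<open>b\<close> cells. The number of work tapes is
  fixed, so it is immaterial whether space is counted per tape or in total.\<close>

definition space_within :: "('q, 'g) otm \<Rightarrow> sym list set \<Rightarrow> sym list \<Rightarrow> real \<Rightarrow> bool" where
  "space_within M Q x b \<longleftrightarrow> (\<forall>n. \<forall>(h, t) \<in> set (work (run M Q x n)). real (Suc h) \<le> b)"

definition queried :: "('q, 'g) otm \<Rightarrow> sym list set \<Rightarrow> sym list \<Rightarrow> sym list set" where
  "queried M Q x = {oracle_tape (run M Q x n) | n. state (run M Q x n) = query M}"

text \<open>States and tape symbols are taken from \<^typ>\<open>nat\<close> without loss of generality, as both
  sets are finite. The shift by one in the logarithm only matters for the empty word.\<close>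

definition pl_turing_reducible :: "param_problem \<Rightarrow> param_problem \<Rightarrow> bool" where
  "pl_turing_reducible = (\<lambda>(Q, \<kappa>) (Q', \<kappa>').
     \<exists>(M :: (nat, nat) otm) f g (C :: nat). wf_otm M \<and> computable f \<and> computable g \<and>
       decides M Q' Q \<and>
       (\<forall>x. space_within M Q' x (real (f (\<kappa> x)) + real C * log 2 (real (length x + 1)))) \<and>
       (\<forall>x. \<forall>y \<in> queried M Q' x. \<kappa>' y \<le> g (\<kappa> x)))"


section \<open>Encodings\<close>

definition block :: "bool list \<Rightarrow> sym list" where
  "block bs = map (\<lambda>b. if b then One else Zero) bs @ [Sep]"

text \<open>Binary representation, least significant digit first, without superfluous zeros.\<close>

fun binary :: "nat \<Rightarrow> bool list" where
  "binary n = (if n = 0 then [] else odd n # binary (n div 2))"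

declare binary.simps [simp del]

definition enc_matrix :: "nat \<Rightarrow> (nat \<times> nat) set \<Rightarrow> sym list" where
  "enc_matrix n X = concat (map (\<lambda>i. block (map (\<lambda>j. (i, j) \<in> X) [0..<n])) [0..<n])"

text \<open>Structures and graphs that are given as inputs have \<open>{..<n}\<close> as the set of elements,
  respectively vertices.\<close>

definition input_structure :: "nat struct \<Rightarrow> bool" where
  "input_structure S \<longleftrightarrow> finite_structure S \<and> univ S = {..<card (univ S)}"

definition enc_structure :: "nat struct \<Rightarrow> sym list" where
  "enc_structure S = (let n = card (univ S) in
     block (map (\<lambda>i. [i] \<in> interp S Root) [0..<n]) @
     enc_matrix n {(i, j). [i, j] \<in> interp S Edge})"

definition enc_emb :: "nat struct \<Rightarrow> nat struct \<Rightarrow> sym list" where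
  "enc_emb A B = enc_structure A @ [Sep] @ enc_structure B"

definition input_graph :: "nat pair_pre_digraph \<Rightarrow> bool" where
  "input_graph G \<longleftrightarrow> pair_graph G \<and> pverts G = {..<card (pverts G)}"

definition enc_longshort :: "nat pair_pre_digraph \<Rightarrow> nat \<Rightarrow> nat \<Rightarrow> nat \<Rightarrow> nat \<Rightarrow> sym list" where
  "enc_longshort G s t k l = enc_matrix (card (pverts G)) (parcs G) @ [Sep] @
     block (binary s) @ block (binary t) @ block (binary k) @ block (binary l)"


section \<open>The two problems\<close>

text \<open>Words that do not encode an instance are no-instances with parameter 0. The parameter of
  an encoded pair of structures does not depend on whether the first one is in the class.\<close>

definition p_emb :: "nat struct set \<Rightarrow> param_problem" where
  "p_emb \<A> =
     ({enc_emb A B | A B. A \<in> \<A> \<and> input_structure A \<and> input_structure B \<and>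
                          (\<exists>h. embedding h A B)},
      \<lambda>x. if \<exists>A B. input_structure A \<and> input_structure B \<and> x = enc_emb A B
          then THE m. \<exists>A B. input_structure A \<and> input_structure B \<and> x = enc_emb A B \<and>
                            m = card (univ A)
          else 0)"

definition longshort_instance ::
    "nat pair_pre_digraph \<Rightarrow> nat \<Rightarrow> nat \<Rightarrow> nat \<Rightarrow> nat \<Rightarrow> bool" where
  "longshort_instance G s t k l \<longleftrightarrow>
     input_graph G \<and> s \<in> pverts G \<and> t \<in> pverts G \<and> k < l"

text \<open>The length of a path is its number of edges.\<close>

definition p_longshort :: param_problem where
  "p_longshort =
     ({enc_longshort G s t k l | G s t k l. longshort_instance G s t k l \<and>
         ((\<exists>v p. pre_digraph.apath (with_proj G) s p v \<and> length p \<ge> l) \<or>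
          (\<exists>p. pre_digraph.apath (with_proj G) s p t \<and> length p = k))},
      \<lambda>x. if \<exists>G s t k l. longshort_instance G s t k l \<and> x = enc_longshort G s t k l
          then THE l. \<exists>G s t k. longshort_instance G s t k l \<and> x = enc_longshort G s t k l
          else 0)"

end

theory Submission
  imports Defs "HOL-Library.Countable"
begin

text \<open>The class consists of the paths with \<open>l\<close> edges, rooted at one end, whose edges are all
  symmetric except that the edge from vertex \<open>k\<close> to vertex \<open>k + 1\<close> is directed. Given a graph with
  vertices \<open>s\<close> and \<open>t\<close>, put the root at \<open>s\<close> and attach to \<open>t\<close> by a directed edge a symmetric path
  with \<open>l - k - 1\<close> edges. An embedding that stays in the graph is a path of length \<open>l\<close>; one that
  leaves it must do so along the directed edge after exactly \<open>k\<close> steps.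

  Conversely, an embedding into an arbitrary structure consists of a path \<open>p\<close> of length \<open>k\<close> from
  the root in the symmetric part, an edge, and a path \<open>q\<close> of length \<open>l - k - 1\<close> disjoint from \<open>p\<close>.
  Disjointness is enforced by colour coding: the oracle is asked for \<open>p\<close> among the vertices of one
  colour and for \<open>q\<close> among those of the other. That the first query also accepts paths of length
  \<open>l\<close> does no harm, as these contain the whole pattern. A colouring is given by a set of positions
  in the binary representation of a vertex and a table that maps the bits at these positions to
  colours; since \<open>l + 1\<close> numbers are distinguished by their bits at some \<open>l + 1\<close> positions, a mask of
  logarithmic length and a table whose length depends only on \<open>l\<close> suffice.

  For the space bounds, number-valued functions of the input are closed under composition and
  under primitive recursion with polynomially bounded values, because these need only a fixed
  number of polynomially bounded binary counters.\<close>

section \<open>Counter programs\<close>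

text \<open>Two obstacles shape the proof. First, some numbers are too large to be computed: the
  bound \<open>l\<close> of a longshort instance is given in binary, and the number of colour tables
  is doubly exponential in the parameter. The former is capped, because a path has fewer edges than
  the graph has vertices. Second, words do not fit on the work tapes. A query is therefore a
  function from positions to symbols, and the input is not parsed: the parts of an instance are
  guessed as digits of the round number, encoded again and compared with the input symbol by symbol.
  The directed edge is what makes \<open>k\<close> exact. The size of the attached path only
  prevents an embedding from leaving the graph before step \<open>k\<close>, as too few vertices
  would be left; with a symmetric edge it could still leave later.\<close>

datatype com = Inc nat | Dec nat | Mv dir | Emit sym | Ask nat | Seq com com
  | IfZ nat com com | IfIn input_sym com com | While nat com | Halt bool

type_synonym cstate = "(nat \<Rightarrow> nat) \<times> nat \<times> sym list"

text \<open>An increment at the limit \<open>V\<close> and a query that violates \<open>ok\<close>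
  have no derivation. A derivation thus certifies termination, the size of the counters and the
  admissibility of the queries at once. \<open>Halt\<close> has no rule: it only marks the final
  stacks of the machine.\<close>

inductive exec :: "sym list \<Rightarrow> sym list set \<Rightarrow> (sym list \<Rightarrow> bool) \<Rightarrow> nat \<Rightarrow>
    com \<Rightarrow> cstate \<Rightarrow> cstate \<Rightarrow> bool"
  for x Q ok V where
  Inc: "\<rho> r < V \<Longrightarrow> exec x Q ok V (Inc r) (\<rho>, p, w) (\<rho>(r := Suc (\<rho> r)), p, w)"
| Dec: "\<rho> r > 0 \<Longrightarrow> exec x Q ok V (Dec r) (\<rho>, p, w) (\<rho>(r := \<rho> r - 1), p, w)"
| Mv: "exec x Q ok V (Mv d) (\<rho>, p, w) (\<rho>, min (move d p) (Suc (length x)), w)"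
| Emit: "exec x Q ok V (Emit s) (\<rho>, p, w) (\<rho>, p, w @ [s])"
| AskYes: "ok w \<Longrightarrow> w \<in> Q \<Longrightarrow> \<rho> r < V \<Longrightarrow>
    exec x Q ok V (Ask r) (\<rho>, p, w) (\<rho>(r := Suc (\<rho> r)), p, [])"
| AskNo: "ok w \<Longrightarrow> w \<notin> Q \<Longrightarrow> exec x Q ok V (Ask r) (\<rho>, p, w) (\<rho>, p, [])"
| Seq: "exec x Q ok V c1 s s' \<Longrightarrow> exec x Q ok V c2 s' s'' \<Longrightarrow> exec x Q ok V (Seq c1 c2) s s''"
| IfZ0: "\<rho> r = 0 \<Longrightarrow> exec x Q ok V c1 (\<rho>, p, w) s' \<Longrightarrow> exec x Q ok V (IfZ r c1 c2) (\<rho>, p, w) s'"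
| IfZ1: "\<rho> r > 0 \<Longrightarrow> exec x Q ok V c2 (\<rho>, p, w) s' \<Longrightarrow> exec x Q ok V (IfZ r c1 c2) (\<rho>, p, w) s'"
| IfIn1: "read_input x p = a \<Longrightarrow> exec x Q ok V c1 (\<rho>, p, w) s' \<Longrightarrow>
    exec x Q ok V (IfIn a c1 c2) (\<rho>, p, w) s'"
| IfIn2: "read_input x p \<noteq> a \<Longrightarrow> exec x Q ok V c2 (\<rho>, p, w) s' \<Longrightarrow>
    exec x Q ok V (IfIn a c1 c2) (\<rho>, p, w) s'"
| While0: "\<rho> r = 0 \<Longrightarrow> exec x Q ok V (While r c) (\<rho>, p, w) (\<rho>, p, w)"
| While1: "\<rho> r > 0 \<Longrightarrow> exec x Q ok V c (\<rho>, p, w) s' \<Longrightarrow> exec x Q ok V (While r c) s' s'' \<Longrightarrow>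
    exec x Q ok V (While r c) (\<rho>, p, w) s''"

fun regs :: "com \<Rightarrow> nat set" where
  "regs (Inc r) = {r}"
| "regs (Dec r) = {r}"
| "regs (Ask r) = {r}"
| "regs (Seq a b) = regs a \<union> regs b"
| "regs (IfZ r a b) = insert r (regs a \<union> regs b)"
| "regs (IfIn _ a b) = regs a \<union> regs b"
| "regs (While r a) = insert r (regs a)"
| "regs _ = {}"

text \<open>The second argument is the list of commands that remain to be executed afterwards.\<close>

fun stacks :: "com \<Rightarrow> com list \<Rightarrow> com list set" where
  "stacks (Ask r) K = {Ask r # K, Inc r # K, K}"
| "stacks (Seq a b) K = {Seq a b # K} \<union> stacks a (b # K) \<union> stacks b K"
| "stacks (IfZ r a b) K = {IfZ r a b # K} \<union> stacks a K \<union> stacks b K"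
| "stacks (IfIn i a b) K = {IfIn i a b # K} \<union> stacks a K \<union> stacks b K"
| "stacks (While r a) K = {While r a # K, K} \<union> stacks a (While r a # K)"
| "stacks c K = {c # K, K}"

fun asks :: "com \<Rightarrow> com list \<Rightarrow> com list set" where
  "asks (Ask r) K = {Ask r # K}"
| "asks (Seq a b) K = asks a (b # K) \<union> asks b K"
| "asks (IfZ r a b) K = asks a K \<union> asks b K"
| "asks (IfIn i a b) K = asks a K \<union> asks b K"
| "asks (While r a) K = asks a (While r a # K)"
| "asks c K = {}"

fun next_stacks :: "com list \<Rightarrow> com list set" where
  "next_stacks [] = {[]}"
| "next_stacks (Seq a b # K) = {a # b # K}"
| "next_stacks (IfZ r a b # K) = {a # K, b # K}"
| "next_stacks (IfIn i a b # K) = {a # K, b # K}"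
| "next_stacks (While r a # K) = {a # While r a # K, K}"
| "next_stacks (Ask r # K) = {K, Inc r # K}"
| "next_stacks (c # K) = {K}"

lemma finite_regs: "finite (regs c)"
  by (induction c) auto

lemma finite_stacks: "finite (stacks c K)"
  by (induction c K rule: stacks.induct) auto

lemma stacks_start: "c # K \<in> stacks c K" and stacks_end: "K \<in> stacks c K"
  by (induction c K rule: stacks.induct) auto

text \<open>For \<open>K = []\<close> this yields a finite state space closed under transitions, the
  empty stack being its own successor. The tail \<open>K\<close> is exempt because its successors
  belong to the surrounding program.\<close>

lemma next_stacks_closed: "st \<in> stacks c K \<Longrightarrow> st = K \<or> next_stacks st \<subseteq> stacks c K"
proof (induction c K rule: stacks.induct)
  case (2 a b K)
  then show ?case using stacks_start[of a "b # K"] stacks_start[of b K] by auto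
next
  case (3 r a b K)
  then show ?case using stacks_start[of a K] stacks_start[of b K] by auto
next
  case (4 i a b K)
  then show ?case using stacks_start[of a K] stacks_start[of b K] by auto
next
  case (5 r a K)
  then show ?case using stacks_start[of a "While r a # K"] by auto
qed auto

section \<open>Running counter programs on a Turing machine\<close>

fun digits_val :: "bool list \<Rightarrow> nat" where
  "digits_val [] = 0"
| "digits_val (b # ds) = of_bool b + 2 * digits_val ds"

fun digits_inc :: "bool list \<Rightarrow> bool list" where
  "digits_inc [] = [True]"
| "digits_inc (False # ds) = True # ds"
| "digits_inc (True # ds) = False # digits_inc ds"

text \<open>Leading zeros are kept. A value therefore has several representations, and a zero test
  has to look for a digit \<open>True\<close> instead of an empty list.\<close>

fun digits_dec :: "bool list \<Rightarrow> bool list" where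
  "digits_dec [] = []"
| "digits_dec (True # ds) = False # ds"
| "digits_dec (False # ds) = True # digits_dec ds"

lemma digits_val_inc: "digits_val (digits_inc ds) = Suc (digits_val ds)"
  by (induction ds rule: digits_inc.induct) auto

lemma digits_val_dec: "digits_val ds > 0 \<Longrightarrow> digits_val (digits_dec ds) = digits_val ds - 1"
  by (induction ds rule: digits_dec.induct) auto

lemma length_digits_dec: "length (digits_dec ds) = length ds"
  by (induction ds rule: digits_dec.induct) auto

text \<open>A digit is appended only if all old ones are \<open>True\<close>, so the space of a
  counter depends on the largest value reached and not on the number of increments.\<close>

lemma length_digits_inc:
  "length (digits_inc ds) = length ds \<or>
   length (digits_inc ds) = Suc (length ds) \<and> Suc (digits_val ds) = 2 ^ length ds"
  by (induction ds rule: digits_inc.induct) auto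

lemma length_digits_inc_le:
  assumes "length ds \<le> L" "digits_val ds < V" "V < 2 ^ L"
  shows "length (digits_inc ds) \<le> L"
proof -
  have "length ds \<noteq> L" if "Suc (digits_val ds) = 2 ^ length ds"
    using assms that by auto
  then show ?thesis
    using length_digits_inc[of ds] assms(1) by auto
qed

definition digit :: "bool \<Rightarrow> nat" where
  "digit b = (if b then 2 else 1)"

text \<open>The digits of a counter start in cell 1. Cell 0 stays blank and is thereby recognized
  by a head that returns from the right.\<close>

definition tape :: "bool list \<Rightarrow> nat \<Rightarrow> nat" where
  "tape ds i = (case i of 0 \<Rightarrow> 0 | Suc j \<Rightarrow> if j < length ds then digit (ds ! j) else 0)"

lemma tape_0 [simp]: "tape ds 0 = 0"
  by (simp add: tape_def)

lemma tape_nth [simp]: "tape (pre @ b # ds) (Suc (length pre)) = digit b"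
  by (simp add: tape_def)

lemma tape_end [simp]: "tape ds (Suc (length ds)) = 0"
  by (simp add: tape_def)

lemma tape_write [simp]:
  "(tape (pre @ b # ds))(Suc (length pre) := digit b') = tape (pre @ b' # ds)"
  by (rule ext) (auto simp: tape_def nth_append nth_Cons split: nat.split)

lemma tape_extend [simp]: "(tape ds)(Suc (length ds) := digit b) = tape (ds @ [b])"
  by (rule ext) (auto simp: tape_def nth_append split: nat.split)

text \<open>A command on register \<open>r\<close> is one sweep: the head leaves cell 0 in a scan
  state and comes home in \<open>Back\<close>. Between commands, in \<open>Run\<close>, all heads
  rest on cell 0.\<close>

datatype ctl = Run "com list" | IncScan nat "com list" | DecScan nat "com list"
  | TestScan nat "com list" "com list" | Back nat "com list"

instance dir :: countable by countable_datatype
instance sym :: countable by countable_datatype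
instance input_sym :: countable by countable_datatype
instance com :: countable by countable_datatype
instance ctl :: countable by countable_datatype

definition stay_acts :: "nat list \<Rightarrow> (nat \<times> dir) list" where
  "stay_acts gs = map (\<lambda>g. (g, Stay)) gs"

text \<open>The last case of \<open>IncScan\<close> covers a digit \<open>False\<close> as well as
  the blank behind the last digit. Both absorb the carry; in the second case the counter becomes
  longer by one cell.\<close>

fun ctl_delta :: "ctl \<Rightarrow> input_sym \<Rightarrow> nat list \<Rightarrow> ctl \<times> dir \<times> (nat \<times> dir) list \<times> sym option" where
  "ctl_delta (Run []) a gs = (Run [], Stay, stay_acts gs, None)"
| "ctl_delta (Run (Inc r # K)) a gs = (IncScan r K, Stay, (stay_acts gs)[r := (gs ! r, GoRight)], None)"
| "ctl_delta (Run (Dec r # K)) a gs = (DecScan r K, Stay, (stay_acts gs)[r := (gs ! r, GoRight)], None)"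
| "ctl_delta (Run (Mv d # K)) a gs = (Run K, d, stay_acts gs, None)"
| "ctl_delta (Run (Emit s # K)) a gs = (Run K, Stay, stay_acts gs, Some s)"
| "ctl_delta (Run (Seq c1 c2 # K)) a gs = (Run (c1 # c2 # K), Stay, stay_acts gs, None)"
| "ctl_delta (Run (IfZ r c1 c2 # K)) a gs =
     (TestScan r (c1 # K) (c2 # K), Stay, (stay_acts gs)[r := (gs ! r, GoRight)], None)"
| "ctl_delta (Run (IfIn i c1 c2 # K)) a gs =
     (Run ((if a = i then c1 else c2) # K), Stay, stay_acts gs, None)"
| "ctl_delta (Run (While r c # K)) a gs =
     (TestScan r K (c # While r c # K), Stay, (stay_acts gs)[r := (gs ! r, GoRight)], None)"
| "ctl_delta (Run (Ask r # K)) a gs = (Run K, Stay, stay_acts gs, None)"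
| "ctl_delta (Run (Halt b # K)) a gs = (Run K, Stay, stay_acts gs, None)"
| "ctl_delta (IncScan r K) a gs =
     (if gs ! r = digit True then (IncScan r K, Stay, (stay_acts gs)[r := (digit False, GoRight)], None)
      else (Back r K, Stay, (stay_acts gs)[r := (digit True, GoLeft)], None))"
| "ctl_delta (DecScan r K) a gs =
     (if gs ! r = digit False then (DecScan r K, Stay, (stay_acts gs)[r := (digit True, GoRight)], None)
      else (Back r K, Stay, (stay_acts gs)[r := (digit False, GoLeft)], None))"
| "ctl_delta (TestScan r K0 K1) a gs =
     (if gs ! r = digit False then (TestScan r K0 K1, Stay, (stay_acts gs)[r := (gs ! r, GoRight)], None)
      else if gs ! r = digit True then (Back r K1, Stay, (stay_acts gs)[r := (gs ! r, GoLeft)], None)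
      else (Back r K0, Stay, (stay_acts gs)[r := (gs ! r, GoLeft)], None))"
| "ctl_delta (Back r K) a gs =
     (if gs ! r = 0 then (Run K, Stay, stay_acts gs, None)
      else (Back r K, Stay, (stay_acts gs)[r := (gs ! r, GoLeft)], None))"

text \<open>As a machine has just one query state, programs may contain \<^const>\<open>Ask\<close> only once;
  the argument \<open>qr # qK\<close> is the stack at this point.\<close>

definition prog_otm :: "com \<Rightarrow> nat \<Rightarrow> nat \<Rightarrow> com list \<Rightarrow> (ctl, nat) otm" where
  "prog_otm P N qr qK = (let S = stacks P [] in
    \<lparr> states = Run ` S \<union> (\<lambda>(r, K). IncScan r K) ` ({..<N} \<times> S) \<union> (\<lambda>(r, K). DecScan r K) ` ({..<N} \<times> S)
        \<union> (\<lambda>(r, K, K'). TestScan r K K') ` ({..<N} \<times> S \<times> S) \<union> (\<lambda>(r, K). Back r K) ` ({..<N} \<times> S),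
      start = Run [P], accept = Run [Halt True], reject = Run [Halt False],
      query = Run (Ask qr # qK), answer_yes = Run (Inc qr # qK), answer_no = Run qK,
      tape_count = N, alphabet = {0, digit True, digit False}, blank = 0, delta = ctl_delta \<rparr>)"

lemma digit_simps [simp]: "digit b \<noteq> 0" "0 \<noteq> digit b" "digit b = digit b' \<longleftrightarrow> b = b'"
  by (auto simp: digit_def)

lemma regs_stacks: "st \<in> stacks c K \<Longrightarrow> (\<Union>(regs ` set st)) \<subseteq> regs c \<union> (\<Union>(regs ` set K))"
proof (induction c K arbitrary: st rule: stacks.induct)
  case (2 a b K)
  then show ?case by fastforce
next
  case (3 r a b K)
  then show ?case by fastforce
next
  case (4 i a b K)
  then show ?case by fastforce
next
  case (5 r a K)
  then show ?case by fastforce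
qed auto

lemma wf_prog_otm:
  assumes "regs P \<subseteq> {..<N}" and "{Ask qr # qK, [Halt True], [Halt False]} \<subseteq> stacks P []"
  shows "wf_otm (prog_otm P N qr qK)"
proof -
  define S where "S = stacks P []"
  have nxt: "next_stacks st \<subseteq> S" if "st \<in> S" for st
    using next_stacks_closed[of st P "[]"] that stacks_end[of "[]" P] unfolding S_def by auto
  have reg: "r < N" if "c # st \<in> S" "r \<in> regs c" for c st r
    using regs_stacks[of "c # st" P "[]"] that assms(1) unfolding S_def by auto
  have S: "[P] \<in> S" "[] \<in> S" "finite S" "Ask qr # qK \<in> S" "[Halt True] \<in> S" "[Halt False] \<in> S"
    using assms(2) stacks_start stacks_end finite_stacks unfolding S_def by auto
  have ans: "Inc qr # qK \<in> S" "qK \<in> S"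
    using nxt[OF S(4)] by auto
  have delta: "case ctl_delta q a gs of (q', d, acts, out) \<Rightarrow>
      q' \<in> states (prog_otm P N qr qK) \<and> length acts = N \<and>
      fst ` set acts \<subseteq> {0, digit True, digit False}"
    if q: "q \<in> states (prog_otm P N qr qK)" and gs: "length gs = N" "set gs \<subseteq> {0, digit True, digit False}"
    for q a gs
  proof -
    have stay: "fst ` set (stay_acts gs) \<subseteq> {0, digit True, digit False}" "length (stay_acts gs) = N"
      using gs by (auto simp: stay_acts_def)
    have upd: "fst ` set ((stay_acts gs)[r := (g, d)]) \<subseteq> {0, digit True, digit False}"
      if "g \<in> {0, digit True, digit False}" for r g d
      using stay(1) that subset_trans[OF image_mono[OF set_update_subset_insert[of "stay_acts gs" r "(g, d)"], of fst],
          of "{0, digit True, digit False}"]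
      by auto
    have nth: "gs ! r \<in> {0, digit True, digit False}" if "r < N" for r
      using that gs nth_mem[of r gs] by blast
    from q consider (run) st where "q = Run st" "st \<in> S"
      | (inc) r K where "q = IncScan r K" "r < N" "K \<in> S"
      | (dec) r K where "q = DecScan r K" "r < N" "K \<in> S"
      | (test) r K0 K1 where "q = TestScan r K0 K1" "r < N" "K0 \<in> S" "K1 \<in> S"
      | (return) r K where "q = Back r K" "r < N" "K \<in> S"
      by (auto simp: prog_otm_def S_def Let_def)
    then show ?thesis
    proof cases
      case run
      show ?thesis
      proof (cases st)
        case Nil
        then show ?thesis using run S stay by (auto simp: prog_otm_def S_def Let_def)
      next
        case (Cons c K)
        note n = nxt[OF run(2)]
        have r: "\<And>r. r \<in> regs c \<Longrightarrow> r < N" using reg run(2) Cons by auto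
        show ?thesis
          using n r run(1) Cons stay upd[OF nth] stay(2)
          by (cases c) (auto simp: prog_otm_def S_def Let_def image_iff split: if_splits)
      qed
    next
      case inc
      then show ?thesis using stay upd upd[OF nth]
        by (auto simp: prog_otm_def S_def Let_def)
    next
      case dec
      then show ?thesis using stay upd upd[OF nth]
        by (auto simp: prog_otm_def S_def Let_def)
    next
      case test
      then show ?thesis using stay upd upd[OF nth]
        by (auto simp: prog_otm_def S_def Let_def image_iff)
    next
      case return
      then show ?thesis using stay upd upd[OF nth]
        by (auto simp: prog_otm_def S_def Let_def)
    qed
  qed
  have fin: "finite (states (prog_otm P N qr qK))"
    using S(3) by (auto simp: prog_otm_def S_def Let_def)
  show ?thesis
    unfolding wf_otm_def using fin S ans delta
    by (auto simp: prog_otm_def S_def Let_def)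
qed

section \<open>Simulation of a program by its machine\<close>

locale prog_run =
  fixes P :: com and N qr :: nat and qK :: "com list" and x :: "sym list" and Q :: "sym list set"
    and ok :: "sym list \<Rightarrow> bool" and V L :: nat
  assumes V_less: "V < 2 ^ L"
begin

abbreviation "M \<equiv> prog_otm P N qr qK"

definition good :: "(ctl, nat) config \<Rightarrow> bool" where
  "good c \<longleftrightarrow> (\<forall>(h, t) \<in> set (work c). h \<le> Suc L) \<and> (state c = query M \<longrightarrow> ok (oracle_tape c))"

text \<open>Goodness is demanded of every configuration that is left but not of the last one, so
  that computations can be concatenated.\<close>

abbreviation reach :: "(ctl, nat) config \<Rightarrow> (ctl, nat) config \<Rightarrow> bool" where
  "reach \<equiv> (\<lambda>c d. good c \<and> d = step M Q x c)\<^sup>*\<^sup>*"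

definition cfg :: "ctl \<Rightarrow> nat \<Rightarrow> (nat \<times> (nat \<Rightarrow> nat)) list \<Rightarrow> sym list \<Rightarrow> (ctl, nat) config" where
  "cfg q p wk w = \<lparr> state = q, input_pos = p, work = wk, oracle_tape = w \<rparr>"

definition tapes :: "bool list list \<Rightarrow> (nat \<times> (nat \<Rightarrow> nat)) list" where
  "tapes D = map (\<lambda>ds. (0, tape ds)) D"

definition small :: "(nat \<times> (nat \<Rightarrow> nat)) list \<Rightarrow> bool" where
  "small wk \<longleftrightarrow> (\<forall>(h, t) \<in> set wk. h \<le> Suc L)"

lemma good_cfg: "good (cfg q p wk w) \<longleftrightarrow> small wk \<and> (q = query M \<longrightarrow> ok w)"
  by (simp add: good_def cfg_def small_def)

lemma small_tapes [simp]: "small (tapes D)"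
  by (auto simp: small_def tapes_def)

lemma length_tapes [simp]: "length (tapes D) = length D"
  by (simp add: tapes_def)

lemma nth_tapes: "r < length D \<Longrightarrow> tapes D ! r = (0, tape (D ! r))"
  by (simp add: tapes_def)

lemma small_upd: "small wk \<Longrightarrow> h \<le> Suc L \<Longrightarrow> small (wk[r := (h, t)])"
  using set_update_subset_insert[of wk r "(h, t)"] unfolding small_def by auto

lemma stay_work: "map2 (\<lambda>(h, t) (g, e). (move e h, t(h := g))) wk
    (stay_acts (map (\<lambda>(h, t). t h) wk)) = (wk :: (nat \<times> (nat \<Rightarrow> nat)) list)"
  by (rule nth_equalityI) (auto simp: stay_acts_def split: prod.split)

lemma update_work:
  assumes "r < length wk" "wk ! r = (h, t)"
  shows "map2 (\<lambda>(h, t) (g, e). (move e h, t(h := g))) wk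
    ((stay_acts (map (\<lambda>(h, t). t h) wk))[r := (g, d)]) = wk[r := (move d h, t(h := g :: nat))]"
  using assms by (intro nth_equalityI) (auto simp: stay_acts_def nth_list_update split: prod.split)

lemma step_cfg:
  assumes "q \<notin> {Run [Halt True], Run [Halt False], query M}"
    "ctl_delta q (read_input x p) (map (\<lambda>(h, t). t h) wk) = (q', d, acts, out)"
  shows "step M Q x (cfg q p wk w) = cfg q' (min (move d p) (Suc (length x)))
    (map2 (\<lambda>(h, t) (g, e). (move e h, t(h := g))) wk acts) (w @ (case out of None \<Rightarrow> [] | Some b \<Rightarrow> [b]))"
  using assms by (simp add: step_def cfg_def prog_otm_def Let_def)

lemma reach_step:
  assumes "q \<notin> {Run [Halt True], Run [Halt False], query M}" "small wk"
    "ctl_delta q (read_input x p) (map (\<lambda>(h, t). t h) wk) = (q', d, acts, out)"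
    "reach (cfg q' (min (move d p) (Suc (length x)))
    (map2 (\<lambda>(h, t) (g, e). (move e h, t(h := g))) wk acts) (w @ (case out of None \<Rightarrow> [] | Some b \<Rightarrow> [b]))) c"
  shows "reach (cfg q p wk w) c"
  by (rule converse_rtranclp_into_rtranclp[OF _ assms(4)])
    (use assms in \<open>simp add: step_cfg good_cfg\<close>)

lemma reach_stay:
  assumes "q \<notin> {Run [Halt True], Run [Halt False], query M}" "small wk" "p \<le> Suc (length x)"
    "ctl_delta q (read_input x p) (map (\<lambda>(h, t). t h) wk) =
      (q', Stay, stay_acts (map (\<lambda>(h, t). t h) wk), None)"
    "reach (cfg q' p wk w) c"
  shows "reach (cfg q p wk w) c"
  by (rule reach_step[OF assms(1,2,4)]) (use assms in \<open>simp add: stay_work\<close>)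

lemma reach_update:
  assumes "q \<notin> {Run [Halt True], Run [Halt False], query M}" "small wk" "p \<le> Suc (length x)"
    "r < length wk" "wk ! r = (h, t)"
    "ctl_delta q (read_input x p) (map (\<lambda>(h, t). t h) wk) =
      (q', Stay, (stay_acts (map (\<lambda>(h, t). t h) wk))[r := (g, d)], None)"
    "reach (cfg q' p (wk[r := (move d h, t(h := g))]) w) c"
  shows "reach (cfg q p wk w) c"
  by (rule reach_step[OF assms(1,2,6)]) (use assms in \<open>simp add: update_work\<close>)

lemma query_M: "query M = Run (Ask qr # qK)"
  by (simp add: prog_otm_def Let_def)

context
  fixes D :: "bool list list" and r p :: nat and w :: "sym list"
  assumes r: "r < length D" and p: "p \<le> Suc (length x)"
begin

abbreviation wk :: "nat \<Rightarrow> bool list \<Rightarrow> (nat \<times> (nat \<Rightarrow> nat)) list" where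
  "wk h ds \<equiv> (tapes D)[r := (h, tape ds)]"

lemma wk_facts:
  "r < length (wk h ds)" "wk h ds ! r = (h, tape ds)" "(wk h ds)[r := u] = (tapes D)[r := u]"
  "map (\<lambda>(h, t). t h) (wk h ds) ! r = tape ds h"
  "h \<le> Suc L \<Longrightarrow> small (wk h ds)"
  using r small_upd[OF small_tapes] by (auto simp: tapes_def)

lemma reach_back:
  assumes "h \<le> length ds" "h \<le> L"
  shows "reach (cfg (Back r K) p (wk h ds) w) (cfg (Run K) p (wk 0 ds) w)"
  using assms
proof (induction h)
  case 0
  show ?case
    by (rule reach_stay) (use p wk_facts[of 0 ds] in \<open>auto simp: query_M\<close>)
next
  case (Suc h)
  have nz: "tape ds (Suc h) \<noteq> 0"
    using Suc.prems by (simp add: tape_def)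
  show ?case
    by (rule reach_update[where r = r and h = "Suc h" and t = "tape ds"
        and q' = "Back r K" and g = "tape ds (Suc h)" and d = GoLeft])
      (use p wk_facts[of _ ds] nz Suc in \<open>auto simp: query_M\<close>)
qed

text \<open>The list \<open>pre\<close> holds the digits already passed. A carry moves one digit
  from the front of \<open>ds\<close> to the end of \<open>pre\<close>, which is why
  \<open>pre\<close> is generalized in the induction.\<close>

lemma reach_inc_scan:
  assumes "length (pre @ digits_inc ds) \<le> L"
  shows "reach (cfg (IncScan r K) p (wk (Suc (length pre)) (pre @ ds)) w)
    (cfg (Run K) p (wk 0 (pre @ digits_inc ds)) w)"
  using assms
proof (induction ds arbitrary: pre rule: digits_inc.induct)
  case 1
  show ?case
    by (rule reach_update[where r = r and h = "Suc (length pre)" and t = "tape (pre @ [])"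
        and q' = "Back r K" and g = "digit True" and d = GoLeft])
      (use p wk_facts 1 reach_back[of "length pre" "pre @ [True]"] in \<open>auto simp: query_M simp del: fun_upd_apply\<close>)
next
  case (2 ds)
  show ?case
    by (rule reach_update[where r = r and h = "Suc (length pre)" and t = "tape (pre @ False # ds)"
        and q' = "Back r K" and g = "digit True" and d = GoLeft])
      (use p wk_facts 2 reach_back[of "length pre" "pre @ True # ds"] in
        \<open>auto simp: query_M simp del: fun_upd_apply\<close>)
next
  case (3 ds)
  show ?case
    by (rule reach_update[where r = r and h = "Suc (length pre)" and t = "tape (pre @ True # ds)"
        and q' = "IncScan r K" and g = "digit False" and d = GoRight])
      (use p wk_facts 3(1)[of "pre @ [False]"] 3(2) in \<open>auto simp: query_M\<close>)
qed

lemma reach_dec_scan: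
  assumes "length (pre @ ds) \<le> L" "digits_val ds > 0"
  shows "reach (cfg (DecScan r K) p (wk (Suc (length pre)) (pre @ ds)) w)
    (cfg (Run K) p (wk 0 (pre @ digits_dec ds)) w)"
  using assms
proof (induction ds arbitrary: pre rule: digits_dec.induct)
  case (2 ds)
  show ?case
    by (rule reach_update[where r = r and h = "Suc (length pre)" and t = "tape (pre @ True # ds)"
        and q' = "Back r K" and g = "digit False" and d = GoLeft])
      (use p wk_facts 2 reach_back[of "length pre" "pre @ False # ds"] in
        \<open>auto simp: query_M simp del: fun_upd_apply\<close>)
next
  case (3 ds)
  show ?case
    by (rule reach_update[where r = r and h = "Suc (length pre)" and t = "tape (pre @ False # ds)"
        and q' = "DecScan r K" and g = "digit True" and d = GoRight])
      (use p wk_facts 3(1)[of "pre @ [True]"] 3(2,3) in \<open>auto simp: query_M\<close>)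
qed simp

lemma reach_test_scan:
  assumes "length (pre @ ds) \<le> L"
  shows "reach (cfg (TestScan r K0 K1) p (wk (Suc (length pre)) (pre @ ds)) w)
    (cfg (Run (if digits_val ds = 0 then K0 else K1)) p (wk 0 (pre @ ds)) w)"
  using assms
proof (induction ds arbitrary: pre)
  case Nil
  show ?case
    by (rule reach_update[where r = r and h = "Suc (length pre)" and t = "tape (pre @ [])"
        and q' = "Back r K0" and g = 0 and d = GoLeft])
      (use p wk_facts Nil reach_back[of "length pre" pre] in \<open>auto simp: query_M fun_upd_idem\<close>)
next
  case (Cons b ds)
  show ?case
  proof (cases b)
    case True
    show ?thesis
      by (rule reach_update[where r = r and h = "Suc (length pre)" and t = "tape (pre @ b # ds)"
          and q' = "Back r K1" and g = "digit True" and d = GoLeft])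
        (use p wk_facts Cons.prems True reach_back[of "length pre" "pre @ b # ds"] in
          \<open>auto simp: query_M simp del: fun_upd_apply\<close>)
  next
    case False
    show ?thesis
      by (rule reach_update[where r = r and h = "Suc (length pre)" and t = "tape (pre @ b # ds)"
          and q' = "TestScan r K0 K1" and g = "digit False" and d = GoRight])
        (use p wk_facts Cons.IH[of "pre @ [b]"] Cons.prems False in \<open>auto simp: query_M\<close>)
  qed
qed

lemma reach_start_scan:
  assumes "q \<notin> {Run [Halt True], Run [Halt False], query M}" "tapes D ! r = (0, tape ds)"
    "ctl_delta q (read_input x p) (map (\<lambda>(h, t). t h) (tapes D)) =
      (q', Stay, (stay_acts (map (\<lambda>(h, t). t h) (tapes D)))[r := (map (\<lambda>(h, t). t h) (tapes D) ! r, GoRight)], None)"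
    "reach (cfg q' p (wk (Suc 0) ds) w) c"
  shows "reach (cfg q p (tapes D) w) c"
  by (rule reach_update[where r = r and h = 0 and t = "tape ds" and g = 0 and d = GoRight])
    (use assms p r in \<open>auto simp: fun_upd_idem\<close>)

end

text \<open>A relation and not a function, because of leading zeros; accordingly \<open>sim\<close>
  starts from an arbitrary representation and ends in some representation. The length bound is the
  space invariant.\<close>

definition rel :: "bool list list \<Rightarrow> (nat \<Rightarrow> nat) \<Rightarrow> bool" where
  "rel D \<rho> \<longleftrightarrow> length D = N \<and> (\<forall>r<N. digits_val (D ! r) = \<rho> r) \<and> (\<forall>ds \<in> set D. length ds \<le> L)"

definition sim :: "com list \<Rightarrow> com list \<Rightarrow> cstate \<Rightarrow> cstate \<Rightarrow> bool" where
  "sim K K' = (\<lambda>(\<rho>, p, w) (\<rho>', p', w'). \<forall>D. p \<le> Suc (length x) \<longrightarrow> rel D \<rho> \<longrightarrow>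
     (\<exists>D'. p' \<le> Suc (length x) \<and> rel D' \<rho>' \<and>
        reach (cfg (Run K) p (tapes D) w) (cfg (Run K') p' (tapes D') w')))"

lemma sim_trans: "sim K K' s s' \<Longrightarrow> sim K' K'' s' s'' \<Longrightarrow> sim K K'' s s''"
  unfolding sim_def by (clarsimp split: prod.splits) (meson rtranclp_trans)

lemma sim_simple:
  assumes "Run K \<notin> {Run [Halt True], Run [Halt False], query M}"
    "ctl_delta (Run K) (read_input x p) = (\<lambda>gs. (Run K', d, stay_acts gs, out))"
    "p \<le> Suc (length x) \<Longrightarrow> p' = min (move d p) (Suc (length x))" "w' = w @ (case out of None \<Rightarrow> [] | Some b \<Rightarrow> [b])"
  shows "sim K K' (\<rho>, p, w) (\<rho>, p', w')"
  unfolding sim_def prod.case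
proof (intro allI impI exI conjI)
  fix D assume *: "p \<le> Suc (length x)" "rel D \<rho>"
  show "p' \<le> Suc (length x)" using assms * by simp
  show "rel D \<rho>" by fact
  show "reach (cfg (Run K) p (tapes D) w) (cfg (Run K') p' (tapes D) w')"
    by (rule reach_step[OF assms(1)]) (use assms * in \<open>auto simp: stay_work\<close>)
qed

lemma rel_upd:
  assumes "rel D \<rho>" "length ds \<le> L" "digits_val ds = v"
  shows "rel (D[r := ds]) (\<rho>(r := v))"
  using assms set_update_subset_insert[of D r ds] by (auto simp: rel_def nth_list_update)

lemma tapes_upd: "(tapes D)[r := (0, tape ds)] = tapes (D[r := ds])"
  by (simp add: tapes_def map_update)

lemma sim_inc:
  assumes "r < N" "\<rho> r < V"
  shows "sim (Inc r # K) K (\<rho>, p, w) (\<rho>(r := Suc (\<rho> r)), p, w)"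
  unfolding sim_def prod.case
proof (intro allI impI exI conjI)
  fix D assume *: "p \<le> Suc (length x)" "rel D \<rho>"
  then have D: "r < length D" "digits_val (D ! r) = \<rho> r" "length (D ! r) \<le> L"
    using assms(1) by (auto simp: rel_def)
  have L: "length (digits_inc (D ! r)) \<le> L"
    using length_digits_inc_le[OF D(3) _ V_less] D(2) assms(2) by simp
  show "rel (D[r := digits_inc (D ! r)]) (\<rho>(r := Suc (\<rho> r)))"
    using rel_upd[OF *(2) L] D(2) by (simp add: digits_val_inc)
  show "reach (cfg (Run (Inc r # K)) p (tapes D) w) (cfg (Run K) p (tapes (D[r := digits_inc (D ! r)])) w)"
    by (rule reach_start_scan[OF D(1) *(1), where ds = "D ! r" and q' = "IncScan r K"])
      (use D *(1) L reach_inc_scan[OF D(1) *(1), of "[]"] in \<open>auto simp: query_M tapes_upd nth_tapes\<close>)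
qed (simp_all)

lemma sim_dec:
  assumes "r < N" "\<rho> r > 0"
  shows "sim (Dec r # K) K (\<rho>, p, w) (\<rho>(r := \<rho> r - 1), p, w)"
  unfolding sim_def prod.case
proof (intro allI impI exI conjI)
  fix D assume *: "p \<le> Suc (length x)" "rel D \<rho>"
  then have D: "r < length D" "digits_val (D ! r) = \<rho> r" "length (D ! r) \<le> L"
    using assms(1) by (auto simp: rel_def)
  show "rel (D[r := digits_dec (D ! r)]) (\<rho>(r := \<rho> r - 1))"
    using D assms(2) by (intro rel_upd *(2)) (auto simp: digits_val_dec length_digits_dec)
  show "reach (cfg (Run (Dec r # K)) p (tapes D) w) (cfg (Run K) p (tapes (D[r := digits_dec (D ! r)])) w)"
    by (rule reach_start_scan[OF D(1) *(1), where ds = "D ! r" and q' = "DecScan r K"])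
      (use D *(1) assms(2) reach_dec_scan[OF D(1) *(1), of "[]"] in \<open>auto simp: query_M tapes_upd nth_tapes\<close>)
qed (simp_all)

lemma sim_test:
  assumes "r < N" "K = IfZ r c0 c1 # K' \<and> K0 = c0 # K' \<and> K1 = c1 # K' \<or>
    K = While r c # K' \<and> K0 = K' \<and> K1 = c # While r c # K'"
  shows "sim K (if \<rho> r = 0 then K0 else K1) (\<rho>, p, w) (\<rho>, p, w)"
  unfolding sim_def prod.case
proof (intro allI impI exI conjI)
  fix D assume *: "p \<le> Suc (length x)" "rel D \<rho>"
  then have D: "r < length D" "digits_val (D ! r) = \<rho> r" "length (D ! r) \<le> L"
    using assms(1) by (auto simp: rel_def)
  show "rel D \<rho>" by fact
  show "reach (cfg (Run K) p (tapes D) w) (cfg (Run (if \<rho> r = 0 then K0 else K1)) p (tapes D) w)"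
    by (rule reach_start_scan[OF D(1) *(1), where ds = "D ! r" and q' = "TestScan r K0 K1"])
      (use D *(1) assms(2) reach_test_scan[OF D(1) *(1), of "[]" "D ! r" K0 K1] in
        \<open>auto simp: query_M tapes_upd nth_tapes\<close>)
qed (simp_all)

lemma sim_ask:
  assumes "ok w"
  shows "sim (Ask qr # qK) (if w \<in> Q then Inc qr # qK else qK) (\<rho>, p, w) (\<rho>, p, [])"
  unfolding sim_def prod.case
proof (intro allI impI exI conjI)
  fix D assume *: "p \<le> Suc (length x)" "rel D \<rho>"
  let ?K = "if w \<in> Q then Inc qr # qK else qK"
  have "step M Q x (cfg (Run (Ask qr # qK)) p (tapes D) w) = cfg (Run ?K) p (tapes D) []"
    by (simp add: step_def cfg_def prog_otm_def Let_def)
  then show "reach (cfg (Run (Ask qr # qK)) p (tapes D) w) (cfg (Run ?K) p (tapes D) [])"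
    using assms by (intro r_into_rtranclp) (simp add: good_cfg)
qed simp_all

text \<open>The continuation \<open>K\<close> is arbitrary because subcommands run on longer stacks;
  the body of a loop has the loop itself below it. The premise on \<open>asks\<close> says that a
  query can only occur in the one query state of the machine.\<close>

lemma exec_sim:
  assumes "exec x Q ok V c s s'" "regs c \<subseteq> {..<N}" "asks c K \<subseteq> {Ask qr # qK}"
  shows "sim (c # K) K s s'"
  using assms
proof (induction arbitrary: K rule: exec.induct)
  case (Inc \<rho> r p w)
  then show ?case using sim_inc by auto
next
  case (Dec \<rho> r p w)
  then show ?case using sim_dec by auto
next
  case (Mv d \<rho> p w)
  show ?case by (rule sim_simple[where d = d and out = None]) (auto simp: query_M fun_eq_iff)
next
  case (Emit s \<rho> p w)
  show ?case by (rule sim_simple[where d = Stay and out = "Some s"]) (auto simp: query_M fun_eq_iff)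
next
  case (AskYes w \<rho> r p)
  then show ?case using sim_trans[OF sim_ask[OF AskYes(1)] , of _ \<rho> p] sim_inc[of r \<rho> K p "[]"] by auto
next
  case (AskNo w r \<rho> p)
  then show ?case using sim_ask[OF AskNo(1), of \<rho> p] by auto
next
  case (Seq c1 s s' c2 s'')
  obtain \<rho> p w where s: "s = (\<rho>, p, w)" by (cases s)
  have "sim (Seq c1 c2 # K) (c1 # c2 # K) s s"
    unfolding s by (rule sim_simple[where d = Stay and out = None]) (use Seq in \<open>auto simp: query_M fun_eq_iff\<close>)
  then show ?case using Seq sim_trans by (metis Un_subset_iff asks.simps(2) regs.simps(4))
next
  case (IfZ0 \<rho> r c1 p w s' c2)
  then show ?case using sim_trans[OF sim_test[of r "IfZ r c1 c2 # K" c1 c2 K "c1 # K" "c2 # K" _ \<rho> p w]] by auto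
next
  case (IfZ1 \<rho> r c2 p w s' c1)
  then show ?case using sim_trans[OF sim_test[of r "IfZ r c1 c2 # K" c1 c2 K "c1 # K" "c2 # K" _ \<rho> p w]] by auto
next
  case (IfIn1 p a c1 \<rho> w s' c2)
  have "sim (IfIn a c1 c2 # K) (c1 # K) (\<rho>, p, w) (\<rho>, p, w)"
    by (rule sim_simple[where d = Stay and out = None]) (use IfIn1 in \<open>auto simp: query_M fun_eq_iff\<close>)
  then show ?case using sim_trans IfIn1 by auto
next
  case (IfIn2 p a c2 \<rho> w s' c1)
  have "sim (IfIn a c1 c2 # K) (c2 # K) (\<rho>, p, w) (\<rho>, p, w)"
    by (rule sim_simple[where d = Stay and out = None]) (use IfIn2 in \<open>auto simp: query_M fun_eq_iff\<close>)
  then show ?case using sim_trans IfIn2 by auto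
next
  case (While0 \<rho> r c p w)
  then show ?case using sim_test[of r "While r c # K" _ _ K _ _ c \<rho> p w] by auto
next
  case (While1 \<rho> r c p w s' s'')
  have "sim (While r c # K) (c # While r c # K) (\<rho>, p, w) (\<rho>, p, w)"
    using While1 sim_test[of r "While r c # K" _ _ K K "c # While r c # K" c \<rho> p w] by auto
  then show ?case using While1 sim_trans by (metis asks.simps(5) insert_subset regs.simps(7))
qed

end

section \<open>Renaming states to natural numbers\<close>

definition rename_states :: "('q \<Rightarrow> nat) \<Rightarrow> (nat \<Rightarrow> 'q) \<Rightarrow> ('q, 'g) otm \<Rightarrow> (nat, 'g) otm" where
  "rename_states f f' M = \<lparr> states = f ` states M, start = f (start M), accept = f (accept M),
     reject = f (reject M), query = f (query M), answer_yes = f (answer_yes M),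
     answer_no = f (answer_no M), tape_count = tape_count M, alphabet = alphabet M,
     blank = blank M, delta = \<lambda>q a gs. case delta M (f' q) a gs of (q', r) \<Rightarrow> (f q', r) \<rparr>"

definition rename_config :: "('q \<Rightarrow> nat) \<Rightarrow> ('q, 'g) config \<Rightarrow> (nat, 'g) config" where
  "rename_config f c = \<lparr> state = f (state c), input_pos = input_pos c, work = work c,
     oracle_tape = oracle_tape c \<rparr>"

lemma rename_config_sel [simp]:
  "state (rename_config f c) = f (state c)" "input_pos (rename_config f c) = input_pos c"
  "work (rename_config f c) = work c" "oracle_tape (rename_config f c) = oracle_tape c"
  by (simp_all add: rename_config_def)

context
  fixes f :: "'q \<Rightarrow> nat" and f' :: "nat \<Rightarrow> 'q" and M :: "('q, 'g) otm"
  assumes inv: "\<And>q. f' (f q) = q"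
begin

lemma rename_inj [simp]: "f q = f q' \<longleftrightarrow> q = q'"
  using inv by metis

lemma wf_rename_states:
  assumes "wf_otm M"
  shows "wf_otm (rename_states f f' M)"
proof -
  let ?M = "rename_states f f' M"
  have "case delta ?M q a gs of (q', d, acts, out) \<Rightarrow>
      q' \<in> states ?M \<and> length acts = tape_count ?M \<and> fst ` set acts \<subseteq> alphabet ?M"
    if q: "q \<in> states ?M" and gs: "length gs = tape_count ?M" "set gs \<subseteq> alphabet ?M" for q a gs
  proof -
    obtain q0 where q0: "q = f q0" "q0 \<in> states M"
      using q by (auto simp: rename_states_def)
    obtain q' d acts out where d: "delta M q0 a gs = (q', d, acts, out)"
      by (cases "delta M q0 a gs")
    have "case delta M q0 a gs of (q', d, acts, out) \<Rightarrow>
        q' \<in> states M \<and> length acts = tape_count M \<and> fst ` set acts \<subseteq> alphabet M"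
      using assms q0(2) gs unfolding wf_otm_def by (simp add: rename_states_def)
    then show ?thesis
      by (simp add: d q0 inv rename_states_def)
  qed
  moreover have "finite (states M)" "finite (alphabet M)" "blank M \<in> alphabet M"
    "start M \<in> states M" "accept M \<in> states M" "reject M \<in> states M" "query M \<in> states M"
    "answer_yes M \<in> states M" "answer_no M \<in> states M"
    "accept M \<noteq> reject M" "query M \<noteq> accept M" "query M \<noteq> reject M"
    using assms by (simp_all add: wf_otm_def)
  then have "finite (states ?M)" "finite (alphabet ?M)" "blank ?M \<in> alphabet ?M"
    "{start ?M, accept ?M, reject ?M, query ?M, answer_yes ?M, answer_no ?M} \<subseteq> states ?M"
    "accept ?M \<noteq> reject ?M" "query ?M \<notin> {accept ?M, reject ?M}"
    by (simp_all add: rename_states_def)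
  ultimately show ?thesis unfolding wf_otm_def by simp
qed

lemma step_rename_states:
  "step (rename_states f f' M) Q x (rename_config f c) = rename_config f (step M Q x c)"
  by (auto simp: step_def rename_states_def inv rename_config_def split: prod.splits)

lemma run_rename_states:
  "run (rename_states f f' M) Q x n = rename_config f (run M Q x n)"
proof (induction n)
  case 0
  show ?case by (simp add: run_def initial_def rename_config_def rename_states_def)
next
  case (Suc n)
  then show ?case by (simp add: run_def step_rename_states)
qed

end

lemma pl_turing_reducibleI:
  fixes M :: "('q :: countable, nat) otm"
  assumes "wf_otm M" "computable f" "computable g" "decides M Q' Q"
    "\<And>x. space_within M Q' x (real (f (\<kappa> x)) + real C * log 2 (real (length x + 1)))"
    "\<And>x y. y \<in> queried M Q' x \<Longrightarrow> \<kappa>' y \<le> g (\<kappa> x)"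
  shows "pl_turing_reducible (Q, \<kappa>) (Q', \<kappa>')"
proof -
  let ?M = "rename_states to_nat from_nat M"
  note run = run_rename_states[of from_nat to_nat, OF from_nat_to_nat]
  have "wf_otm ?M"
    by (rule wf_rename_states) (use assms in auto)
  moreover have "decides ?M Q' Q"
    unfolding decides_def
  proof
    fix x
    obtain n where "state (run M Q' x n) = (if x \<in> Q then accept M else reject M)"
      using assms(4) unfolding decides_def by blast
    then show "\<exists>n. state (run ?M Q' x n) = (if x \<in> Q then accept ?M else reject ?M)"
      by (intro exI[of _ n], subst run) (simp add: rename_states_def)
  qed
  moreover have "space_within ?M Q' x (real (f (\<kappa> x)) + real C * log 2 (real (length x + 1)))" for x
    using assms(5)[of x] unfolding space_within_def by (simp add: run)
  moreover have "queried ?M Q' x = queried M Q' x" for x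
    unfolding queried_def run by (simp add: rename_states_def)
  ultimately show ?thesis
    unfolding pl_turing_reducible_def prod.case using assms(2,3,6)
    by (intro exI[of _ ?M] exI[of _ f] exI[of _ g] exI[of _ C]) auto
qed

section \<open>Termination and space of the machine\<close>

context prog_run
begin

text \<open>The simulation gives goodness up to the halting configuration. This is a fixed point of
  \<open>step\<close> with all heads on cell 0, so goodness persists at all later times.\<close>

lemma prog_run_result:
  assumes P: "P = Seq c (IfZ 0 (Halt False) (Halt True))"
    and regs: "regs P \<subseteq> {..<N}" and ask: "asks P [] = {Ask qr # qK}"
    and ex: "exec x Q ok V c (\<lambda>_. 0, 0, []) (\<rho>, p, w)"
  shows "\<exists>n. state (run M Q x n) = Run [Halt (\<rho> 0 \<noteq> 0)]"
    and "good (run M Q x n)"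
proof -
  have N: "0 < N" using regs P by auto
  have 1: "sim [P] [c, IfZ 0 (Halt False) (Halt True)] (\<lambda>_. 0, 0, []) (\<lambda>_. 0, 0, [])"
    by (rule sim_simple[where d = Stay and out = None]) (auto simp: P query_M[unfolded P] fun_eq_iff)
  have 2: "sim [c, IfZ 0 (Halt False) (Halt True)] [IfZ 0 (Halt False) (Halt True)] (\<lambda>_. 0, 0, []) (\<rho>, p, w)"
    by (rule exec_sim[OF ex]) (use regs ask P in auto)
  have 3: "sim [IfZ 0 (Halt False) (Halt True)] [Halt (\<rho> 0 \<noteq> 0)] (\<rho>, p, w) (\<rho>, p, w)"
    using sim_test[of 0 "[IfZ 0 (Halt False) (Halt True)]" "Halt False" "Halt True" "[]" "[Halt False]" "[Halt True]" _ \<rho> p w] N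
    by (cases "\<rho> 0 = 0") auto
  have rel: "rel (replicate N []) (\<lambda>_. 0)"
    by (auto simp: rel_def)
  have init: "initial M = cfg (Run [P]) 0 (tapes (replicate N [])) []"
  proof -
    have "tape [] = (\<lambda>_. 0)" by (auto simp: tape_def fun_eq_iff split: nat.split)
    then show ?thesis by (simp add: initial_def cfg_def prog_otm_def Let_def tapes_def)
  qed
  obtain D where R: "reach (initial M) (cfg (Run [Halt (\<rho> 0 \<noteq> 0)]) p (tapes D) w)"
    using sim_trans[OF sim_trans[OF 1 2] 3] rel unfolding init sim_def by auto
  have reach_run: "\<exists>n. d = (step M Q x ^^ n) c' \<and> (\<forall>m<n. good ((step M Q x ^^ m) c'))" if "reach c' d" for c' d
    using that
  proof (induction rule: converse_rtranclp_induct)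
    case base
    show ?case by (rule exI[of _ 0]) simp
  next
    case (step y z)
    then obtain n where n: "d = (step M Q x ^^ n) z" "\<And>m. m < n \<Longrightarrow> good ((step M Q x ^^ m) z)" by blast
    have "good ((step M Q x ^^ m) y)" if "m < Suc n" for m
      using that step(1) n(2) by (cases m) (auto simp: funpow_swap1)
    then show ?case using n(1) step(1) by (intro exI[of _ "Suc n"]) (auto simp: funpow_swap1)
  qed
  let ?h = "cfg (Run [Halt (\<rho> 0 \<noteq> 0)]) p (tapes D) w"
  from reach_run[OF R] obtain n0 where n0: "run M Q x n0 = ?h" "\<And>m. m < n0 \<Longrightarrow> good (run M Q x m)"
    unfolding run_def by metis
  show "\<exists>n. state (run M Q x n) = Run [Halt (\<rho> 0 \<noteq> 0)]"
    using n0(1) by (intro exI[of _ n0]) (simp add: cfg_def)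
  have fixed: "step M Q x ?h = ?h"
    by (auto simp: step_def cfg_def prog_otm_def Let_def)
  have stay: "run M Q x (k + n0) = ?h" for k
    using n0(1) fixed by (induction k) (simp_all add: run_def)
  have "good ?h"
    by (simp add: good_cfg query_M)
  then show "good (run M Q x n)"
    using n0(2)[of n] stay[of "n - n0"] by (cases "n < n0") auto
qed

end

section \<open>Terms over the input word\<close>

definition sym_code :: "sym list \<Rightarrow> nat \<Rightarrow> nat" where
  "sym_code x i = (if i < length x then (case x ! i of Zero \<Rightarrow> 0 | One \<Rightarrow> 1 | Sep \<Rightarrow> 2) else 3)"

text \<open>Primitive recursion suffices here: apart from the outer loop over the queries, which is
  a \<open>While\<close> in the program, every search has a computable bound.\<close>

datatype exp = Var nat | Null | Succ exp | Len | Read exp | Comp exp "exp list" | Rec exp exp exp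

primrec eval :: "sym list \<Rightarrow> exp \<Rightarrow> nat list \<Rightarrow> nat" where
  "eval x (Var i) env = (if i < length env then env ! i else 0)"
| "eval x Null env = 0"
| "eval x (Succ e) env = Suc (eval x e env)"
| "eval x Len env = length x"
| "eval x (Read e) env = sym_code x (eval x e env)"
| "eval x (Comp f es) env = eval x f (map (\<lambda>e. eval x e env) es)"
| "eval x (Rec e0 e1 e2) env =
     rec_nat (eval x e0 env) (\<lambda>i r. eval x e1 (i # r # env)) (eval x e2 env)"

text \<open>Bounds the intermediate values along with the result, since all of them pass through
  counters. For \<open>Rec\<close> only the accumulator values actually reached matter, which leaves
  room for bodies that would grow quickly on other arguments.\<close>

primrec bounded :: "nat \<Rightarrow> sym list \<Rightarrow> exp \<Rightarrow> nat list \<Rightarrow> bool" where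
  "bounded V x (Var i) env \<longleftrightarrow> eval x (Var i) env \<le> V"
| "bounded V x Null env \<longleftrightarrow> True"
| "bounded V x (Succ e) env \<longleftrightarrow> bounded V x e env \<and> Suc (eval x e env) \<le> V"
| "bounded V x Len env \<longleftrightarrow> length x \<le> V"
| "bounded V x (Read e) env \<longleftrightarrow> bounded V x e env"
| "bounded V x (Comp f es) env \<longleftrightarrow>
     (\<forall>b \<in> set (map (\<lambda>e. bounded V x e env) es). b) \<and> bounded V x f (map (\<lambda>e. eval x e env) es)"
| "bounded V x (Rec e0 e1 e2) env \<longleftrightarrow> bounded V x e0 env \<and> bounded V x e2 env \<and>
     (\<forall>i < eval x e2 env.
        bounded V x e1 (i # rec_nat (eval x e0 env) (\<lambda>i r. eval x e1 (i # r # env)) i # env))"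

lemma bounded_mono: "bounded V x e env \<Longrightarrow> V \<le> V' \<Longrightarrow> bounded V' x e env"
  by (induction e arbitrary: env) auto

text \<open>The number 3 is the largest symbol code. It accounts for \<open>Read\<close>, whose own
  value \<open>bounded\<close> does not restrict.\<close>

lemma eval_le: "bounded V x e env \<Longrightarrow> 3 \<le> V \<Longrightarrow> eval x e env \<le> V"
proof (induction e arbitrary: env)
  case (Read e)
  then show ?case by (auto simp: sym_code_def split: sym.split)
next
  case (Rec e0 e1 e2)
  then show ?case by (cases "eval x e2 env") auto
qed auto

section \<open>Compilation of terms into programs\<close>

definition skip :: com where "skip = Mv Stay"

definition clear :: "nat \<Rightarrow> com" where "clear a = While a (Dec a)"

definition transfer :: "nat \<Rightarrow> nat \<Rightarrow> com" where
  "transfer a b = While a (Seq (Dec a) (Inc b))"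

definition copy :: "nat \<Rightarrow> nat \<Rightarrow> nat \<Rightarrow> com" where
  "copy a b t = Seq (While a (Seq (Dec a) (Seq (Inc b) (Inc t)))) (transfer t a)"

text \<open>As \<open>While\<close> only tests registers, \<open>t\<close> serves as a flag that is
  lowered when the end marker is seen. \<open>measure_input\<close> does the same at the right
  end.\<close>

definition rewind :: "nat \<Rightarrow> com" where
  "rewind t = Seq (Inc t) (While t (IfIn LeftEnd (Dec t) (Mv GoLeft)))"

definition measure_input :: "nat \<Rightarrow> nat \<Rightarrow> com" where
  "measure_input d t = Seq (rewind t) (Seq (Mv GoRight) (Seq (Inc t)
     (While t (IfIn RightEnd (Dec t) (Seq (Inc d) (Mv GoRight))))))"

definition lookup_input :: "nat \<Rightarrow> nat \<Rightarrow> com" where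
  "lookup_input d t = Seq (rewind t) (Seq (Mv GoRight) (Seq (While d (Seq (Dec d) (Mv GoRight)))
     (IfIn (Symbol Zero) skip (IfIn (Symbol One) (Inc d)
       (IfIn (Symbol Sep) (Seq (Inc d) (Inc d)) (Seq (Inc d) (Seq (Inc d) (Inc d))))))))"

fun comp_list :: "(nat list \<Rightarrow> nat \<Rightarrow> com) list \<Rightarrow> nat list \<Rightarrow> nat \<Rightarrow> com" where
  "comp_list [] rs d = skip"
| "comp_list (c # cs) rs d = Seq (c rs d) (comp_list cs rs (Suc d))"

fun clear_all :: "nat \<Rightarrow> nat \<Rightarrow> com" where
  "clear_all d 0 = skip"
| "clear_all d (Suc k) = Seq (clear d) (clear_all (Suc d) k)"

text \<open>The values of the variables are in the registers \<open>rs\<close>, all of which are below \<open>d\<close>.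
  The result goes to \<open>d\<close>, and the registers above \<open>d\<close> are free.\<close>

primrec compile :: "exp \<Rightarrow> nat list \<Rightarrow> nat \<Rightarrow> com" where
  "compile (Var i) rs d = (if i < length rs then copy (rs ! i) d (Suc d) else skip)"
| "compile Null rs d = skip"
| "compile (Succ e) rs d = Seq (compile e rs d) (Inc d)"
| "compile Len rs d = measure_input d (Suc d)"
| "compile (Read e) rs d = Seq (compile e rs d) (lookup_input d (Suc d))"
| "compile (Comp f es) rs d = (let k = length es in
     Seq (comp_list (map compile es) rs (Suc d))
    (Seq (compile f [Suc d..<Suc d + k] (Suc d + k))
    (Seq (transfer (Suc d + k) d) (clear_all (Suc d) k))))"
| "compile (Rec e0 e1 e2) rs d =
     Seq (compile e0 rs d) (Seq (compile e2 rs (Suc d))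
    (Seq (While (Suc d) (Seq (Dec (Suc d)) (Seq (compile e1 (Suc (Suc d) # d # rs) (Suc (Suc (Suc d))))
       (Seq (clear d) (Seq (transfer (Suc (Suc (Suc d))) d) (Inc (Suc (Suc d))))))))
     (clear (Suc (Suc d)))))"

text \<open>The free registers must be 0 because the code of a term adds to its target instead of
  overwriting it.\<close>

definition ready :: "nat list \<Rightarrow> nat list \<Rightarrow> nat \<Rightarrow> (nat \<Rightarrow> nat) \<Rightarrow> bool" where
  "ready env rs d \<rho> \<longleftrightarrow> length rs = length env \<and>
     (\<forall>i < length env. \<rho> (rs ! i) = env ! i \<and> rs ! i < d) \<and> (\<forall>r \<ge> d. \<rho> r = 0)"

context
  fixes x :: "sym list" and Q :: "sym list set" and ok :: "sym list \<Rightarrow> bool" and V :: nat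
  assumes V: "3 \<le> V"
begin

abbreviation ex :: "com \<Rightarrow> cstate \<Rightarrow> cstate \<Rightarrow> bool" where
  "ex \<equiv> exec x Q ok V"

lemma ex_skip: "p \<le> Suc (length x) \<Longrightarrow> ex skip (\<rho>, p, w) (\<rho>, p, w)"
  using exec.Mv[of x Q ok V Stay \<rho> p w] by (simp add: skip_def)

lemma ex_clear: "ex (clear a) (\<rho>, p, w) (\<rho>(a := 0), p, w)"
proof (induction "\<rho> a" arbitrary: \<rho>)
  case 0
  then have "\<rho>(a := 0) = \<rho>" by auto
  then show ?case using exec.While0[of \<rho> a x Q ok V "Dec a" p w] 0 by (simp add: clear_def)
next
  case (Suc n)
  have "ex (Dec a) (\<rho>, p, w) (\<rho>(a := \<rho> a - 1), p, w)"
    using Suc.hyps(2) by (intro exec.Dec) simp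
  moreover have "ex (clear a) (\<rho>(a := \<rho> a - 1), p, w) (\<rho>(a := 0), p, w)"
    using Suc.hyps(1)[of "\<rho>(a := \<rho> a - 1)"] Suc.hyps(2) by simp
  ultimately show ?case
    using Suc.hyps(2) unfolding clear_def by (intro exec.While1) simp_all
qed

lemma ex_transfer:
  assumes "a \<noteq> b" "\<rho> a + \<rho> b \<le> V"
  shows "ex (transfer a b) (\<rho>, p, w) (\<rho>(a := 0, b := \<rho> a + \<rho> b), p, w)"
  using assms(2)
proof (induction "\<rho> a" arbitrary: \<rho>)
  case 0
  then have eq: "\<rho>(a := 0, b := \<rho> a + \<rho> b) = \<rho>" by auto
  show ?case
    unfolding eq transfer_def using 0 by (intro exec.While0) simp
next
  case (Suc n)
  let ?\<rho> = "\<rho>(a := \<rho> a - 1, b := Suc (\<rho> b))"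
  have "ex (Dec a) (\<rho>, p, w) (\<rho>(a := \<rho> a - 1), p, w)"
    using Suc.hyps(2) by (intro exec.Dec) simp
  moreover have "ex (Inc b) (\<rho>(a := \<rho> a - 1), p, w) (?\<rho>, p, w)"
    using exec.Inc[of "\<rho>(a := \<rho> a - 1)" b V x Q ok p w] Suc assms(1) by simp
  moreover have "ex (transfer a b) (?\<rho>, p, w) (?\<rho>(a := 0, b := ?\<rho> a + ?\<rho> b), p, w)"
    using Suc assms(1) by (intro Suc.hyps(1)) auto
  moreover have "?\<rho>(a := 0, b := ?\<rho> a + ?\<rho> b) = \<rho>(a := 0, b := \<rho> a + \<rho> b)"
    using Suc.hyps(2) assms(1) by auto
  ultimately show ?case
    using Suc.hyps(2) unfolding transfer_def by (auto intro!: exec.While1 exec.Seq)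
qed

lemma ex_copy_loop:
  assumes "a \<noteq> b" "a \<noteq> t" "b \<noteq> t" "\<rho> a + \<rho> b \<le> V" "\<rho> a + \<rho> t \<le> V"
  shows "ex (While a (Seq (Dec a) (Seq (Inc b) (Inc t)))) (\<rho>, p, w)
    (\<rho>(a := 0, b := \<rho> a + \<rho> b, t := \<rho> a + \<rho> t), p, w)"
  using assms(4,5)
proof (induction "\<rho> a" arbitrary: \<rho>)
  case 0
  then have eq: "\<rho>(a := 0, b := \<rho> a + \<rho> b, t := \<rho> a + \<rho> t) = \<rho>" by auto
  show ?case
    unfolding eq using 0 by (intro exec.While0) simp
next
  case (Suc n)
  let ?\<rho> = "\<rho>(a := \<rho> a - 1, b := Suc (\<rho> b), t := Suc (\<rho> t))"
  have "ex (Dec a) (\<rho>, p, w) (\<rho>(a := \<rho> a - 1), p, w)"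
    using Suc.hyps(2) by (intro exec.Dec) simp
  moreover have "ex (Inc b) (\<rho>(a := \<rho> a - 1), p, w) (\<rho>(a := \<rho> a - 1, b := Suc (\<rho> b)), p, w)"
    using exec.Inc[of "\<rho>(a := \<rho> a - 1)" b V x Q ok p w] Suc assms(1) by simp
  moreover have "ex (Inc t) (\<rho>(a := \<rho> a - 1, b := Suc (\<rho> b)), p, w) (?\<rho>, p, w)"
    using exec.Inc[of "\<rho>(a := \<rho> a - 1, b := Suc (\<rho> b))" t V x Q ok p w] Suc assms by simp
  moreover have "ex (While a (Seq (Dec a) (Seq (Inc b) (Inc t)))) (?\<rho>, p, w)
      (?\<rho>(a := 0, b := ?\<rho> a + ?\<rho> b, t := ?\<rho> a + ?\<rho> t), p, w)"
    using Suc assms(1-3) by (intro Suc.hyps(1)) auto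
  moreover have "?\<rho>(a := 0, b := ?\<rho> a + ?\<rho> b, t := ?\<rho> a + ?\<rho> t) =
      \<rho>(a := 0, b := \<rho> a + \<rho> b, t := \<rho> a + \<rho> t)"
    using Suc.hyps(2) assms(1-3) by auto
  ultimately show ?case
    using Suc.hyps(2) by (auto intro!: exec.While1 exec.Seq)
qed

lemma ex_copy:
  assumes "a \<noteq> b" "a \<noteq> t" "b \<noteq> t" "\<rho> a \<le> V" "\<rho> b = 0" "\<rho> t = 0"
  shows "ex (copy a b t) (\<rho>, p, w) (\<rho>(b := \<rho> a), p, w)"
proof -
  let ?\<rho> = "\<rho>(a := 0, b := \<rho> a, t := \<rho> a)"
  have 1: "ex (While a (Seq (Dec a) (Seq (Inc b) (Inc t)))) (\<rho>, p, w) (?\<rho>, p, w)"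
    using ex_copy_loop[OF assms(1-3), of \<rho>] assms by simp
  have "ex (transfer t a) (?\<rho>, p, w) (?\<rho>(t := 0, a := \<rho> a), p, w)"
    using ex_transfer[of t a ?\<rho>] assms by simp
  moreover have "?\<rho>(t := 0, a := \<rho> a) = \<rho>(b := \<rho> a)"
    using assms by auto
  ultimately show ?thesis
    unfolding copy_def using 1 exec.Seq by simp
qed

lemma ex_rewind:
  assumes "\<rho> t = 0" "p \<le> Suc (length x)"
  shows "ex (rewind t) (\<rho>, p, w) (\<rho>, 0, w)"
proof -
  let ?\<rho> = "\<rho>(t := 1)"
  have loop: "ex (While t (IfIn LeftEnd (Dec t) (Mv GoLeft))) (?\<rho>, p, w) (\<rho>, 0, w)"
    using assms(2)
  proof (induction p)
    case 0
    have "ex (Dec t) (?\<rho>, 0, w) (?\<rho>(t := ?\<rho> t - 1), 0, w)"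
      by (rule exec.Dec) simp
    moreover have "?\<rho>(t := ?\<rho> t - 1) = \<rho>" using assms(1) by auto
    ultimately have "ex (IfIn LeftEnd (Dec t) (Mv GoLeft)) (?\<rho>, 0, w) (\<rho>, 0, w)"
      by (intro exec.IfIn1) (simp_all add: read_input_def)
    then show ?case using assms(1)
      by (intro exec.While1[OF _ _ exec.While0]) (simp_all del: fun_upd_apply add: fun_upd_same)
  next
    case (Suc p)
    have "ex (Mv GoLeft) (?\<rho>, Suc p, w) (?\<rho>, p, w)"
      using exec.Mv[of x Q ok V GoLeft ?\<rho> "Suc p" w] Suc.prems by simp
    then have "ex (IfIn LeftEnd (Dec t) (Mv GoLeft)) (?\<rho>, Suc p, w) (?\<rho>, p, w)"
      by (intro exec.IfIn2) (simp_all add: read_input_def)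
    moreover have "ex (While t (IfIn LeftEnd (Dec t) (Mv GoLeft))) (?\<rho>, p, w) (\<rho>, 0, w)"
      using Suc by (simp add: fun_upd_def)
    ultimately show ?case by (intro exec.While1) (simp_all add: fun_upd_def)
  qed
  have "ex (Inc t) (\<rho>, p, w) (?\<rho>, p, w)"
    using exec.Inc[of \<rho> t V x Q ok p w] assms(1) V by simp
  then show ?thesis unfolding rewind_def using loop exec.Seq by blast
qed

lemma ex_measure_input:
  assumes "\<rho> t = 0" "\<rho> d = 0" "d \<noteq> t" "p \<le> Suc (length x)" "length x \<le> V"
  shows "ex (measure_input d t) (\<rho>, p, w) (\<rho>(d := length x), Suc (length x), w)"
proof -
  let ?W = "While t (IfIn RightEnd (Dec t) (Seq (Inc d) (Mv GoRight)))"
  have loop: "ex ?W (\<rho>(t := 1, d := length x - n), Suc (length x) - n, w)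
      (\<rho>(d := length x), Suc (length x), w)" if "n \<le> length x" for n
    using that
  proof (induction n)
    case 0
    let ?\<rho> = "\<rho>(t := 1, d := length x)"
    have "ex (Dec t) (?\<rho>, Suc (length x), w) (?\<rho>(t := ?\<rho> t - 1), Suc (length x), w)"
      using assms by (intro exec.Dec) simp
    moreover have "?\<rho>(t := ?\<rho> t - 1) = \<rho>(d := length x)" using assms by auto
    ultimately have "ex (IfIn RightEnd (Dec t) (Seq (Inc d) (Mv GoRight))) (?\<rho>, Suc (length x), w)
        (\<rho>(d := length x), Suc (length x), w)"
      by (intro exec.IfIn1) (simp_all add: read_input_def)
    then have "ex ?W (?\<rho>, Suc (length x), w) (\<rho>(d := length x), Suc (length x), w)"
      using assms by (intro exec.While1[OF _ _ exec.While0]) (simp_all del: fun_upd_apply, simp_all)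
    then show ?case by (simp add: fun_upd_def)
  next
    case (Suc n)
    let ?\<rho> = "\<rho>(t := 1, d := length x - Suc n)"
    have "ex (Inc d) (?\<rho>, Suc (length x) - Suc n, w) (\<rho>(t := 1, d := length x - n), Suc (length x) - Suc n, w)"
      using exec.Inc[of ?\<rho> d V x Q ok "Suc (length x) - Suc n" w] assms Suc.prems
      by (simp add: Suc_diff_Suc)
    moreover have "ex (Mv GoRight) (\<rho>(t := 1, d := length x - n), Suc (length x) - Suc n, w)
       (\<rho>(t := 1, d := length x - n), Suc (length x) - n, w)"
      using exec.Mv[of x Q ok V GoRight "\<rho>(t := 1, d := length x - n)" "Suc (length x) - Suc n" w] Suc.prems
      by (simp add: Suc_diff_le)
    ultimately have "ex (IfIn RightEnd (Dec t) (Seq (Inc d) (Mv GoRight))) (?\<rho>, Suc (length x) - Suc n, w)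
        (\<rho>(t := 1, d := length x - n), Suc (length x) - n, w)"
      using Suc.prems by (intro exec.IfIn2 exec.Seq) (auto simp: read_input_def)
    moreover have "ex ?W (\<rho>(t := 1, d := length x - n), Suc (length x) - n, w)
      (\<rho>(d := length x), Suc (length x), w)"
      using Suc by (simp add: fun_upd_def)
    ultimately show ?case using assms(3) by (intro exec.While1) (simp_all add: fun_upd_def)
  qed
  have "ex (Mv GoRight) (\<rho>, 0, w) (\<rho>, 1, w)"
    using exec.Mv[of x Q ok V GoRight \<rho> 0 w] by simp
  moreover have "ex (Inc t) (\<rho>, 1, w) (\<rho>(t := 1), 1, w)"
    using exec.Inc[of \<rho> t V x Q ok 1 w] assms(1) V by simp
  moreover have "\<rho>(t := 1, d := 0) = \<rho>(t := 1)" using assms by auto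
  ultimately show ?thesis
    unfolding measure_input_def using loop[of "length x"] ex_rewind[of \<rho> t p w] assms
    by (auto intro!: exec.Seq)
qed

lemma ex_lookup_input:
  assumes "\<rho> t = 0" "d \<noteq> t" "p \<le> Suc (length x)"
  shows "\<exists>p'. p' \<le> Suc (length x) \<and> ex (lookup_input d t) (\<rho>, p, w) (\<rho>(d := sym_code x (\<rho> d)), p', w)"
proof -
  have loop: "ex (While d (Seq (Dec d) (Mv GoRight))) (\<rho>, p, w)
      (\<rho>(d := 0), min (p + \<rho> d) (Suc (length x)), w)" if "p \<le> Suc (length x)" for p and \<rho> :: "nat \<Rightarrow> nat"
    using that
  proof (induction "\<rho> d" arbitrary: p \<rho>)
    case 0
    then have "\<rho>(d := 0) = \<rho>" by auto
    then show ?case using exec.While0[of \<rho> d x Q ok V _ p w] 0 by simp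
  next
    case (Suc n)
    let ?\<rho> = "\<rho>(d := \<rho> d - 1)"
    have "ex (Dec d) (\<rho>, p, w) (?\<rho>, p, w)"
      using Suc.hyps(2) by (intro exec.Dec) simp
    moreover have "ex (Mv GoRight) (?\<rho>, p, w) (?\<rho>, min (Suc p) (Suc (length x)), w)"
      using exec.Mv[of x Q ok V GoRight ?\<rho> p w] by simp
    moreover have "ex (While d (Seq (Dec d) (Mv GoRight))) (?\<rho>, min (Suc p) (Suc (length x)), w)
       (?\<rho>(d := 0), min (min (Suc p) (Suc (length x)) + ?\<rho> d) (Suc (length x)), w)"
      using Suc by (intro Suc.hyps(1)) auto
    moreover have "min (min (Suc p) (Suc (length x)) + ?\<rho> d) (Suc (length x)) = min (p + \<rho> d) (Suc (length x))"
      using Suc.hyps(2) by auto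
    ultimately show ?case
      using Suc.hyps(2) by (auto intro!: exec.While1 exec.Seq)
  qed
  let ?p = "min (1 + \<rho> d) (Suc (length x))"
  let ?\<rho> = "\<rho>(d := 0)"
  have read: "ex (IfIn (Symbol Zero) skip (IfIn (Symbol One) (Inc d)
       (IfIn (Symbol Sep) (Seq (Inc d) (Inc d)) (Seq (Inc d) (Seq (Inc d) (Inc d)))))) (?\<rho>, ?p, w)
       (\<rho>(d := sym_code x (\<rho> d)), ?p, w)"
  proof -
    have i1: "ex (Inc d) (?\<rho>, ?p, w) (\<rho>(d := 1), ?p, w)"
      using exec.Inc[of ?\<rho> d V x Q ok ?p w] V by simp
    have i2: "ex (Inc d) (\<rho>(d := 1), ?p, w) (\<rho>(d := 2), ?p, w)"
      using exec.Inc[of "\<rho>(d := 1)" d V x Q ok ?p w] V by (simp add: numeral_2_eq_2)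
    have i3: "ex (Inc d) (\<rho>(d := 2), ?p, w) (\<rho>(d := 3), ?p, w)"
      using exec.Inc[of "\<rho>(d := 2)" d V x Q ok ?p w] V by (simp add: numeral_3_eq_3 numeral_2_eq_2)
    show ?thesis
    proof (cases "\<rho> d < length x")
      case True
      then have r: "read_input x ?p = Symbol (x ! \<rho> d)"
        by (simp add: read_input_def)
      show ?thesis
      proof (cases "x ! \<rho> d")
        case Zero
        then show ?thesis using r True ex_skip[of ?p ?\<rho> w]
          by (intro exec.IfIn1) (simp_all add: sym_code_def)
      next
        case One
        then show ?thesis using r True i1
          by (intro exec.IfIn2[OF _ exec.IfIn1]) (simp_all add: sym_code_def)
      next
        case Sep
        then show ?thesis using r True i1 i2
          by (intro exec.IfIn2[OF _ exec.IfIn2[OF _ exec.IfIn1]]) (auto simp: sym_code_def intro: exec.Seq)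
      qed
    next
      case False
      then have r: "read_input x ?p = RightEnd"
        by (simp add: read_input_def)
      then show ?thesis using False i1 i2 i3
        by (intro exec.IfIn2[OF _ exec.IfIn2[OF _ exec.IfIn2]]) (auto simp: sym_code_def intro: exec.Seq)
    qed
  qed
  have "ex (Mv GoRight) (\<rho>, 0, w) (\<rho>, 1, w)"
    using exec.Mv[of x Q ok V GoRight \<rho> 0 w] by simp
  then have "ex (lookup_input d t) (\<rho>, p, w) (\<rho>(d := sym_code x (\<rho> d)), ?p, w)"
    unfolding lookup_input_def
    using ex_rewind[of \<rho> t p w] assms loop[of 1 \<rho>] read by (auto intro!: exec.Seq)
  then show ?thesis by (intro exI[of _ ?p]) simp
qed

text \<open>The position of the input head is quantified away. This is possible because every
  routine that reads the input rewinds first.\<close>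

definition does :: "sym list \<Rightarrow> com \<Rightarrow> (nat \<Rightarrow> nat) \<Rightarrow> (nat \<Rightarrow> nat) \<Rightarrow> bool" where
  "does w c \<rho> \<rho>' \<longleftrightarrow> (\<forall>p \<le> Suc (length x). \<exists>p' \<le> Suc (length x). ex c (\<rho>, p, w) (\<rho>', p', w))"

lemma does_Seq: "does w c1 \<rho> \<rho>' \<Longrightarrow> does w c2 \<rho>' \<rho>'' \<Longrightarrow> does w (Seq c1 c2) \<rho> \<rho>''"
  unfolding does_def by (meson exec.Seq)

lemma does_While0: "\<rho> r = 0 \<Longrightarrow> does w (While r c) \<rho> \<rho>"
  unfolding does_def by (meson exec.While0)

lemma does_While1: "\<rho> r > 0 \<Longrightarrow> does w c \<rho> \<rho>' \<Longrightarrow> does w (While r c) \<rho>' \<rho>'' \<Longrightarrow> does w (While r c) \<rho> \<rho>''"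
  unfolding does_def by (meson exec.While1)

lemma does_Inc: "\<rho> r < V \<Longrightarrow> \<rho>' = \<rho>(r := Suc (\<rho> r)) \<Longrightarrow> does w (Inc r) \<rho> \<rho>'"
  unfolding does_def using exec.Inc by blast

lemma does_Dec: "\<rho> r > 0 \<Longrightarrow> \<rho>' = \<rho>(r := \<rho> r - 1) \<Longrightarrow> does w (Dec r) \<rho> \<rho>'"
  unfolding does_def using exec.Dec by blast

lemma does_skip: "does w skip \<rho> \<rho>"
  unfolding does_def using ex_skip by blast

lemma does_clear: "\<rho>' = \<rho>(a := 0) \<Longrightarrow> does w (clear a) \<rho> \<rho>'"
  unfolding does_def using ex_clear by blast

lemma does_transfer:
  "a \<noteq> b \<Longrightarrow> \<rho> a + \<rho> b \<le> V \<Longrightarrow> \<rho>' = \<rho>(a := 0, b := \<rho> a + \<rho> b) \<Longrightarrow> does w (transfer a b) \<rho> \<rho>'"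
  unfolding does_def using ex_transfer by blast

lemma does_clear_all:
  "\<rho>' = (\<lambda>r. if d \<le> r \<and> r < d + k then 0 else \<rho> r) \<Longrightarrow> does w (clear_all d k) \<rho> \<rho>'"
proof (induction k arbitrary: d \<rho> \<rho>')
  case 0
  then have "\<rho>' = \<rho>" by auto
  then show ?case by (simp add: does_skip)
next
  case (Suc k)
  show ?case
    unfolding clear_all.simps
    by (rule does_Seq[OF does_clear[OF refl] Suc.IH]) (auto simp: Suc.prems)
qed

lemma does_comp_list:
  assumes "\<And>e rs d \<rho>. e \<in> set es \<Longrightarrow> ready env rs d \<rho> \<Longrightarrow> does w (compile e rs d) \<rho> (\<rho>(d := eval x e env))"
    and "length rs = length env" "\<forall>i < length env. \<rho> (rs ! i) = env ! i \<and> rs ! i < d" "\<forall>r \<ge> d. \<rho> r = 0"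
    and "\<rho>' = (\<lambda>r. if d \<le> r \<and> r < d + length es then eval x (es ! (r - d)) env else \<rho> r)"
  shows "does w (comp_list (map compile es) rs d) \<rho> \<rho>'"
  using assms
proof (induction es arbitrary: d \<rho> \<rho>')
  case Nil
  then have "\<rho>' = \<rho>" by auto
  then show ?case by (simp add: does_skip)
next
  case (Cons e es)
  have 1: "does w (compile e rs d) \<rho> (\<rho>(d := eval x e env))"
    using Cons.prems by (intro Cons.prems(1)) (auto simp: ready_def)
  have 2: "does w (comp_list (map compile es) rs (Suc d)) (\<rho>(d := eval x e env))
     (\<lambda>r. if Suc d \<le> r \<and> r < Suc d + length es then eval x (es ! (r - Suc d)) env
       else (\<rho>(d := eval x e env)) r)"
  proof (rule Cons.IH)
    show "\<forall>i<length env. (\<rho>(d := eval x e env)) (rs ! i) = env ! i \<and> rs ! i < Suc d"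
      using Cons.prems(3) by fastforce
  qed (use Cons.prems in auto)
  have "\<rho>' = (\<lambda>r. if Suc d \<le> r \<and> r < Suc d + length es then eval x (es ! (r - Suc d)) env
       else (\<rho>(d := eval x e env)) r)"
    unfolding Cons.prems(5) by (rule ext) (auto simp: nth_Cons')
  then show ?case using does_Seq[OF 1 2] by simp
qed

lemma does_comp:
  assumes "bounded V x e env" "ready env rs d \<rho>"
  shows "does w (compile e rs d) \<rho> (\<rho>(d := eval x e env))"
  using assms
proof (induction e arbitrary: env rs d \<rho>)
  case (Var i)
  show ?case
  proof (cases "i < length rs")
    case True
    then have "\<rho> (rs ! i) = env ! i" "rs ! i < d" "i < length env" "\<rho> d = 0" "\<rho> (Suc d) = 0"
      using Var.prems by (auto simp: ready_def)
    moreover from this have "env ! i \<le> V" using Var.prems(1) by simp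
    ultimately have "ex (copy (rs ! i) d (Suc d)) (\<rho>, p, w) (\<rho>(d := eval x (Var i) env), p, w)" for p
      using ex_copy[of "rs ! i" d "Suc d" \<rho>] by simp
    then show ?thesis
      using True unfolding does_def by auto
  next
    case False
    then have "\<rho>(d := eval x (Var i) env) = \<rho>" using Var.prems by (auto simp: ready_def)
    then show ?thesis using False does_skip by simp
  qed
next
  case Null
  then have "\<rho>(d := eval x Null env) = \<rho>" by (auto simp: ready_def)
  then show ?case using does_skip by simp
next
  case (Succ e)
  have "does w (compile e rs d) \<rho> (\<rho>(d := eval x e env))"
    by (rule Succ.IH) (use Succ.prems in auto)
  moreover have "does w (Inc d) (\<rho>(d := eval x e env)) (\<rho>(d := eval x (Succ e) env))"
    using Succ.prems by (intro does_Inc) auto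
  ultimately show ?case unfolding compile.simps by (rule does_Seq)
next
  case Len
  then have "ex (compile Len rs d) (\<rho>, p, w) (\<rho>(d := eval x Len env), Suc (length x), w)"
    if "p \<le> Suc (length x)" for p
    using ex_measure_input[of \<rho> "Suc d" d p w] that by (simp add: ready_def)
  then show ?case unfolding does_def by blast
next
  case (Read e)
  have "does w (compile e rs d) \<rho> (\<rho>(d := eval x e env))"
    by (rule Read.IH) (use Read.prems in auto)
  moreover have "does w (lookup_input d (Suc d)) (\<rho>(d := eval x e env)) (\<rho>(d := eval x (Read e) env))"
  proof -
    have "(\<rho>(d := eval x e env)) (Suc d) = 0" using Read.prems by (simp add: ready_def)
    then show ?thesis
      using ex_lookup_input[of "\<rho>(d := eval x e env)" "Suc d" d _ w] by (simp add: does_def)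
  qed
  ultimately show ?case unfolding compile.simps by (rule does_Seq)
next
  case (Comp f es)
  let ?k = "length es" and ?vs = "map (\<lambda>e. eval x e env) es"
  define \<rho>1 where "\<rho>1 = (\<lambda>r. if Suc d \<le> r \<and> r < Suc d + ?k then eval x (es ! (r - Suc d)) env else \<rho> r)"
  have r: "length rs = length env" "\<forall>i < length env. \<rho> (rs ! i) = env ! i \<and> rs ! i < d" "\<forall>r \<ge> d. \<rho> r = 0"
    using Comp.prems(2) by (auto simp: ready_def)
  have 1: "does w (comp_list (map compile es) rs (Suc d)) \<rho> \<rho>1"
  proof (rule does_comp_list)
    show "does w (compile e rs d) \<rho> (\<rho>(d := eval x e env))" if "e \<in> set es" "ready env rs d \<rho>" for e rs d \<rho>
      by (rule Comp.IH(2)[OF that(1) _ that(2)]) (use Comp.prems(1) that(1) in simp)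
  qed (use r in \<open>auto simp: \<rho>1_def less_Suc_eq\<close>)
  have 2: "does w (compile f [Suc d..<Suc d + ?k] (Suc d + ?k)) \<rho>1 (\<rho>1(Suc d + ?k := eval x f ?vs))"
  proof (rule Comp.IH(1))
    show "ready ?vs [Suc d..<Suc d + ?k] (Suc d + ?k) \<rho>1"
      using r by (auto simp: ready_def \<rho>1_def simp del: upt_Suc)
  qed (use Comp.prems in simp)
  have v: "eval x f ?vs \<le> V"
    using eval_le[OF _ V] Comp.prems(1) by simp
  have 3: "does w (transfer (Suc d + ?k) d) (\<rho>1(Suc d + ?k := eval x f ?vs)) (\<rho>1(d := eval x f ?vs))"
    using v r by (intro does_transfer) (auto simp: \<rho>1_def)
  have 4: "does w (clear_all (Suc d) ?k) (\<rho>1(d := eval x f ?vs)) (\<rho>(d := eval x f ?vs))"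
    using r by (intro does_clear_all) (auto simp: \<rho>1_def)
  show ?case
    using does_Seq[OF 1 does_Seq[OF 2 does_Seq[OF 3 4]]] unfolding compile.simps eval.simps Let_def .
next
  case (Rec e0 e1 e2)
  have r: "length rs = length env" "\<forall>i < length env. \<rho> (rs ! i) = env ! i \<and> rs ! i < d" "\<forall>r \<ge> d. \<rho> r = 0"
    using Rec.prems(2) by (auto simp: ready_def)
  define R where "R = rec_nat (eval x e0 env) (\<lambda>i r. eval x e1 (i # r # env))"
  define n where "n = eval x e2 env"
  have b: "bounded V x e0 env" "bounded V x e2 env" "\<And>i. i < n \<Longrightarrow> bounded V x e1 (i # R i # env)"
    using Rec.prems(1) by (auto simp: R_def n_def)
  have RS: "R (Suc i) = eval x e1 (i # R i # env)" for i by (simp add: R_def)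
  have R0: "R 0 = eval x e0 env" by (simp add: R_def)
  have le1: "n \<le> V" using eval_le[OF b(2) V] by (simp add: n_def)
  have le2: "R i \<le> V" if "i \<le> n" for i
    using that eval_le[OF b(1) V] eval_le[OF b(3) V] by (cases i) (auto simp: R0 RS)
  have 1: "does w (compile e0 rs d) \<rho> (\<rho>(d := R 0))"
    unfolding R0 by (rule Rec.IH(1)[OF b(1) Rec.prems(2)])
  have 2: "does w (compile e2 rs (Suc d)) (\<rho>(d := R 0)) (\<rho>(d := R 0, Suc d := n))"
    unfolding n_def
  proof (rule Rec.IH(3)[OF b(2)])
    have "\<forall>i<length env. (\<rho>(d := R 0)) (rs ! i) = env ! i \<and> rs ! i < Suc d"
      using r(2) by fastforce
    then show "ready env rs (Suc d) (\<rho>(d := R 0))"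
      using r by (auto simp: ready_def)
  qed
  let ?B = "Seq (Dec (Suc d)) (Seq (compile e1 (Suc (Suc d) # d # rs) (Suc (Suc (Suc d))))
       (Seq (clear d) (Seq (transfer (Suc (Suc (Suc d))) d) (Inc (Suc (Suc d))))))"
  \<comment> \<open>After \<open>j\<close> iterations, \<open>d\<close> holds the accumulator,
    \<open>Suc d\<close> the number of iterations left and \<open>Suc (Suc d)\<close> the
    index.\<close>
  let ?\<rho> = "\<lambda>j. \<rho>(d := R j, Suc d := n - j, Suc (Suc d) := j)"
  have 3: "does w (While (Suc d) ?B) (?\<rho> j) (?\<rho> n)" if "j \<le> n" for j
    using that
  proof (induction rule: inc_induct)
    case base
    show ?case by (rule does_While0) simp
  next
    case (step j)
    let ?\<rho>1 = "\<rho>(d := R j, Suc d := n - j - 1, Suc (Suc d) := j)"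
    let ?d3 = "Suc (Suc (Suc d))"
    have a: "does w (Dec (Suc d)) (?\<rho> j) ?\<rho>1"
      using step by (intro does_Dec) auto
    have "ready (j # R j # env) (Suc (Suc d) # d # rs) ?d3 ?\<rho>1"
    proof -
      have "?\<rho>1 (rs ! i) = env ! i \<and> rs ! i < ?d3" if "i < length env" for i
        using r(2) that by (metis fun_upd_other less_Suc_eq less_irrefl_nat not_less_eq)
      moreover have "?\<rho>1 (Suc (Suc d)) = j" "?\<rho>1 d = R j" by simp_all
      ultimately have "?\<rho>1 ((Suc (Suc d) # d # rs) ! i) = (j # R j # env) ! i \<and> (Suc (Suc d) # d # rs) ! i < ?d3"
        if "i < Suc (Suc (length env))" for i
        using that by (auto simp only: nth_Cons split: nat.split)
      then show ?thesis using r by (simp add: ready_def)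
    qed
    then have b1: "does w (compile e1 (Suc (Suc d) # d # rs) ?d3) ?\<rho>1 (?\<rho>1(?d3 := R (Suc j)))"
      unfolding RS by (rule Rec.IH(2)[OF b(3)[OF \<open>j < n\<close>]])
    have c: "does w (clear d) (?\<rho>1(?d3 := R (Suc j))) (?\<rho>1(?d3 := R (Suc j), d := 0))"
      by (intro does_clear) auto
    have d: "does w (transfer ?d3 d) (?\<rho>1(?d3 := R (Suc j), d := 0)) (?\<rho>1(d := R (Suc j)))"
      using le2[of "Suc j"] step r by (intro does_transfer) auto
    have e: "does w (Inc (Suc (Suc d))) (?\<rho>1(d := R (Suc j))) (?\<rho> (Suc j))"
      using le1 step by (intro does_Inc) auto
    show ?case
      by (rule does_While1[OF _ does_Seq[OF a does_Seq[OF b1 does_Seq[OF c does_Seq[OF d e]]]] step.IH])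
        (use step in simp)
  qed
  have eq: "\<rho>(d := R 0, Suc d := n) = ?\<rho> 0"
    using r by auto
  have 4: "does w (clear (Suc (Suc d))) (?\<rho> n) (\<rho>(d := R n))"
    using r by (intro does_clear) auto
  have "eval x (Rec e0 e1 e2) env = R n" by (simp only: eval.simps R_def n_def)
  then show ?case
    using does_Seq[OF 1 does_Seq[OF 2[unfolded eq] does_Seq[OF 3[of 0] 4]]] by (simp only: compile.simps le0)
qed

end

section \<open>Functions computable in logarithmic space\<close>

text \<open>The summand 2 keeps the base of the polynomial bounds at 2 or more, so that sums and
  constants can be absorbed by a larger exponent.\<close>

definition size_of :: "('e \<Rightarrow> nat) list \<Rightarrow> sym list \<Rightarrow> 'e \<Rightarrow> nat" where
  "size_of vs x a = length x + sum_list (map (\<lambda>p. p a) vs) + 2"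

text \<open>The numbers that a term may use are read off the parameter \<open>a\<close> by the projections in \<open>vs\<close>.\<close>

definition lsf :: "('e \<Rightarrow> nat) list \<Rightarrow> (sym list \<Rightarrow> 'e \<Rightarrow> nat) \<Rightarrow> bool" where
  "lsf vs F \<longleftrightarrow> (\<exists>e c. \<forall>x a. eval x e (map (\<lambda>p. p a) vs) = F x a \<and>
     bounded (size_of vs x a ^ c) x e (map (\<lambda>p. p a) vs))"

abbreviation lsp :: "('e \<Rightarrow> nat) list \<Rightarrow> (sym list \<Rightarrow> 'e \<Rightarrow> bool) \<Rightarrow> bool" where
  "lsp vs P \<equiv> lsf vs (\<lambda>x a. of_bool (P x a))"

text \<open>The variables under a binder: a recursion index, an accumulator or a quantified number
  is paired in front of the old parameter.\<close>

abbreviation ext :: "('e \<Rightarrow> nat) list \<Rightarrow> (nat \<times> 'e \<Rightarrow> nat) list" where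
  "ext vs \<equiv> fst # map (\<lambda>p q. p (snd q)) vs"

definition polyb :: "('e \<Rightarrow> nat) list \<Rightarrow> (sym list \<Rightarrow> 'e \<Rightarrow> nat) \<Rightarrow> bool" where
  "polyb vs F \<longleftrightarrow> (\<exists>c. \<forall>x a. F x a \<le> size_of vs x a ^ c)"

lemma size_of_ge: "2 \<le> size_of vs x a"
  by (simp add: size_of_def)

lemma size_power_mono: "c \<le> c' \<Longrightarrow> size_of vs x a ^ c \<le> size_of vs x a ^ c'"
  using size_of_ge[of vs x a] by (intro power_increasing) auto

lemma polyb_mono: "polyb vs G \<Longrightarrow> (\<And>x a. F x a \<le> G x a) \<Longrightarrow> polyb vs F"
  unfolding polyb_def by (meson order_trans)

lemma polyb_add:
  assumes "polyb vs F" "polyb vs G"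
  shows "polyb vs (\<lambda>x a. F x a + G x a)"
proof -
  obtain c d where cd: "\<And>x a. F x a \<le> size_of vs x a ^ c" "\<And>x a. G x a \<le> size_of vs x a ^ d"
    using assms unfolding polyb_def by blast
  have "F x a + G x a \<le> size_of vs x a ^ Suc (max c d)" for x a
  proof -
    have "F x a + G x a \<le> 2 * size_of vs x a ^ max c d"
      using cd[of x a] size_power_mono[of c "max c d" vs x a] size_power_mono[of d "max c d" vs x a] by simp
    also have "\<dots> \<le> size_of vs x a ^ Suc (max c d)"
      using size_of_ge[of vs x a] by simp
    finally show ?thesis .
  qed
  then show ?thesis unfolding polyb_def by blast
qed

lemma polyb_mult:
  assumes "polyb vs F" "polyb vs G"
  shows "polyb vs (\<lambda>x a. F x a * G x a)"
proof -
  obtain c d where cd: "\<And>x a. F x a \<le> size_of vs x a ^ c" "\<And>x a. G x a \<le> size_of vs x a ^ d"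
    using assms unfolding polyb_def by blast
  have "F x a * G x a \<le> size_of vs x a ^ (c + d)" for x a
    using mult_mono[OF cd] by (simp add: power_add)
  then show ?thesis unfolding polyb_def by blast
qed

lemma polyb_size: "polyb vs (\<lambda>x a. size_of vs x a)"
  unfolding polyb_def by (rule exI[of _ 1]) simp

lemma polyb_const: "polyb vs (\<lambda>x a. n)"
proof -
  have "n \<le> size_of vs x a ^ n" for x a
    using less_imp_le[OF less_exp[of n]] power_mono[OF size_of_ge[of vs x a], of n] by (rule order_trans) simp
  then show ?thesis unfolding polyb_def by blast
qed

lemma polyb_power: "polyb vs F \<Longrightarrow> polyb vs (\<lambda>x a. F x a ^ k)"
  by (induction k) (auto intro: polyb_mult polyb_const)

lemma lsfI:
  assumes "polyb vs B" "\<And>x a. eval x e (map (\<lambda>p. p a) vs) = F x a"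
    "\<And>x a. bounded (B x a) x e (map (\<lambda>p. p a) vs)"
  shows "lsf vs F"
proof -
  obtain c where "\<And>x a. B x a \<le> size_of vs x a ^ c"
    using assms(1) unfolding polyb_def by blast
  then show ?thesis unfolding lsf_def using assms(2) bounded_mono[OF assms(3)] by blast
qed

lemma lsfE:
  assumes "lsf vs F"
  obtains e B where "polyb vs B" "\<And>x a. eval x e (map (\<lambda>p. p a) vs) = F x a"
    "\<And>x a. bounded (B x a) x e (map (\<lambda>p. p a) vs)" "\<And>x a. 3 \<le> B x a" "\<And>x a. F x a \<le> B x a"
proof -
  obtain e c where e: "\<And>x a. eval x e (map (\<lambda>p. p a) vs) = F x a"
    "\<And>x a. bounded (size_of vs x a ^ c) x e (map (\<lambda>p. p a) vs)"
    using assms unfolding lsf_def by blast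
  let ?B = "\<lambda>x a. size_of vs x a ^ c + 3"
  have b: "bounded (?B x a) x e (map (\<lambda>p. p a) vs)" for x a
    by (rule bounded_mono[OF e(2)]) simp
  moreover have "F x a \<le> ?B x a" for x a
    using eval_le[OF b] by (simp add: e(1))
  moreover have "polyb vs ?B"
    by (intro polyb_add polyb_power polyb_size polyb_const)
  ultimately show ?thesis
    by (intro that[of ?B e] e(1)) auto
qed

lemma lsf_polyb: "lsf vs F \<Longrightarrow> polyb vs F"
  by (erule lsfE) (rule polyb_mono, auto)

lemma lsf_cong: "lsf vs F \<Longrightarrow> (\<And>x a. F x a = G x a) \<Longrightarrow> lsf vs G"
  by (simp add: lsf_def)

lemma lsf_var:
  assumes "p \<in> set vs"
  shows "lsf vs (\<lambda>x. p)"
proof -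
  obtain i where i: "i < length vs" "p = vs ! i"
    using assms by (metis in_set_conv_nth)
  show ?thesis
  proof (rule lsfI[OF polyb_size, where e = "Var i"])
    fix x a
    have "vs ! i \<in> set vs" using i by simp
    then have "(vs ! i) a \<le> sum_list (map (\<lambda>p. p a) vs)"
      by (intro member_le_sum_list) auto
    then show "bounded (size_of vs x a) x (Var i) (map (\<lambda>p. p a) vs)"
      using i by (simp add: size_of_def)
  qed (use i in simp)
qed

lemma lsf_zero: "lsf vs (\<lambda>x a. 0)"
  by (rule lsfI[OF polyb_size, where e = Null]) auto

lemma lsf_Suc:
  assumes "lsf vs F"
  shows "lsf vs (\<lambda>x a. Suc (F x a))"
proof -
  from assms obtain e B where e: "polyb vs B" "\<And>x a. eval x e (map (\<lambda>p. p a) vs) = F x a"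
    "\<And>x a. bounded (B x a) x e (map (\<lambda>p. p a) vs)" "\<And>x a. F x a \<le> B x a" by (rule lsfE) blast
  show ?thesis
    by (rule lsfI[OF polyb_add[OF e(1) polyb_const[of _ 1]], where e = "Succ e"])
      (use e(2,4) bounded_mono[OF e(3)] in auto)
qed

lemma lsf_const: "lsf vs (\<lambda>x a. n)"
  by (induction n) (auto intro: lsf_zero lsf_Suc)

lemma lsf_length: "lsf vs (\<lambda>x a. length x)"
  by (rule lsfI[OF polyb_size, where e = Len]) (auto simp: size_of_def)

lemma lsf_sym:
  assumes "lsf vs F"
  shows "lsf vs (\<lambda>x a. sym_code x (F x a))"
proof -
  from assms obtain e B where e: "polyb vs B" "\<And>x a. eval x e (map (\<lambda>p. p a) vs) = F x a"
    "\<And>x a. bounded (B x a) x e (map (\<lambda>p. p a) vs)" by (rule lsfE) blast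
  show ?thesis by (rule lsfI[OF e(1), where e = "Read e"]) (use e in auto)
qed

text \<open>A polynomial in polynomially bounded values is polynomially bounded. As \<open>t\<close>
  maps between parameter types, the rule also renames, permutes and drops variables.\<close>

lemma lsf_comp:
  assumes F: "lsf ws F" and ws: "\<And>p. p \<in> set ws \<Longrightarrow> lsf vs (\<lambda>x a. p (t x a))"
  shows "lsf vs (\<lambda>x a. F x (t x a))"
proof -
  have "\<exists>es B. polyb vs B \<and> polyb vs (\<lambda>x a. sum_list (map (\<lambda>p. p (t x a)) ws)) \<and>
     (\<forall>x a. map (\<lambda>e. eval x e (map (\<lambda>p. p a) vs)) es = map (\<lambda>p. p (t x a)) ws \<and>
       (\<forall>e \<in> set es. bounded (B x a) x e (map (\<lambda>p. p a) vs)))"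
    using ws
  proof (induction ws)
    case Nil
    then show ?case by (intro exI[of _ "[]"] exI[of _ "\<lambda>x a. 0"]) (simp add: polyb_const)
  next
    case (Cons p ws)
    have "\<And>p. p \<in> set ws \<Longrightarrow> lsf vs (\<lambda>x a. p (t x a))"
      by (rule Cons.prems) simp
    from Cons.IH[OF this] obtain es B where es: "polyb vs B" "polyb vs (\<lambda>x a. sum_list (map (\<lambda>p. p (t x a)) ws))"
      "\<And>x a. map (\<lambda>e. eval x e (map (\<lambda>p. p a) vs)) es = map (\<lambda>p. p (t x a)) ws"
      "\<And>x a e. e \<in> set es \<Longrightarrow> bounded (B x a) x e (map (\<lambda>p. p a) vs)"
      by blast
    have p: "lsf vs (\<lambda>x a. p (t x a))" by (rule Cons.prems) simp
    then obtain e B' where e: "polyb vs B'" "\<And>x a. eval x e (map (\<lambda>p. p a) vs) = p (t x a)"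
      "\<And>x a. bounded (B' x a) x e (map (\<lambda>p. p a) vs)" by (rule lsfE) blast
    show ?case
      by (intro exI[of _ "e # es"] exI[of _ "\<lambda>x a. B x a + B' x a"] conjI polyb_add es(1) e(1))
        (use polyb_add[OF lsf_polyb[OF p] es(2)] es(3) e(2) bounded_mono[OF es(4)] bounded_mono[OF e(3)] in auto)
  qed
  then obtain es B where es: "polyb vs B" "polyb vs (\<lambda>x a. sum_list (map (\<lambda>p. p (t x a)) ws))"
      "\<And>x a. map (\<lambda>e. eval x e (map (\<lambda>p. p a) vs)) es = map (\<lambda>p. p (t x a)) ws"
      "\<And>x a e. e \<in> set es \<Longrightarrow> bounded (B x a) x e (map (\<lambda>p. p a) vs)"
    by blast
  obtain f c where f: "\<And>x a. eval x f (map (\<lambda>p. p a) ws) = F x a"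
    "\<And>x a. bounded (size_of ws x a ^ c) x f (map (\<lambda>p. p a) ws)"
    using F unfolding lsf_def by blast
  have "polyb vs (\<lambda>x a. size_of ws x (t x a))"
    unfolding size_of_def by (intro polyb_add es(2) polyb_const lsf_polyb[OF lsf_length])
  then have "polyb vs (\<lambda>x a. B x a + size_of ws x (t x a) ^ c)"
    by (intro polyb_add es(1) polyb_power)
  then show ?thesis
    by (rule lsfI[where e = "Comp f es"])
      (use es(3) f(1) bounded_mono[OF es(4)] bounded_mono[OF f(2)] in auto)
qed

text \<open>The bound \<open>B\<close> has to be supplied, as iteration can leave the polynomial
  range (repeated doubling). Given \<open>B\<close>, the body only sees arguments of polynomial
  size, so its intermediate values are polynomial in the original size.\<close>

lemma lsf_rec:
  assumes F0: "lsf vs F0" and F2: "lsf vs F2"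
    and F1: "lsf (ext (ext vs)) (\<lambda>x q. F1 x (fst q) (fst (snd q)) (snd (snd q)))"
    and B: "polyb vs B" "\<And>x a i. i \<le> F2 x a \<Longrightarrow> rec_nat (F0 x a) (\<lambda>i r. F1 x i r a) i \<le> B x a"
  shows "lsf vs (\<lambda>x a. rec_nat (F0 x a) (\<lambda>i r. F1 x i r a) (F2 x a))"
proof -
  obtain e0 B0 where e0: "polyb vs B0" "\<And>x a. eval x e0 (map (\<lambda>p. p a) vs) = F0 x a"
      "\<And>x a. bounded (B0 x a) x e0 (map (\<lambda>p. p a) vs)"
    using F0 by (rule lsfE) blast
  obtain e2 B2 where e2: "polyb vs B2" "\<And>x a. eval x e2 (map (\<lambda>p. p a) vs) = F2 x a"
      "\<And>x a. bounded (B2 x a) x e2 (map (\<lambda>p. p a) vs)"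
    using F2 by (rule lsfE) blast
  obtain e1 c where "\<forall>x a. eval x e1 (map (\<lambda>p. p a) (ext (ext vs))) = F1 x (fst a) (fst (snd a)) (snd (snd a)) \<and>
      bounded (size_of (ext (ext vs)) x a ^ c) x e1 (map (\<lambda>p. p a) (ext (ext vs)))"
    using F1 unfolding lsf_def by blast
  note e1' = this[rule_format, of _ "(i, r, a)" for i r a]
  have m: "map (\<lambda>p. p (i, r, a)) (ext (ext vs)) = i # r # map (\<lambda>p. p a) vs" for i r a
    by (simp add: o_def)
  have sz: "size_of (ext (ext vs)) x (i, r, a) = i + r + size_of vs x a" for x i r a
    unfolding size_of_def m by simp
  have e1: "eval x e1 (i # r # map (\<lambda>p. p a) vs) = F1 x i r a"
    "bounded ((i + r + size_of vs x a) ^ c) x e1 (i # r # map (\<lambda>p. p a) vs)" for x i r a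
    using e1'[of x i r a] unfolding m sz by simp_all
  let ?R = "\<lambda>x a. rec_nat (F0 x a) (\<lambda>i r. F1 x i r a)"
  let ?B = "\<lambda>x a. B0 x a + B2 x a + (F2 x a + B x a + size_of vs x a) ^ c"
  have "polyb vs ?B"
    by (intro polyb_add polyb_power polyb_size e0 e2 B lsf_polyb[OF F2])
  then show ?thesis
  proof (rule lsfI[where e = "Rec e0 e1 e2"])
    fix x a
    have "bounded (?B x a) x e1 (i # ?R x a i # map (\<lambda>p. p a) vs)" if "i < F2 x a" for i
    proof (rule bounded_mono[OF e1(2)])
      have "?R x a i \<le> B x a" using that by (intro B(2)) simp
      then have "(i + ?R x a i + size_of vs x a) ^ c \<le> (F2 x a + B x a + size_of vs x a) ^ c"
        using that by (intro power_mono) auto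
      then show "(i + ?R x a i + size_of vs x a) ^ c \<le> ?B x a" by simp
    qed
    then show "bounded (?B x a) x (Rec e0 e1 e2) (map (\<lambda>p. p a) vs)"
      using bounded_mono[OF e0(3), of x a "?B x a"] bounded_mono[OF e2(3), of x a "?B x a"]
      by (simp add: e0(2) e1(1) e2(2))
  qed (simp add: e0(2) e1(1) e2(2))
qed

section \<open>Arithmetic, predicates and bounded quantifiers\<close>

lemma lsf_weaken: "lsf vs F \<Longrightarrow> lsf (ext vs) (\<lambda>x q. F x (snd q))"
  by (erule lsf_comp) (rule lsf_var, auto)

lemma lsf_ext_first: "lsf (ext vs) (\<lambda>x q. fst q)"
  by (rule lsf_var) simp

lemma lsf_add:
  assumes "lsf vs F" "lsf vs G"
  shows "lsf vs (\<lambda>x a. F x a + G x a)"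
proof -
  have r: "rec_nat m (\<lambda>i r. Suc r) n = m + n" for m n by (induction n) auto
  have "lsf vs (\<lambda>x a. rec_nat (F x a) (\<lambda>i r. Suc r) (G x a))"
    by (rule lsf_rec[OF assms lsf_Suc[OF lsf_weaken[OF lsf_ext_first]] polyb_add[OF assms[THEN lsf_polyb]]])
      (simp only: r add_left_mono)
  then show ?thesis by (simp add: r)
qed

lemma lsf_mult:
  assumes "lsf vs F" "lsf vs G"
  shows "lsf vs (\<lambda>x a. F x a * G x a)"
proof -
  have r: "rec_nat 0 (\<lambda>i r. r + m) n = m * n" for m n :: nat by (induction n) auto
  have "lsf vs (\<lambda>x a. rec_nat 0 (\<lambda>i r. r + F x a) (G x a))"
  proof (rule lsf_rec[OF lsf_zero assms(2) _ polyb_mult[OF assms[THEN lsf_polyb]]])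
    show "lsf (ext (ext vs)) (\<lambda>x q. fst (snd q) + F x (snd (snd q)))"
      by (intro lsf_add lsf_weaken[OF lsf_weaken[OF assms(1)]] lsf_weaken[OF lsf_ext_first])
  qed (auto simp: r)
  then show ?thesis by (simp add: r)
qed

lemma lsf_pred:
  assumes "lsf vs F"
  shows "lsf vs (\<lambda>x a. F x a - 1)"
proof -
  have r: "rec_nat 0 (\<lambda>i r. i) n = n - 1" for n :: nat by (cases n) auto
  have "lsf vs (\<lambda>x a. rec_nat 0 (\<lambda>i r. i) (F x a))"
    by (rule lsf_rec[OF lsf_zero assms lsf_ext_first lsf_polyb[OF assms]]) (auto simp: r)
  then show ?thesis by (simp add: r)
qed

lemma lsf_diff:
  assumes "lsf vs F" "lsf vs G"
  shows "lsf vs (\<lambda>x a. F x a - G x a)"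
proof -
  have r: "rec_nat m (\<lambda>i r. r - 1) n = m - n" for m n :: nat by (induction n) auto
  have "lsf vs (\<lambda>x a. rec_nat (F x a) (\<lambda>i r. r - 1) (G x a))"
    by (rule lsf_rec[OF assms lsf_pred[OF lsf_weaken[OF lsf_ext_first]] lsf_polyb[OF assms(1)]]) (simp only: r diff_le_self)
  then show ?thesis unfolding r .
qed

lemma lsp_not: "lsp vs P \<Longrightarrow> lsp vs (\<lambda>x a. \<not> P x a)"
  by (rule lsf_cong[OF lsf_diff[OF lsf_const[of _ 1], where G = "\<lambda>x a. of_bool (P x a)"]]) auto

lemma lsp_conj: "lsp vs P \<Longrightarrow> lsp vs P' \<Longrightarrow> lsp vs (\<lambda>x a. P x a \<and> P' x a)"
  by (rule lsf_cong[OF lsf_mult[of vs "\<lambda>x a. of_bool (P x a)" "\<lambda>x a. of_bool (P' x a)"]]) auto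

lemma lsp_disj:
  assumes "lsp vs P" "lsp vs P'"
  shows "lsp vs (\<lambda>x a. P x a \<or> P' x a)"
  using lsp_not[OF lsp_conj[OF assms[THEN lsp_not]]] by simp

lemma lsp_imp: "lsp vs P \<Longrightarrow> lsp vs P' \<Longrightarrow> lsp vs (\<lambda>x a. P x a \<longrightarrow> P' x a)"
  unfolding imp_conv_disj by (intro lsp_disj lsp_not)

lemma lsp_le: "lsf vs F \<Longrightarrow> lsf vs G \<Longrightarrow> lsp vs (\<lambda>x a. F x a \<le> G x a)"
  by (rule lsf_cong[OF lsf_diff[OF lsf_const[of _ 1] lsf_diff[of vs F G]]]) auto

lemma lsp_less: "lsf vs F \<Longrightarrow> lsf vs G \<Longrightarrow> lsp vs (\<lambda>x a. F x a < G x a)"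
  unfolding less_eq_Suc_le by (intro lsp_le lsf_Suc)

lemma lsp_eq: "lsf vs F \<Longrightarrow> lsf vs G \<Longrightarrow> lsp vs (\<lambda>x a. F x a = G x a)"
  unfolding eq_iff[where ?'a = nat] by (intro lsp_conj lsp_le)

lemma lsf_if:
  "lsp vs P \<Longrightarrow> lsf vs F \<Longrightarrow> lsf vs G \<Longrightarrow> lsf vs (\<lambda>x a. if P x a then F x a else G x a)"
  by (rule lsf_cong[OF lsf_add[OF lsf_mult[of vs "\<lambda>x a. of_bool (P x a)" F]
        lsf_mult[OF lsp_not, of vs P G]]]) auto

lemma lsf_min: "lsf vs F \<Longrightarrow> lsf vs G \<Longrightarrow> lsf vs (\<lambda>x a. min (F x a) (G x a))"
  unfolding min_def by (intro lsf_if lsp_le)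

lemma lsp_ex:
  assumes "lsf vs F" "lsp (ext vs) (\<lambda>x q. P x (fst q) (snd q))"
  shows "lsp vs (\<lambda>x a. \<exists>i < F x a. P x i a)"
proof -
  have r: "rec_nat 0 (\<lambda>i r. of_bool (r = 1 \<or> A i)) n = (of_bool (\<exists>i<n. A i) :: nat)" for A and n :: nat
    by (induction n) (auto simp: less_Suc_eq)
  have "lsf vs (\<lambda>x a. rec_nat 0 (\<lambda>i r. of_bool (r = 1 \<or> P x i a)) (F x a))"
  proof (rule lsf_rec[OF lsf_zero assms(1) _ polyb_const[of _ 1]])
    show "lsp (ext (ext vs)) (\<lambda>x q. fst (snd q) = 1 \<or> P x (fst q) (snd (snd q)))"
      by (intro lsp_disj lsp_eq lsf_const lsf_weaken[OF lsf_ext_first]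
          lsf_comp[OF assms(2), where t = "\<lambda>x q. (fst q, snd (snd q))", simplified])
        (auto intro!: lsf_var)
  qed (simp_all only: r, simp)
  then show ?thesis by (simp only: r)
qed

lemma lsp_all:
  assumes "lsf vs F" "lsp (ext vs) (\<lambda>x q. P x (fst q) (snd q))"
  shows "lsp vs (\<lambda>x a. \<forall>i < F x a. P x i a)"
  using lsp_not[OF lsp_ex[OF assms(1) lsp_not[OF assms(2)]]] by simp

lemma lsf_div:
  assumes "lsf vs F" "lsf vs G"
  shows "lsf vs (\<lambda>x a. F x a div G x a)"
proof -
  \<comment> \<open>The accumulator is raised as long as the next multiple of \<open>n\<close> fits
    into \<open>m\<close>; \<open>m\<close> iterations are enough. The guard \<open>0 < n\<close>
    reproduces the convention that division by 0 gives 0.\<close>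
  have r: "rec_nat 0 (\<lambda>i r. r + of_bool (0 < n \<and> Suc r * n \<le> m)) i = min i (m div n)" for m n i :: nat
  proof (induction i)
    case (Suc i)
    show ?case
    proof (cases "n = 0")
      case False
      then have "Suc r * n \<le> m \<longleftrightarrow> Suc r \<le> m div n" for r
        by (simp add: less_eq_div_iff_mult_less_eq)
      then show ?thesis using Suc False by (auto simp: min_def)
    qed (use Suc in simp)
  qed simp
  have "lsf vs (\<lambda>x a. rec_nat 0 (\<lambda>i r. r + of_bool (0 < G x a \<and> Suc r * G x a \<le> F x a)) (F x a))"
  proof (rule lsf_rec[OF lsf_zero assms(1) _ lsf_polyb[OF assms(1)]])
    show "lsf (ext (ext vs)) (\<lambda>x q. fst (snd q) +
       of_bool (0 < G x (snd (snd q)) \<and> Suc (fst (snd q)) * G x (snd (snd q)) \<le> F x (snd (snd q))))"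
      by (intro lsf_add lsp_conj lsp_less lsp_le lsf_mult lsf_Suc lsf_zero
          lsf_weaken[OF lsf_weaken[OF assms(1)]] lsf_weaken[OF lsf_weaken[OF assms(2)]]
          lsf_weaken[OF lsf_ext_first])
  qed (use r in auto)
  then show ?thesis
    by (rule lsf_cong) (simp only: r, simp add: min.absorb2)
qed

lemma lsf_mod: "lsf vs F \<Longrightarrow> lsf vs G \<Longrightarrow> lsf vs (\<lambda>x a. F x a mod G x a)"
  unfolding minus_div_mult_eq_mod[symmetric] by (intro lsf_diff lsf_mult lsf_div)

text \<open>The power of 2 may be too large to be computed on its own. Halving \<open>G\<close>
  times never exceeds the value of \<open>F\<close>.\<close>

lemma lsf_shift:
  assumes "lsf vs F" "lsf vs G"
  shows "lsf vs (\<lambda>x a. F x a div 2 ^ G x a)"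
proof -
  have r: "rec_nat m (\<lambda>i r. r div 2) n = m div 2 ^ n" for m n :: nat
    by (induction n) (simp_all add: div_mult2_eq[symmetric] mult.commute)
  have "lsf vs (\<lambda>x a. rec_nat (F x a) (\<lambda>i r. r div 2) (G x a))"
    by (rule lsf_rec[OF assms lsf_div[OF lsf_weaken[OF lsf_ext_first] lsf_const] lsf_polyb[OF assms(1)]]) (simp only: r div_le_dividend)
  then show ?thesis unfolding r .
qed

lemma lsp_odd: "lsf vs F \<Longrightarrow> lsp vs (\<lambda>x a. odd (F x a))"
  unfolding odd_iff_mod_2_eq_one by (intro lsp_eq lsf_mod lsf_const)

section \<open>Bit lengths and binary digits\<close>

definition bit_length :: "nat \<Rightarrow> nat" where
  "bit_length n = length (binary n)"

lemma bit_length_simps: "bit_length n = (if n = 0 then 0 else Suc (bit_length (n div 2)))"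
  unfolding bit_length_def by (subst binary.simps) simp

lemma bit_length_0 [simp]: "bit_length 0 = 0"
  by (simp add: bit_length_simps)

lemma less_bit_length_iff: "i < bit_length n \<longleftrightarrow> n div 2 ^ i \<noteq> 0"
proof (induction i arbitrary: n)
  case 0
  show ?case by (subst bit_length_simps) simp
next
  case (Suc i)
  have "Suc i < bit_length n \<longleftrightarrow> i < bit_length (n div 2)"
    by (subst bit_length_simps) (cases "n = 0", auto)
  then show ?case using Suc[of "n div 2"] by (simp add: div_mult2_eq)
qed

lemma bit_length_le_iff: "bit_length n \<le> b \<longleftrightarrow> n < 2 ^ b"
proof -
  have "bit_length n \<le> b \<longleftrightarrow> \<not> b < bit_length n" by auto
  then show ?thesis unfolding less_bit_length_iff by (simp add: div_eq_0_iff)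
qed

lemma bit_length_le: "bit_length n \<le> n"
  by (simp add: bit_length_le_iff)

lemma nth_binary: "i < bit_length n \<Longrightarrow> binary n ! i = odd (n div 2 ^ i)"
proof (induction i arbitrary: n)
  case 0
  then have "n \<noteq> 0" by (cases "n = 0", auto)
  then show ?case by (subst binary.simps) simp
next
  case (Suc i)
  then have n: "n \<noteq> 0" by (cases "n = 0", auto)
  then have "i < bit_length (n div 2)" using Suc.prems by (subst (asm) bit_length_simps) simp
  then show ?case using Suc.IH n by (subst binary.simps) (simp add: div_mult2_eq)
qed

text \<open>Counts the positions below \<open>n\<close> at which the shifted number is still
  nonzero. No position is missed because \<open>bit_length n\<close> is at most
  \<open>n\<close>.\<close>

lemma lsf_bit_length:
  assumes "lsf vs F"
  shows "lsf vs (\<lambda>x a. bit_length (F x a))"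
proof -
  have r: "rec_nat 0 (\<lambda>i r. r + of_bool (0 < n div 2 ^ i)) i = min i (bit_length n)" for n i :: nat
  proof (induction i)
    case (Suc i)
    have "(0 < n div 2 ^ i) = (i < bit_length n)"
      unfolding less_bit_length_iff by (rule neq0_conv[symmetric])
    then show ?case using Suc by (simp only: old.nat.simps(7)) (simp add: min_def)
  qed simp
  have "lsf vs (\<lambda>x a. rec_nat 0 (\<lambda>i r. r + of_bool (0 < F x a div 2 ^ i)) (F x a))"
  proof (rule lsf_rec[OF lsf_zero assms _ lsf_polyb[OF assms]])
    show "lsf (ext (ext vs)) (\<lambda>x q. fst (snd q) + of_bool (0 < F x (snd (snd q)) div 2 ^ fst q))"
      by (intro lsf_add lsp_less lsf_shift lsf_const lsf_weaken[OF lsf_weaken[OF assms]]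
          lsf_weaken[OF lsf_ext_first] lsf_ext_first)
  qed (use r in auto)
  then show ?thesis
    by (rule lsf_cong) (simp only: r, simp add: min.absorb2 bit_length_le)
qed

subsection \<open>Words\<close>

lemma lsf_ext_snd: "p \<in> set vs \<Longrightarrow> lsf (ext vs) (\<lambda>x q. p (snd q))"
  by (rule lsf_weaken[OF lsf_var])

definition sym_of :: "nat \<Rightarrow> sym" where
  "sym_of n = (if n = 0 then Zero else if n = 1 then One else Sep)"

text \<open>Words are too long to be stored. They are represented by their length and their symbols
  as functions of the position, which is what is needed to emit them one symbol at a time.\<close>

definition lsw :: "('e \<Rightarrow> nat) list \<Rightarrow> (sym list \<Rightarrow> 'e \<Rightarrow> sym list) \<Rightarrow> bool" where
  "lsw vs W \<longleftrightarrow> (\<exists>L Y. lsf vs L \<and> lsf (ext vs) (\<lambda>x q. Y x (fst q) (snd q)) \<and>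
     (\<forall>x a. W x a = map (\<lambda>j. sym_of (Y x j a)) [0..<L x a]))"

lemma lswI:
  assumes "lsf vs L" "lsf (ext vs) (\<lambda>x q. Y x (fst q) (snd q))"
    "\<And>x a. length (W x a) = L x a" "\<And>x a j. j < L x a \<Longrightarrow> W x a ! j = sym_of (Y x j a)"
  shows "lsw vs W"
proof -
  have "W x a = map (\<lambda>j. sym_of (Y x j a)) [0..<L x a]" for x a
    using assms(3,4) by (intro nth_equalityI) auto
  then show ?thesis unfolding lsw_def using assms(1,2) by blast
qed

lemma lswE:
  assumes "lsw vs W"
  obtains Y where "lsf vs (\<lambda>x a. length (W x a))" "lsf (ext vs) (\<lambda>x q. Y x (fst q) (snd q))"
    "\<And>x a j. j < length (W x a) \<Longrightarrow> W x a ! j = sym_of (Y x j a)"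
proof -
  obtain L Y where "lsf vs L" "lsf (ext vs) (\<lambda>x q. Y x (fst q) (snd q))"
    "\<And>x a. W x a = map (\<lambda>j. sym_of (Y x j a)) [0..<L x a]"
    using assms unfolding lsw_def by blast
  then show ?thesis by (intro that[of Y]) auto
qed

lemma lsw_length: "lsw vs W \<Longrightarrow> lsf vs (\<lambda>x a. length (W x a))"
  by (erule lswE)

lemma lsw_comp:
  assumes W: "lsw ws W" and ws: "\<And>p. p \<in> set ws \<Longrightarrow> lsf vs (\<lambda>x a. p (t x a))"
  shows "lsw vs (\<lambda>x a. W x (t x a))"
proof -
  from W obtain Y where Y: "lsf ws (\<lambda>x a. length (W x a))" "lsf (ext ws) (\<lambda>x q. Y x (fst q) (snd q))"
    "\<And>x a j. j < length (W x a) \<Longrightarrow> W x a ! j = sym_of (Y x j a)" by (rule lswE) blast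
  show ?thesis
  proof (rule lswI[OF lsf_comp[OF Y(1) ws], where Y = "\<lambda>x j a. Y x j (t x a)"])
    have "lsf (ext vs) (\<lambda>x q. Y x (fst (fst q, t x (snd q))) (snd (fst q, t x (snd q))))"
      by (rule lsf_comp[OF Y(2)]) (auto intro!: lsf_weaken[OF ws] intro: lsf_ext_first)
    then show "lsf (ext vs) (\<lambda>x q. Y x (fst q) (t x (snd q)))" by simp
  qed (auto simp: Y(3))
qed

lemma lsw_weaken: "lsw vs W \<Longrightarrow> lsw (ext vs) (\<lambda>x q. W x (snd q))"
  by (erule lsw_comp) (rule lsf_var, auto)

lemma lsw_single: "lsw vs (\<lambda>x a. [s])"
proof -
  obtain n where "s = sym_of n"
    by (cases s) (auto simp: sym_of_def intro: that[of 0] that[of 1] that[of 2])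
  then show ?thesis
    by (intro lswI[OF lsf_const[of _ 1], where Y = "\<lambda>_ _ _. n"] lsf_const) auto
qed

lemma lsw_nil: "lsw vs (\<lambda>x a. [])"
  by (intro lswI[OF lsf_const[of _ 0], where Y = "\<lambda>_ _ _. 0"] lsf_const) auto

lemma lsw_bits:
  assumes "lsf vs N" "lsp (ext vs) (\<lambda>x q. P x (fst q) (snd q))"
  shows "lsw vs (\<lambda>x a. map (\<lambda>i. if P x i a then One else Zero) [0..<N x a])"
  by (rule lswI[OF assms(1), where Y = "\<lambda>x j a. of_bool (P x j a)"]) (use assms(2) in \<open>auto simp: sym_of_def\<close>)

lemma lsw_append:
  assumes "lsw vs W" "lsw vs W'"
  shows "lsw vs (\<lambda>x a. W x a @ W' x a)"
proof -
  from assms(1) obtain Y where Y: "lsf vs (\<lambda>x a. length (W x a))" "lsf (ext vs) (\<lambda>x q. Y x (fst q) (snd q))"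
    "\<And>x a j. j < length (W x a) \<Longrightarrow> W x a ! j = sym_of (Y x j a)" by (rule lswE) blast
  from assms(2) obtain Y' where Y': "lsf vs (\<lambda>x a. length (W' x a))" "lsf (ext vs) (\<lambda>x q. Y' x (fst q) (snd q))"
    "\<And>x a j. j < length (W' x a) \<Longrightarrow> W' x a ! j = sym_of (Y' x j a)" by (rule lswE) blast
  show ?thesis
  proof (rule lswI[OF lsf_add[OF Y(1) Y'(1)], where Y = "\<lambda>x j a. if j < length (W x a) then Y x j a
      else Y' x (j - length (W x a)) a"])
    have "lsf (ext vs) (\<lambda>x q. Y' x (fst (fst q - length (W x (snd q)), snd q)) (snd (fst q - length (W x (snd q)), snd q)))"
      by (rule lsf_comp[OF Y'(2)])
        (auto intro!: lsf_diff lsf_ext_first lsf_weaken[OF Y(1)] lsf_ext_snd)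
    then show "lsf (ext vs) (\<lambda>x q. if fst q < length (W x (snd q)) then Y x (fst q) (snd q)
      else Y' x (fst q - length (W x (snd q))) (snd q))"
      by (intro lsf_if lsp_less lsf_ext_first lsf_weaken[OF Y(1)] Y(2)) simp
  qed (auto simp: nth_append Y(3) Y'(3))
qed

lemma lsw_if:
  assumes "lsp vs P" "lsw vs W" "lsw vs W'"
  shows "lsw vs (\<lambda>x a. if P x a then W x a else W' x a)"
proof -
  from assms(2) obtain Y where Y: "lsf vs (\<lambda>x a. length (W x a))" "lsf (ext vs) (\<lambda>x q. Y x (fst q) (snd q))"
    "\<And>x a j. j < length (W x a) \<Longrightarrow> W x a ! j = sym_of (Y x j a)" by (rule lswE) blast
  from assms(3) obtain Y' where Y': "lsf vs (\<lambda>x a. length (W' x a))" "lsf (ext vs) (\<lambda>x q. Y' x (fst q) (snd q))"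
    "\<And>x a j. j < length (W' x a) \<Longrightarrow> W' x a ! j = sym_of (Y' x j a)" by (rule lswE) blast
  show ?thesis
    by (rule lswI[OF lsf_if[OF assms(1) Y(1) Y'(1)], where Y = "\<lambda>x j a. if P x a then Y x j a else Y' x j a"])
      (auto intro!: lsf_if lsf_weaken[OF assms(1)] Y(2) Y'(2) simp: Y(3) Y'(3))
qed

lemma concat_map_uniform:
  "concat (map (\<lambda>i. map (f i) [0..<u]) [0..<n]) = map (\<lambda>j. f (j div u) (j mod u)) [0..<n * u]"
proof (induction n)
  case (Suc n)
  have "map (f n) [0..<u] = map (\<lambda>j. f (j div u) (j mod u)) [n * u..<n * u + u]"
    by (rule nth_equalityI) auto
  then show ?case
    using Suc upt_add_eq_append[of 0 "n * u" u] by (simp add: add.commute)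
qed simp

text \<open>Since all pieces have the same length, division and remainder find the piece and the
  offset that belong to a position. The rows of a matrix encoding are such pieces.\<close>

lemma lsw_concat:
  assumes W: "lsw (ext vs) (\<lambda>x q. W x (fst q) (snd q))" and N: "lsf vs N" and U: "lsf vs U"
    and len: "\<And>x a i. length (W x i a) = U x a"
  shows "lsw vs (\<lambda>x a. concat (map (\<lambda>i. W x i a) [0..<N x a]))"
proof -
  from W obtain Y where Y: "lsf (ext (ext vs)) (\<lambda>x q. Y x (fst q) (snd q))"
    "\<And>x a j. j < length (W x (fst a) (snd a)) \<Longrightarrow> W x (fst a) (snd a) ! j = sym_of (Y x j a)"
    by (rule lswE) blast
  have eq: "W x i a = map (\<lambda>j. sym_of (Y x j (i, a))) [0..<U x a]" for x i a
    using Y(2)[of _ x "(i, a)"] len[of x i a] by (intro nth_equalityI) auto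
  show ?thesis
    unfolding eq concat_map_uniform
  proof (rule lswI[OF lsf_mult[OF N U], where Y = "\<lambda>x j a. Y x (j mod U x a) (j div U x a, a)"])
    have "lsf (ext vs) (\<lambda>x q. Y x (fst (fst q mod U x (snd q), (fst q div U x (snd q), snd q)))
        (snd (fst q mod U x (snd q), (fst q div U x (snd q), snd q))))"
      by (rule lsf_comp[OF Y(1)])
        (auto intro!: lsf_mod lsf_div lsf_ext_first lsf_weaken[OF U] lsf_ext_snd)
    then show "lsf (ext vs) (\<lambda>x q. Y x (fst q mod U x (snd q)) (fst q div U x (snd q), snd q))"
      by simp
  qed auto
qed

text \<open>The truncation at 2 mirrors \<open>sym_of\<close>, which sends every larger number to
  \<open>Sep\<close>.\<close>

lemma sym_code_eq_iff: "i < length x \<Longrightarrow> sym_code x i = min n 2 \<longleftrightarrow> x ! i = sym_of n"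
  by (auto simp: sym_code_def sym_of_def split: sym.split)

lemma lsp_prefix:
  assumes "lsw vs W"
  shows "lsp vs (\<lambda>x a. take (length (W x a)) x = W x a)"
proof -
  from assms obtain Y where Y: "lsf vs (\<lambda>x a. length (W x a))" "lsf (ext vs) (\<lambda>x q. Y x (fst q) (snd q))"
    "\<And>x a j. j < length (W x a) \<Longrightarrow> W x a ! j = sym_of (Y x j a)" by (rule lswE) blast
  have "lsp vs (\<lambda>x a. length (W x a) \<le> length x \<and>
      (\<forall>j < length (W x a). sym_code x j = min (Y x j a) 2))"
    by (intro lsp_conj lsp_le lsp_all lsp_eq lsf_sym lsf_min lsf_const lsf_length lsf_ext_first Y)
  moreover have "(length (W x a) \<le> length x \<and> (\<forall>j < length (W x a). sym_code x j = min (Y x j a) 2)) \<longleftrightarrow>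
      take (length (W x a)) x = W x a" for x a
    by (auto simp: list_eq_iff_nth_eq sym_code_eq_iff Y(3))
  ultimately show ?thesis by simp
qed

text \<open>This test replaces parsing: an instance is guessed as a tuple of numbers, and the guess
  is verified by encoding it and comparing the result with the input.\<close>

lemma lsp_word_eq:
  assumes "lsw vs W"
  shows "lsp vs (\<lambda>x a. x = W x a)"
proof -
  have "lsp vs (\<lambda>x a. length x = length (W x a) \<and> take (length (W x a)) x = W x a)"
    by (intro lsp_conj lsp_eq lsf_length lsw_length lsp_prefix assms)
  moreover have "(length x = length w \<and> take (length w) x = w) \<longleftrightarrow> x = w" for x w :: "sym list"
    by auto
  ultimately show ?thesis by simp
qed

lemma lsw_block:
  assumes "lsf vs N" "lsp (ext vs) (\<lambda>x q. P x (fst q) (snd q))"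
  shows "lsw vs (\<lambda>x a. block (map (\<lambda>i. P x i a) [0..<N x a]))"
  unfolding block_def map_map o_def by (intro lsw_append lsw_single lsw_bits assms)

lemma lsw_binary:
  assumes "lsf vs F"
  shows "lsw vs (\<lambda>x a. block (binary (F x a)))"
proof -
  have "lsw vs (\<lambda>x a. block (map (\<lambda>i. odd (F x a div 2 ^ i)) [0..<bit_length (F x a)]))"
    by (intro lsw_block lsf_bit_length assms lsp_odd lsf_shift lsf_weaken[OF assms] lsf_ext_first)
  moreover have "map (\<lambda>i. odd (n div 2 ^ i)) [0..<bit_length n] = binary n" for n
    by (intro nth_equalityI) (auto simp: nth_binary bit_length_def[symmetric])
  ultimately show ?thesis by simp
qed

lemma lsw_matrix:
  assumes N: "lsf vs N" and P: "lsp (ext (ext vs)) (\<lambda>x q. P x (fst (snd q)) (fst q) (snd (snd q)))"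
  shows "lsw vs (\<lambda>x a. enc_matrix (N x a) {(i, j). P x i j a})"
  unfolding enc_matrix_def mem_Collect_eq prod.case
proof (rule lsw_concat[OF _ N lsf_Suc[OF N]])
  have "lsw (ext vs) (\<lambda>x q. block (map (\<lambda>j. P x (fst q) j (snd q)) [0..<N x (snd q)]))"
    by (rule lsw_block[OF lsf_weaken[OF N], where P = "\<lambda>x j q. P x (fst q) j (snd q)"]) (use P in simp)
  then show "lsw (ext vs) (\<lambda>x q. block (map (\<lambda>j. P x (fst q) j (snd q)) [0..<N x (snd q)]))" .
qed (simp add: block_def)

section \<open>Computable bounds\<close>

lemma computable_const: "computable (\<lambda>k. n)"
proof -
  have "\<exists>F. general_recursive 1 F \<and> (\<forall>xs. F xs = n)"
  proof (induction n)
    case 0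
    show ?case using general_recursive.zero by (intro exI[of _ "\<lambda>_. 0"]) simp
  next
    case (Suc n)
    then obtain F where F: "general_recursive 1 F" "\<And>xs. F xs = n" by blast
    have "general_recursive 1 (\<lambda>xs. (\<lambda>xs. Suc (xs ! 0)) (map (\<lambda>F. F xs) [F]))"
      by (rule general_recursive.comp) (use F(1) general_recursive.succ in auto)
    then show ?case by (intro exI[of _ "\<lambda>xs. Suc (F xs)"]) (simp add: F(2))
  qed
  then show ?thesis unfolding computable_def by metis
qed

lemma computable_id: "computable (\<lambda>k. k)"
  unfolding computable_def using general_recursive.proj[of 0 1] by (intro exI[of _ "\<lambda>xs. xs ! 0"]) simp

lemma general_recursive_add: "general_recursive 2 (\<lambda>xs. rec_nat (tl xs ! 0) (\<lambda>i r. Suc r) (hd xs))"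
proof -
  have "general_recursive 3 (\<lambda>xs. (\<lambda>xs. Suc (xs ! 0)) (map (\<lambda>F. F xs) [\<lambda>xs. xs ! 1]))"
    by (rule general_recursive.comp) (use general_recursive.succ general_recursive.proj[of 1 3] in auto)
  then have H: "general_recursive (1 + 2) (\<lambda>xs. Suc (xs ! 1))"
    by (simp add: eval_nat_numeral)
  show ?thesis
    using general_recursive.prim[OF general_recursive.proj[of 0 1] H] by (simp add: eval_nat_numeral)
qed

lemma computable_add:
  assumes "computable f" "computable g"
  shows "computable (\<lambda>k. f k + g k)"
proof -
  obtain F G where FG: "general_recursive 1 F" "\<And>i. f i = F [i]" "general_recursive 1 G" "\<And>i. g i = G [i]"
    using assms unfolding computable_def by blast
  let ?A = "\<lambda>xs. rec_nat (tl xs ! 0) (\<lambda>i r. Suc r) (hd xs)"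
  have A: "?A [a, b] = a + b" for a b by (induction a) auto
  have "general_recursive 1 (\<lambda>xs. ?A (map (\<lambda>F. F xs) [F, G]))"
    by (rule general_recursive.comp)
      (use general_recursive_add FG(1,3) in \<open>auto simp: eval_nat_numeral\<close>)
  then show ?thesis
    unfolding computable_def using A FG(2,4)
    by (intro exI[of _ "\<lambda>xs. ?A (map (\<lambda>F. F xs) [F, G])"]) simp
qed

lemma computable_mult: "computable f \<Longrightarrow> computable (\<lambda>k. n * f k)"
  by (induction n) (auto intro: computable_const computable_add)

lemma computable_exp2:
  assumes "computable f"
  shows "computable (\<lambda>k. 2 ^ f k)"
proof -
  obtain F where F: "general_recursive 1 F" "\<And>i. f i = F [i]"
    using assms unfolding computable_def by blast
  have one: "general_recursive 0 (\<lambda>xs. (\<lambda>xs. Suc (xs ! 0)) (map (\<lambda>F :: nat list \<Rightarrow> nat. F xs) [\<lambda>_. 0]))"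
    by (rule general_recursive.comp) (use general_recursive.succ general_recursive.zero in auto)
  let ?A = "\<lambda>xs. rec_nat (tl xs ! 0) (\<lambda>i r. Suc r) (hd xs)"
  have A: "?A [a, b] = a + b" for a b by (induction a) auto
  have "general_recursive 2 (\<lambda>xs. ?A (map (\<lambda>F. F xs) [\<lambda>xs. xs ! 1, \<lambda>xs. xs ! 1]))"
    by (rule general_recursive.comp)
      (use general_recursive_add general_recursive.proj[of 1 2] in \<open>auto simp: eval_nat_numeral\<close>)
  then have H: "general_recursive (0 + 2) (\<lambda>xs. ?A [xs ! 1, xs ! 1])"
    by (simp only: list.map add_0)
  define E where "E = (\<lambda>xs :: nat list. rec_nat (Suc 0) (\<lambda>i r. ?A [(i # r # tl xs) ! 1, (i # r # tl xs) ! 1]) (hd xs))"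
  have E: "general_recursive 1 E"
    using general_recursive.prim[OF one H] by (simp add: E_def)
  have "E [n] = 2 ^ n" for n unfolding E_def A by (induction n) auto
  moreover have "general_recursive 1 (\<lambda>xs. E (map (\<lambda>F. F xs) [F]))"
    by (rule general_recursive.comp) (use E F(1) in auto)
  ultimately show ?thesis
    unfolding computable_def using F(2) by (intro exI[of _ "\<lambda>xs. E (map (\<lambda>F. F xs) [F])"]) simp
qed

section \<open>Oracle reductions from computable query words\<close>

text \<open>Leaves the \<open>Ask\<close> in \<open>oracle_round\<close> as the only query of the
  whole program, as the single query state demands.\<close>

lemma asks_comp: "asks (compile e rs d) K = {}"
proof -
  have list: "(\<forall>c \<in> set cs. \<forall>rs d K. asks (c rs d) K = {}) \<Longrightarrow> asks (comp_list cs rs d) K = {}"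
    for cs rs d K
    by (induction cs arbitrary: d K) (auto simp: skip_def)
  have cl: "asks (clear_all d k) K = {}" for d k K
    by (induction k arbitrary: d K) (auto simp: skip_def clear_def)
  show ?thesis
    by (induction e arbitrary: rs d K)
      (auto simp: skip_def clear_def transfer_def copy_def rewind_def measure_input_def
        lookup_input_def Let_def cl list)
qed

lemma asks_subset_stacks: "asks c K \<subseteq> stacks c K"
  by (induction c K rule: asks.induct) auto

section \<open>The loop over the oracle queries\<close>

definition emit_code :: "nat \<Rightarrow> com" where
  "emit_code t = IfZ t (Emit Zero) (Seq (Dec t) (IfZ t (Emit One) (Seq (clear t) (Emit Sep))))"

text \<open>The terms compute the length of the query (\<open>eL\<close>), the code of its symbol at
  a position (\<open>eY\<close>), the next round from the answer (\<open>eS\<close>) and whether to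
  continue (\<open>eC\<close>), each from the current round number.\<close>

definition oracle_round :: "exp \<Rightarrow> exp \<Rightarrow> exp \<Rightarrow> exp \<Rightarrow> com" where
  "oracle_round eL eY eS eC = Seq (Dec 1) (Seq (compile eL [0] 2)
     (Seq (While 2 (Seq (Dec 2) (Seq (compile eY [3, 0] 4) (Seq (emit_code 4) (Inc 3)))))
     (Seq (clear 3) (Seq (Ask 2) (Seq (compile eS [2, 0] 3)
     (Seq (clear 2) (Seq (clear 0) (Seq (transfer 3 0) (compile eC [0] 1)))))))))"

text \<open>Register 0 starts at 2, the number of the first query round. When the loop ends it holds
  0 or 1, which \<open>final\<close> turns into the verdict.\<close>

definition oracle_prog :: "exp \<Rightarrow> exp \<Rightarrow> exp \<Rightarrow> exp \<Rightarrow> com" where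
  "oracle_prog eL eY eS eC = Seq (Inc 0) (Seq (Inc 0) (Seq (Inc 1) (While 1 (oracle_round eL eY eS eC))))"

definition final :: "com \<Rightarrow> com" where
  "final c = Seq c (IfZ 0 (Halt False) (Halt True))"

lemma asks_oracle_prog: "\<exists>qK. asks (final (oracle_prog eL eY eS eC)) [] = {Ask 2 # qK}"
  by (simp add: final_def oracle_prog_def oracle_round_def asks_comp emit_code_def clear_def transfer_def)

text \<open>The registers 0, \<dots>, 4 hold the round, the loop flag, the remaining length of the query
  and later its answer, the position in the query, and a symbol code.\<close>

definition regs5 :: "nat \<Rightarrow> nat \<Rightarrow> nat \<Rightarrow> nat \<Rightarrow> nat \<Rightarrow> nat" where
  "regs5 a b c d = (\<lambda>_. 0)(0 := a, 1 := b, 2 := c, 3 := d)"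

lemma regs5_upd:
  "(regs5 a b c d)(0 := n) = regs5 n b c d" "(regs5 a b c d)(1 := n) = regs5 a n c d"
  "(regs5 a b c d)(Suc 0 := n) = regs5 a n c d"
  "(regs5 a b c d)(2 := n) = regs5 a b n d" "(regs5 a b c d)(3 := n) = regs5 a b c n"
  "(regs5 a b c d)(4 := 0) = regs5 a b c d"
  by (auto simp: regs5_def)

lemma regs5_sel [simp]:
  "regs5 a b c d 0 = a" "regs5 a b c d (Suc 0) = b" "regs5 a b c d 2 = c" "regs5 a b c d 3 = d"
  "4 \<le> r \<Longrightarrow> regs5 a b c d r = 0"
  by (auto simp: regs5_def)

context
  fixes x :: "sym list" and Q :: "sym list set" and ok :: "sym list \<Rightarrow> bool" and V :: nat
  assumes V: "3 \<le> V"
begin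

text \<open>The analogue of \<open>does\<close> for commands that change the contents of the oracle
  tape.\<close>

definition goes :: "com \<Rightarrow> (nat \<Rightarrow> nat) \<Rightarrow> sym list \<Rightarrow> (nat \<Rightarrow> nat) \<Rightarrow> sym list \<Rightarrow> bool" where
  "goes c \<rho> w \<rho>' w' \<longleftrightarrow> (\<forall>p \<le> Suc (length x). \<exists>p' \<le> Suc (length x). exec x Q ok V c (\<rho>, p, w) (\<rho>', p', w'))"

lemma goes_Seq: "goes c1 \<rho> w \<rho>' w' \<Longrightarrow> goes c2 \<rho>' w' \<rho>'' w'' \<Longrightarrow> goes (Seq c1 c2) \<rho> w \<rho>'' w''"
  unfolding goes_def by (meson exec.Seq)

lemma goes_While0: "\<rho> r = 0 \<Longrightarrow> goes (While r c) \<rho> w \<rho> w"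
  unfolding goes_def by (meson exec.While0)

lemma goes_While1:
  "\<rho> r > 0 \<Longrightarrow> goes c \<rho> w \<rho>' w' \<Longrightarrow> goes (While r c) \<rho>' w' \<rho>'' w'' \<Longrightarrow> goes (While r c) \<rho> w \<rho>'' w''"
  unfolding goes_def by (meson exec.While1)

lemma goes_IfZ0: "\<rho> r = 0 \<Longrightarrow> goes c1 \<rho> w \<rho>' w' \<Longrightarrow> goes (IfZ r c1 c2) \<rho> w \<rho>' w'"
  unfolding goes_def by (meson exec.IfZ0)

lemma goes_IfZ1: "\<rho> r > 0 \<Longrightarrow> goes c2 \<rho> w \<rho>' w' \<Longrightarrow> goes (IfZ r c1 c2) \<rho> w \<rho>' w'"
  unfolding goes_def by (meson exec.IfZ1)

lemma goes_Inc: "\<rho> r < V \<Longrightarrow> \<rho>' = \<rho>(r := Suc (\<rho> r)) \<Longrightarrow> goes (Inc r) \<rho> w \<rho>' w"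
  unfolding goes_def using exec.Inc by blast

lemma goes_Dec: "\<rho> r > 0 \<Longrightarrow> \<rho>' = \<rho>(r := \<rho> r - 1) \<Longrightarrow> goes (Dec r) \<rho> w \<rho>' w"
  unfolding goes_def using exec.Dec by blast

lemma goes_Emit: "goes (Emit s) \<rho> w \<rho> (w @ [s])"
  unfolding goes_def using exec.Emit by blast

lemma goes_clear: "\<rho>' = \<rho>(a := 0) \<Longrightarrow> goes (clear a) \<rho> w \<rho>' w"
  unfolding goes_def using ex_clear[OF V] by blast

lemma goes_transfer:
  "a \<noteq> b \<Longrightarrow> \<rho> a + \<rho> b \<le> V \<Longrightarrow> \<rho>' = \<rho>(a := 0, b := \<rho> a + \<rho> b) \<Longrightarrow> goes (transfer a b) \<rho> w \<rho>' w"
  unfolding goes_def using ex_transfer[OF V] by blast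

lemma goes_Ask:
  assumes "ok w" "\<rho> r = 0" "\<rho>' = \<rho>(r := of_bool (w \<in> Q))"
  shows "goes (Ask r) \<rho> w \<rho>' []"
proof -
  have "exec x Q ok V (Ask r) (\<rho>, p, w) (\<rho>', p, [])" for p
  proof (cases "w \<in> Q")
    case True
    then show ?thesis using exec.AskYes[where ok = ok and w = w and Q = Q and \<rho> = \<rho> and r = r and V = V] assms V by simp
  next
    case False
    then have "\<rho>' = \<rho>" using assms(2,3) by auto
    then show ?thesis using exec.AskNo[where ok = ok and w = w and Q = Q and \<rho> = \<rho>] assms(1) False by simp
  qed
  then show ?thesis unfolding goes_def by blast
qed

lemma goes_comp:
  assumes "bounded V x e env" "ready env rs d \<rho>" "\<rho>' = \<rho>(d := eval x e env)"
  shows "goes (compile e rs d) \<rho> w \<rho>' w"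
  using does_comp[OF V assms(1,2), of Q ok w] unfolding does_def[OF V] goes_def assms(3) .

lemma goes_emit_code:
  assumes "\<rho>' = \<rho>(t := 0)"
  shows "goes (emit_code t) \<rho> w \<rho>' (w @ [sym_of (\<rho> t)])"
proof -
  consider "\<rho> t = 0" | "\<rho> t = 1" | "\<rho> t \<ge> 2" by linarith
  then show ?thesis
  proof cases
    case 1
    then have "\<rho>' = \<rho>" using assms by auto
    then show ?thesis
      unfolding emit_code_def using 1 by (intro goes_IfZ0) (simp_all add: sym_of_def goes_Emit)
  next
    case 2
    then have s: "sym_of (\<rho> t) = One" by (simp add: sym_of_def)
    show ?thesis
      unfolding emit_code_def s
      by (rule goes_IfZ1[OF _ goes_Seq[OF goes_Dec[OF _ refl] goes_IfZ0]])
        (use 2 assms goes_Emit in auto)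
  next
    case 3
    then have s: "sym_of (\<rho> t) = Sep" by (simp add: sym_of_def)
    have \<rho>': "\<rho>' = (\<rho>(t := \<rho> t - 1))(t := 0)" using assms by simp
    show ?thesis
      unfolding emit_code_def s
      by (rule goes_IfZ1[OF _ goes_Seq[OF goes_Dec[OF _ refl] goes_IfZ1[OF _ goes_Seq[OF goes_clear[OF \<rho>'] goes_Emit]]]])
        (use 3 in auto)
  qed
qed

lemma goes_oracle_round:
  assumes L: "bounded V x eL [r]" "eval x eL [r] = length w"
    and Y: "\<And>j. j < length w \<Longrightarrow> bounded V x eY [j, r]"
      "\<And>j. j < length w \<Longrightarrow> w ! j = sym_of (eval x eY [j, r])"
    and ok: "ok w"
    and S: "bounded V x eS [of_bool (w \<in> Q), r]" "eval x eS [of_bool (w \<in> Q), r] = r'"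
    and C: "bounded V x eC [r']" "eval x eC [r'] = f"
  shows "goes (oracle_round eL eY eS eC) (regs5 r 1 0 0) [] (regs5 r' f 0 0) []"
proof -
  let ?n = "length w"
  have n: "?n \<le> V" using eval_le[OF L(1) V] L(2) by simp
  have r': "r' \<le> V" using eval_le[OF S(1) V] S(2) by simp
  have 1: "goes (Dec 1) (regs5 r 1 0 0) [] (regs5 r 0 0 0) []"
    by (rule goes_Dec) (simp_all add: regs5_upd)
  have 2: "goes (compile eL [0] 2) (regs5 r 0 0 0) [] (regs5 r 0 ?n 0) []"
  proof (rule goes_comp[OF L(1)])
    have "regs5 r 0 0 0 i = 0" if "2 \<le> i" for i using that by (auto simp: regs5_def)
    then show "ready [r] [0] 2 (regs5 r 0 0 0)" by (auto simp: ready_def)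
  qed (simp add: L(2) regs5_upd)
  let ?B = "Seq (Dec 2) (Seq (compile eY [3, 0] 4) (Seq (emit_code 4) (Inc 3)))"
  have 3: "goes (While 2 ?B) (regs5 r 0 (?n - j) j) (take j w) (regs5 r 0 0 ?n) w" if "j \<le> ?n" for j
    using that
  proof (induction rule: inc_induct)
    case base
    show ?case using goes_While0[of "regs5 r 0 0 ?n" 2] by simp
  next
    case (step j)
    have a: "goes (Dec 2) (regs5 r 0 (?n - j) j) (take j w) (regs5 r 0 (?n - Suc j) j) (take j w)"
      by (rule goes_Dec) (use step in \<open>simp_all add: regs5_upd\<close>)
    have b: "goes (compile eY [3, 0] 4) (regs5 r 0 (?n - Suc j) j) (take j w)
        ((regs5 r 0 (?n - Suc j) j)(4 := eval x eY [j, r])) (take j w)"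
      by (rule goes_comp[OF Y(1)]) (use step in \<open>auto simp: ready_def nth_Cons split: nat.split\<close>)
    have c: "goes (emit_code 4) ((regs5 r 0 (?n - Suc j) j)(4 := eval x eY [j, r])) (take j w)
        (regs5 r 0 (?n - Suc j) j) (take (Suc j) w)"
      using goes_emit_code[OF refl, where \<rho> = "(regs5 r 0 (?n - Suc j) j)(4 := eval x eY [j, r])" and t = 4 and w = "take j w"]
        Y(2)[OF step(2)] step(2) by (simp add: regs5_upd take_Suc_conv_app_nth)
    have d: "goes (Inc 3) (regs5 r 0 (?n - Suc j) j) (take (Suc j) w)
        (regs5 r 0 (?n - Suc j) (Suc j)) (take (Suc j) w)"
      by (rule goes_Inc) (use step n in \<open>simp_all add: regs5_upd\<close>)
    show ?case
      by (rule goes_While1[OF _ goes_Seq[OF a goes_Seq[OF b goes_Seq[OF c d]]] step.IH])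
        (use step in simp)
  qed
  have 4: "goes (clear 3) (regs5 r 0 0 ?n) w (regs5 r 0 0 0) w"
    by (rule goes_clear) (simp add: regs5_upd)
  let ?b = "of_bool (w \<in> Q)"
  have 5: "goes (Ask 2) (regs5 r 0 0 0) w (regs5 r 0 ?b 0) []"
    by (rule goes_Ask[OF ok]) (simp_all add: regs5_upd)
  have 6: "goes (compile eS [2, 0] 3) (regs5 r 0 ?b 0) [] (regs5 r 0 ?b r') []"
  proof (rule goes_comp[OF S(1)])
    have "regs5 r 0 ?b 0 i = 0" if "3 \<le> i" for i using that by (auto simp: regs5_def)
    then show "ready [?b, r] [2, 0] 3 (regs5 r 0 ?b 0)"
      by (auto simp: ready_def nth_Cons split: nat.split)
  qed (simp add: S(2) regs5_upd)
  have 7: "goes (clear 2) (regs5 r 0 ?b r') [] (regs5 r 0 0 r') []"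
    by (rule goes_clear) (simp add: regs5_upd)
  have 8: "goes (clear 0) (regs5 r 0 0 r') [] (regs5 0 0 0 r') []"
    by (rule goes_clear) (simp add: regs5_upd)
  have 9: "goes (transfer 3 0) (regs5 0 0 0 r') [] (regs5 r' 0 0 0) []"
    by (rule goes_transfer) (use r' in \<open>simp_all add: regs5_upd\<close>)
  have 10: "goes (compile eC [0] 1) (regs5 r' 0 0 0) [] (regs5 r' f 0 0) []"
  proof (rule goes_comp[OF C(1)])
    have "regs5 r' 0 0 0 i = 0" if "1 \<le> i" for i using that by (auto simp: regs5_def)
    then show "ready [r'] [0] 1 (regs5 r' 0 0 0)" by (auto simp: ready_def)
  qed (simp add: C(2) regs5_upd)
  show ?thesis
    unfolding oracle_round_def using 3[of 0]
    by (intro goes_Seq[OF 1] goes_Seq[OF 2] goes_Seq[OF _ goes_Seq[OF 4 goes_Seq[OF 5 goes_Seq[OF 6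
        goes_Seq[OF 7 goes_Seq[OF 8 goes_Seq[OF 9 10]]]]]]]) simp
qed

end

lemma polyb_id: "polyb [\<lambda>r. r] F \<Longrightarrow> \<exists>c. \<forall>x r. F x r \<le> (length x + r + 2) ^ c"
  by (simp add: polyb_def size_of_def)

text \<open>In round \<open>r = 2 + 2 * i + q\<close>, the oracle is asked for the word \<open>W x (q, i)\<close>. The rounds
  0 and 1 stand for rejection and acceptance.\<close>

definition round_step :: "(sym list \<Rightarrow> nat \<Rightarrow> bool) \<Rightarrow> sym list \<Rightarrow> nat \<Rightarrow> nat \<Rightarrow> nat" where
  "round_step live x b r =
     (if b = 0 then if live x (r div 2) then 2 * (r div 2) + 2 else 0
      else if r mod 2 = 0 then Suc r else 1)"

lemma lsf_round_step:
  assumes "lsp [\<lambda>i. i] live"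
  shows "lsf [fst, snd] (\<lambda>x q. round_step live x (fst q) (snd q))"
proof -
  have v: "lsf [fst, snd] (\<lambda>x. fst)" "lsf [fst, snd] (\<lambda>x. snd)"
    by (rule lsf_var, simp)+
  have "lsp [fst, snd] (\<lambda>x q. live x (snd q div 2))"
    by (rule lsf_comp[OF assms]) (auto intro!: lsf_div v lsf_const)
  then show ?thesis
    unfolding round_step_def by (intro lsf_if lsp_eq lsf_add lsf_mult lsf_mod lsf_div lsf_Suc v lsf_const)
qed

context
  fixes x :: "sym list" and Q :: "sym list set" and ok :: "sym list \<Rightarrow> bool" and V :: nat
    and eL eY eS eC :: exp and W :: "nat \<times> nat \<Rightarrow> sym list" and live :: "sym list \<Rightarrow> nat \<Rightarrow> bool" and N :: nat
  assumes V: "3 \<le> V"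
    and L: "\<And>r. r < 2 * N + 2 \<Longrightarrow> bounded V x eL [r]"
      "\<And>r. eval x eL [r] = length (W (r mod 2, r div 2 - 1))"
    and Y: "\<And>r j. r < 2 * N + 2 \<Longrightarrow> j < length (W (r mod 2, r div 2 - 1)) \<Longrightarrow> bounded V x eY [j, r]"
      "\<And>r j. j < length (W (r mod 2, r div 2 - 1)) \<Longrightarrow>
        W (r mod 2, r div 2 - 1) ! j = sym_of (eval x eY [j, r])"
    and S: "\<And>b r. r < 2 * N + 2 \<Longrightarrow> b \<le> 1 \<Longrightarrow> bounded V x eS [b, r]"
      "\<And>b r. eval x eS [b, r] = round_step live x b r"
    and C: "\<And>r. r < 2 * N + 2 \<Longrightarrow> bounded V x eC [r]" "\<And>r. eval x eC [r] = of_bool (2 \<le> r)"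
    and live: "\<And>i. live x i \<longleftrightarrow> i < N" and N: "0 < N"
    and ok: "\<And>q i. i < N \<Longrightarrow> q < 2 \<Longrightarrow> ok (W (q, i))"
begin

lemma goes_one_round:
  assumes "2 \<le> r" "r < 2 * N + 2"
  shows "goes x Q ok V (oracle_round eL eY eS eC) (regs5 r 1 0 0) []
    (regs5 (round_step live x (of_bool (W (r mod 2, r div 2 - 1) \<in> Q)) r)
      (of_bool (2 \<le> round_step live x (of_bool (W (r mod 2, r div 2 - 1) \<in> Q)) r)) 0 0) []"
proof (rule goes_oracle_round[OF V])
  have "r div 2 < Suc N" using assms(2) by linarith
  then show "ok (W (r mod 2, r div 2 - 1))" using assms(1) N by (intro ok) auto
  \<comment> \<open>The bound is even, so the successor of a smaller even number, the round of the
    second question, stays below it.\<close>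
  have "r mod 2 = 0 \<Longrightarrow> Suc r < 2 * N + 2"
    using assms(2) by presburger
  then have "round_step live x b r < 2 * N + 2" for b
    by (simp add: round_step_def live)
  then show "bounded V x eC [round_step live x (of_bool (W (r mod 2, r div 2 - 1) \<in> Q)) r]"
    by (intro C(1))
qed (use assms L Y S C(2) in auto)

text \<open>Downward induction on the first index still to be tried. The case \<open>i = N\<close>
  is the state in which no index is left and the round number has become 0.\<close>

lemma goes_loop:
  assumes "i \<le> N" "i = N \<Longrightarrow> r = 0" "i < N \<Longrightarrow> r = 2 * i + 2"
  shows "goes x Q ok V (While 1 (oracle_round eL eY eS eC)) (regs5 r (of_bool (2 \<le> r)) 0 0) []
    (regs5 (of_bool (\<exists>i'<N. i \<le> i' \<and> W (0, i') \<in> Q \<and> W (1, i') \<in> Q)) 0 0 0) []"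
  using assms
proof (induction arbitrary: r rule: inc_induct)
  case base
  have none: "(\<exists>i'<N. N \<le> i' \<and> W (0, i') \<in> Q \<and> W (1, i') \<in> Q) = False" by auto
  show ?case using base goes_While0[OF V, of "regs5 0 0 0 0" 1] unfolding none by simp
next
  case (step i)
  let ?G = "\<lambda>i. of_bool (\<exists>i'<N. i \<le> i' \<and> W (0, i') \<in> Q \<and> W (1, i') \<in> Q) :: nat"
  \<comment> \<open>The round taken after a negative answer to either question: the first question
    for the next index, or rejection if there is none.\<close>
  let ?nxt = "if Suc i < N then 2 * Suc i + 2 else 0"
  have r: "r = 2 * i + 2" using step by simp
  have IH: "goes x Q ok V (While 1 (oracle_round eL eY eS eC)) (regs5 ?nxt (of_bool (2 \<le> ?nxt)) 0 0) []
      (regs5 (?G (Suc i)) 0 0 0) []"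
    by (rule step.IH) (use step.hyps in auto)
  have split: "(\<exists>i'<N. i \<le> i' \<and> W (0, i') \<in> Q \<and> W (1, i') \<in> Q) \<longleftrightarrow>
      W (0, i) \<in> Q \<and> W (1, i) \<in> Q \<or> (\<exists>i'<N. Suc i \<le> i' \<and> W (0, i') \<in> Q \<and> W (1, i') \<in> Q)"
  proof -
    have e: "i \<le> i' \<longleftrightarrow> i' = i \<or> Suc i \<le> i'" for i' by auto
    show ?thesis unfolding e using step.hyps(2) by blast
  qed
  have r1: "goes x Q ok V (oracle_round eL eY eS eC) (regs5 (2 * i + 2) 1 0 0) []
      (regs5 (if W (0, i) \<in> Q then 2 * i + 3 else ?nxt)
        (of_bool (2 \<le> (if W (0, i) \<in> Q then 2 * i + 3 else ?nxt))) 0 0) []"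
  proof -
    have m: "(2 * i + 2) mod 2 = 0" "(2 * i + 2) div 2 = Suc i" by presburger+
    have s: "round_step live x (of_bool p) (2 * i + 2) = (if p then 2 * i + 3 else ?nxt)" for p
      unfolding round_step_def m live by simp
    show ?thesis
      using goes_one_round[of "2 * i + 2"] step.hyps(2) unfolding s m by simp
  qed
  have r2: "goes x Q ok V (oracle_round eL eY eS eC) (regs5 (2 * i + 3) 1 0 0) []
      (regs5 (if W (1, i) \<in> Q then 1 else ?nxt)
        (of_bool (2 \<le> (if W (1, i) \<in> Q then 1 else ?nxt))) 0 0) []"
  proof -
    have m: "(2 * i + 3) mod 2 = 1" "(2 * i + 3) div 2 = Suc i" by presburger+
    have s: "round_step live x (of_bool p) (2 * i + 3) = (if p then 1 else ?nxt)" for p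
      unfolding round_step_def m live by simp
    show ?thesis
      using goes_one_round[of "2 * i + 3"] step.hyps(2) unfolding s m by simp
  qed
  have "goes x Q ok V (While 1 (oracle_round eL eY eS eC)) (regs5 (2 * i + 2) 1 0 0) [] (regs5 (?G i) 0 0 0) []"
  proof (cases "W (0, i) \<in> Q")
    case False
    then have G: "?G i = ?G (Suc i)" unfolding split by simp
    show ?thesis
      unfolding G by (rule goes_While1[OF V _ r1[unfolded if_not_P[OF False]] IH]) simp
  next
    case True
    have 2: "goes x Q ok V (While 1 (oracle_round eL eY eS eC)) (regs5 (2 * i + 3) 1 0 0) [] (regs5 (?G i) 0 0 0) []"
    proof (cases "W (1, i) \<in> Q")
      case False
      then have G: "?G i = ?G (Suc i)" unfolding split by simp
      show ?thesis
        unfolding G by (rule goes_While1[OF V _ r2[unfolded if_not_P[OF False]] IH]) simp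
    next
      case True': True
      then have G: "?G i = 1" unfolding split using True by simp
      show ?thesis
        unfolding G
        by (rule goes_While1[OF V _ r2[unfolded if_P[OF True']]])
          (use goes_While0[OF V, of "regs5 1 0 0 0" 1] in simp_all)
    qed
    show ?thesis
      by (rule goes_While1[OF V _ r1[unfolded if_P[OF True]]]) (use 2 in simp_all)
  qed
  then show ?case unfolding r by simp
qed

lemma goes_oracle_prog:
  "goes x Q ok V (oracle_prog eL eY eS eC) (\<lambda>_. 0) []
    (regs5 (of_bool (\<exists>i<N. W (0, i) \<in> Q \<and> W (1, i) \<in> Q)) 0 0 0) []"
proof -
  have z: "(\<lambda>_. 0) = regs5 0 0 0 0" by (auto simp: regs5_def)
  have 1: "goes x Q ok V (Inc 0) (regs5 0 0 0 0) [] (regs5 1 0 0 0) []"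
    by (rule goes_Inc[OF V]) (use V in \<open>simp_all add: regs5_upd\<close>)
  have 2: "goes x Q ok V (Inc 0) (regs5 1 0 0 0) [] (regs5 2 0 0 0) []"
    by (rule goes_Inc[OF V]) (use V in \<open>simp_all add: regs5_upd numeral_2_eq_2\<close>)
  have 3: "goes x Q ok V (Inc 1) (regs5 2 0 0 0) [] (regs5 2 1 0 0) []"
    by (rule goes_Inc[OF V]) (use V in \<open>simp_all add: regs5_upd\<close>)
  show ?thesis
    unfolding oracle_prog_def z
    using goes_loop[of 0 2] N
    by (intro goes_Seq[OF V 1] goes_Seq[OF V 2] goes_Seq[OF V 3]) simp
qed

end

lemma size_of_simps:
  "size_of [\<lambda>r. r] x r = length x + r + 2" "size_of [fst, snd] x (j, r) = length x + j + r + 2"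
  by (simp_all add: size_of_def)

lemma real_bit_length_le: "0 < n \<Longrightarrow> real (bit_length n) \<le> log 2 (real n) + 1"
proof -
  assume n: "0 < n"
  then have "0 < bit_length n" by (simp add: less_bit_length_iff)
  then have "n div 2 ^ (bit_length n - 1) \<noteq> 0"
    using less_bit_length_iff[of "bit_length n - 1" n] by simp
  then have "2 ^ (bit_length n - 1) \<le> n" by (simp add: div_eq_0_iff not_less)
  then have "real (bit_length n - 1) \<le> log 2 (real n)" by (rule le_log2_of_power)
  then show ?thesis by simp
qed

text \<open>The frame of both reductions: exhaustive search over the indices below
  \<open>N x\<close>, each tested by two queries that both have to succeed. A counter up to
  \<open>N x\<close> has \<open>h (\<kappa> x)\<close> plus logarithmically many digits, even if
  \<open>N x\<close> itself is not polynomial in the input. For this reason the range is not given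
  by a term for \<open>N\<close> but by the predicate \<open>live\<close>, whose cost is measured in
  the input and the index.\<close>

theorem oracle_reduction:
  fixes W :: "sym list \<Rightarrow> nat \<times> nat \<Rightarrow> sym list" and \<kappa> \<kappa>' :: "sym list \<Rightarrow> nat"
  assumes W: "lsw [fst, snd] W" and live: "lsp [\<lambda>i. i] live"
    and N: "\<And>x i. live x i \<longleftrightarrow> i < N x" "\<And>x. 0 < N x"
      "\<And>x. N x \<le> 2 ^ h (\<kappa> x) * (length x + 2) ^ c" "computable h"
    and Q: "\<And>x. x \<in> Q \<longleftrightarrow> (\<exists>i<N x. W x (0, i) \<in> Q' \<and> W x (1, i) \<in> Q')"
    and \<kappa>: "\<And>x q i. i < N x \<Longrightarrow> q < 2 \<Longrightarrow> \<kappa>' (W x (q, i)) \<le> g (\<kappa> x)" "computable g"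
  shows "pl_turing_reducible (Q, \<kappa>) (Q', \<kappa>')"
proof -
  let ?t = "\<lambda>r. (r mod 2, r div 2 - 1)"
  obtain Y where Y: "lsf [fst, snd] (\<lambda>x a. length (W x a))" "lsf (ext [fst, snd]) (\<lambda>x q. Y x (fst q) (snd q))"
    "\<And>x a j. j < length (W x a) \<Longrightarrow> W x a ! j = sym_of (Y x j a)"
    using W by (rule lswE) blast
  have var: "lsf [\<lambda>r. r] (\<lambda>x r. r)" "lsf [fst, snd] (\<lambda>x. fst)" "lsf [fst, snd] (\<lambda>x. snd)"
    by (rule lsf_var, simp)+
  have LL: "lsf [\<lambda>r. r] (\<lambda>x r. length (W x (?t r)))"
    by (rule lsf_comp[OF Y(1)]) (auto intro!: lsf_mod lsf_diff lsf_div var lsf_const)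
  have "lsf [fst, snd] (\<lambda>x q. Y x (fst (fst q, ?t (snd q))) (snd (fst q, ?t (snd q))))"
    by (rule lsf_comp[OF Y(2)]) (auto intro!: lsf_mod lsf_diff lsf_div var lsf_const)
  then have YY: "lsf [fst, snd] (\<lambda>x q. Y x (fst q) (?t (snd q)))" by simp
  obtain eL BL where eL: "polyb [\<lambda>r. r] BL" "\<And>x r. eval x eL (map (\<lambda>p. p r) [\<lambda>r. r]) = length (W x (?t r))"
    "\<And>x r. bounded (BL x r) x eL (map (\<lambda>p. p r) [\<lambda>r. r])"
    using LL by (rule lsfE) blast
  obtain eC BC where eC: "polyb [\<lambda>r. r] BC" "\<And>x r. eval x eC (map (\<lambda>p. p r) [\<lambda>r. r]) = of_bool (2 \<le> r)"
    "\<And>x r. bounded (BC x r) x eC (map (\<lambda>p. p r) [\<lambda>r. r])"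
    using lsp_le[OF lsf_const[of _ 2] var(1)] by (rule lsfE) blast
  obtain eY BY where eY: "polyb [fst, snd] BY"
    "\<And>x q. eval x eY (map (\<lambda>p. p q) [fst, snd]) = Y x (fst q) (?t (snd q))"
    "\<And>x q. bounded (BY x q) x eY (map (\<lambda>p. p q) [fst, snd])"
    using YY by (rule lsfE) blast
  obtain eS BS where eS: "polyb [fst, snd] BS"
    "\<And>x q. eval x eS (map (\<lambda>p. p q) [fst, snd]) = round_step live x (fst q) (snd q)"
    "\<And>x q. bounded (BS x q) x eS (map (\<lambda>p. p q) [fst, snd])"
    using lsf_round_step[OF live] by (rule lsfE) blast
  obtain cY where cY: "\<And>x j r. BY x (j, r) \<le> (length x + j + r + 2) ^ cY"
    using eY(1) unfolding polyb_def by (metis size_of_simps(2))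
  obtain cS where cS: "\<And>x j r. BS x (j, r) \<le> (length x + j + r + 2) ^ cS"
    using eS(1) unfolding polyb_def by (metis size_of_simps(2))
  \<comment> \<open>A polynomial bound in the input length and the round number alone: positions in
    a query are below its length, and answers are at most 1.\<close>
  define B where "B x r = BL x r + BC x r + (length x + length (W x (?t r)) + r + 2) ^ cY
      + (length x + 1 + r + 2) ^ cS" for x r
  have "polyb [\<lambda>r. r] B"
    unfolding B_def by (intro polyb_add polyb_power eL(1) eC(1) lsf_polyb[OF lsf_length]
        lsf_polyb[OF LL] lsf_polyb[OF var(1)] polyb_const)
  then obtain c0 where c0: "\<And>x r. B x r \<le> (length x + r + 2) ^ c0"
    using polyb_id by blast
  \<comment> \<open>All round numbers are below \<open>2 * N x + 2\<close>, so one limit serves the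
    whole run. The exponent is a successor to make the limit at least 3.\<close>
  define V where "V x = (length x + (2 * N x + 2) + 2) ^ Suc c0" for x
  have BV: "B x r \<le> V x" if "r < 2 * N x + 2" for x r
  proof -
    have "B x r \<le> (length x + r + 2) ^ c0" by (rule c0)
    also have "\<dots> \<le> (length x + (2 * N x + 2) + 2) ^ c0" using that by (intro power_mono) auto
    also have "\<dots> \<le> V x" unfolding V_def by (intro power_increasing) auto
    finally show ?thesis .
  qed
  have V3: "3 \<le> V x" for x
  proof -
    have "3 \<le> length x + (2 * N x + 2) + 2" by simp
    also have "\<dots> \<le> V x" unfolding V_def using self_le_power[of "length x + (2 * N x + 2) + 2" "Suc c0"] by simp
    finally show ?thesis .
  qed
  define b where "b x = bit_length (length x + 1)" for x :: "sym list"
  \<comment> \<open>The base of \<open>V x\<close> is at most 2 to the power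
    \<open>h (\<kappa> x) + (c + 1) * b x + 4\<close>; multiplication by \<open>Suc c0\<close> takes
    the power, and the last 1 makes the inequality strict.\<close>
  define L where "L x = (h (\<kappa> x) + (c + 1) * b x + 4) * Suc c0 + 1" for x
  have VL: "V x < 2 ^ L x" for x
  proof -
    let ?m = "h (\<kappa> x) + (c + 1) * b x + 2"
    have b2: "length x + 2 \<le> 2 ^ b x"
      using bit_length_le_iff[of "length x + 1" "b x"] by (simp add: b_def)
    have b1: "1 \<le> b x"
      using less_bit_length_iff[of 0 "length x + 1"] by (simp add: b_def)
    have "N x \<le> 2 ^ h (\<kappa> x) * (2 ^ b x) ^ c"
      by (rule order_trans[OF N(3)]) (intro mult_left_mono power_mono b2, auto)
    then have "N x \<le> 2 ^ (h (\<kappa> x) + b x * c)" by (simp add: power_add power_mult)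
    then have "2 * N x \<le> 2 ^ Suc (h (\<kappa> x) + b x * c)" by simp
    also have "(2::nat) ^ Suc (h (\<kappa> x) + b x * c) \<le> 2 ^ ?m"
      using b1 by (intro power_increasing) (auto simp: algebra_simps)
    finally have n: "2 * N x \<le> 2 ^ ?m" .
    have "length x + 2 \<le> 2 ^ ?m"
      using b2 by (rule order_trans) (intro power_increasing, auto)
    moreover have "(2::nat) ^ 2 \<le> 2 ^ ?m" by (intro power_increasing) auto
    ultimately have "length x + (2 * N x + 2) + 2 \<le> 2 ^ ?m * 2 ^ 2"
      using n unfolding power2_eq_square by linarith
    then have "length x + (2 * N x + 2) + 2 \<le> 2 ^ (?m + 2)"
      by (simp only: power_add)
    then have "V x \<le> (2 ^ (?m + 2)) ^ Suc c0"
      unfolding V_def by (intro power_mono) auto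
    also have "\<dots> = 2 ^ ((?m + 2) * Suc c0)" by (simp only: power_mult)
    also have "\<dots> < 2 ^ L x" unfolding L_def by (intro power_strict_increasing) (auto simp: algebra_simps)
    finally show ?thesis .
  qed
  define P where "P = final (oracle_prog eL eY eS eC)"
  obtain qK where qK: "asks P [] = {Ask 2 # qK}"
    using asks_oracle_prog unfolding P_def by blast
  obtain n where n: "regs P \<subseteq> {..<n}"
    using finite_nat_iff_bounded finite_regs by blast
  let ?M = "prog_otm P n 2 qK"
  have halts: "(\<exists>k. state (run ?M Q' x k) = Run [Halt (x \<in> Q)]) \<and>
      (\<forall>k. prog_run.good P n 2 qK (\<lambda>w. \<kappa>' w \<le> g (\<kappa> x)) (L x) (run ?M Q' x k))" for x
  proof -
    \<comment> \<open>The bound on the parameters of the queries enters as the admissibility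
      condition of the execution and returns as part of \<open>good\<close>.\<close>
    let ?ok = "\<lambda>w. \<kappa>' w \<le> g (\<kappa> x)"
    interpret prog_run P n 2 qK x Q' ?ok "V x" "L x"
      by unfold_locales (rule VL)
    have "goes x Q' ?ok (V x) (oracle_prog eL eY eS eC) (\<lambda>_. 0) []
       (regs5 (of_bool (\<exists>i<N x. W x (0, i) \<in> Q' \<and> W x (1, i) \<in> Q')) 0 0 0) []"
    proof (rule goes_oracle_prog[where live = live and W = "W x"])
      fix r assume r: "r < 2 * N x + 2"
      note BV = BV[OF r]
      show "bounded (V x) x eL [r]" "bounded (V x) x eC [r]"
        using bounded_mono[OF eL(3)[of x r]] bounded_mono[OF eC(3)[of x r]] BV by (auto simp: B_def)
      show "bounded (V x) x eY [j, r]" if "j < length (W x (?t r))" for j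
      proof -
        have "BY x (j, r) \<le> (length x + j + r + 2) ^ cY" by (rule cY)
        also have "\<dots> \<le> (length x + length (W x (?t r)) + r + 2) ^ cY"
          using that by (intro power_mono) auto
        also have "\<dots> \<le> V x" using BV by (simp add: B_def)
        finally show ?thesis using bounded_mono[OF eY(3)[of x "(j, r)"]] by simp
      qed
      show "bounded (V x) x eS [b, r]" if "b \<le> 1" for b
      proof -
        have "BS x (b, r) \<le> (length x + b + r + 2) ^ cS" by (rule cS)
        also have "\<dots> \<le> (length x + 1 + r + 2) ^ cS"
          using that by (intro power_mono) auto
        also have "\<dots> \<le> V x" using BV by (simp add: B_def)
        finally show ?thesis using bounded_mono[OF eS(3)[of x "(b, r)"]] by simp
      qed
    next
      show "eval x eS [b, r] = round_step live x b r" for b r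
        using eS(2)[of x "(b, r)"] by simp
      show "W x (?t r) ! j = sym_of (eval x eY [j, r])" if "j < length (W x (?t r))" for r j
        using eY(2)[of x "(j, r)"] Y(3)[OF that] by simp
    qed (use V3 eL(2) eC(2) N \<kappa>(1) in auto)
    then obtain p' where "exec x Q' ?ok (V x) (oracle_prog eL eY eS eC) (\<lambda>_. 0, 0, [])
       (regs5 (of_bool (x \<in> Q)) 0 0 0, p', [])"
      unfolding goes_def[OF V3] Q[symmetric] by blast
    note res = prog_run_result[OF P_def[unfolded final_def] n qK this]
    show ?thesis using res by simp
  qed
  show ?thesis
  \<comment> \<open>Heads reach cell \<open>Suc (L x)\<close> at most, that is,
    \<open>L x + 2\<close> cells, whence the constant 3. Bounding \<open>b x\<close> by the
    logarithm plus 1 moves a further \<open>(c + 1) * Suc c0\<close> into the constant part.\<close>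
  proof (rule pl_turing_reducibleI[where M = ?M and g = g and
        f = "\<lambda>k. Suc c0 * h k + ((c + 1 + 4) * Suc c0 + 3)" and C = "(c + 1) * Suc c0"])
    show "wf_otm ?M"
    proof (rule wf_prog_otm[OF n])
      show "{Ask 2 # qK, [Halt True], [Halt False]} \<subseteq> stacks P []"
        using asks_subset_stacks[of P "[]"] qK by (auto simp: P_def final_def)
    qed
    show "computable (\<lambda>k. Suc c0 * h k + ((c + 1 + 4) * Suc c0 + 3))"
      by (intro computable_add computable_mult computable_const N(4))
    show "decides ?M Q' Q"
      unfolding decides_def
    proof
      fix x
      obtain k where "state (run ?M Q' x k) = Run [Halt (x \<in> Q)]" using halts by blast
      then show "\<exists>k. state (run ?M Q' x k) = (if x \<in> Q then accept ?M else reject ?M)"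
        by (intro exI[of _ k]) (simp add: prog_otm_def Let_def)
    qed
    fix x
    have good: "(\<forall>(h, t) \<in> set (work (run ?M Q' x k)). h \<le> Suc (L x))"
      "state (run ?M Q' x k) = query ?M \<Longrightarrow> \<kappa>' (oracle_tape (run ?M Q' x k)) \<le> g (\<kappa> x)" for k
      using halts[of x] prog_run.good_def[OF prog_run.intro[OF VL], of P n 2 qK _ x] by auto
    show "\<kappa>' y \<le> g (\<kappa> x)" if "y \<in> queried ?M Q' x" for y
      using that good(2) unfolding queried_def by auto
    have "real (b x) \<le> log 2 (real (length x + 1)) + 1"
      unfolding b_def by (rule real_bit_length_le) simp
    then have "real ((c + 1) * Suc c0) * real (b x) \<le> real ((c + 1) * Suc c0) * (log 2 (real (length x + 1)) + 1)"
      by (rule mult_left_mono) simp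
    then have "real (L x) + 2 \<le> real (Suc c0 * h (\<kappa> x) + ((c + 1 + 4) * Suc c0 + 3)) +
        real ((c + 1) * Suc c0) * log 2 (real (length x + 1))"
      unfolding L_def by (simp add: algebra_simps)
    moreover have "real (Suc h) \<le> real (L x) + 2" if "(h, t) \<in> set (work (run ?M Q' x k))" for h t k
      using good(1)[of k] that by fastforce
    ultimately show "space_within ?M Q' x (real (Suc c0 * h (\<kappa> x) + ((c + 1 + 4) * Suc c0 + 3)) +
        real ((c + 1) * Suc c0) * log 2 (real (length x + 1)))"
      unfolding space_within_def by fastforce
  qed (rule \<kappa>(2))
qed

section \<open>Paths, path structures and embeddings\<close>

definition mk_graph :: "nat \<Rightarrow> (nat \<Rightarrow> nat \<Rightarrow> bool) \<Rightarrow> nat pair_pre_digraph" where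
  "mk_graph n E = \<lparr> pverts = {..<n}, parcs = {(i, j). i < n \<and> j < n \<and> E i j} \<rparr>"

definition mk_struct :: "nat \<Rightarrow> (nat \<Rightarrow> bool) \<Rightarrow> (nat \<Rightarrow> nat \<Rightarrow> bool) \<Rightarrow> nat struct" where
  "mk_struct n R E = \<lparr> univ = {..<n}, interp = (\<lambda>v. case v of Root \<Rightarrow> {[i] | i. i < n \<and> R i}
     | Edge \<Rightarrow> {[i, j] | i j. i < n \<and> j < n \<and> E i j}) \<rparr>"

definition pat :: "nat \<Rightarrow> nat \<Rightarrow> nat struct" where
  "pat k l = mk_struct (Suc l) (\<lambda>i. i = 0) (\<lambda>i j. j = Suc i \<or> i = Suc j \<and> j \<noteq> k)"

text \<open>Paths are given as injective maps on an initial segment because embeddings of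
  \<open>pat k l\<close> have the same form.\<close>

definition pth :: "nat \<Rightarrow> (nat \<Rightarrow> nat \<Rightarrow> bool) \<Rightarrow> nat \<Rightarrow> nat \<Rightarrow> nat \<Rightarrow> (nat \<Rightarrow> nat) \<Rightarrow> bool" where
  "pth n E L u v h \<longleftrightarrow> (\<forall>i\<le>L. h i < n) \<and> inj_on h {..L} \<and> h 0 = u \<and> h L = v \<and>
     (\<forall>i<L. E (h i) (h (Suc i)))"

definition long_or_exact :: "nat \<Rightarrow> (nat \<Rightarrow> nat \<Rightarrow> bool) \<Rightarrow> nat \<Rightarrow> nat \<Rightarrow> nat \<Rightarrow> nat \<Rightarrow> bool" where
  "long_or_exact n E s t k l \<longleftrightarrow> (\<exists>v h. pth n E l s v h) \<or> (\<exists>h. pth n E k s t h)"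

lemma mk_struct_simps [simp]:
  "univ (mk_struct n R E) = {..<n}" "interp (mk_struct n R E) Root = {[i] | i. i < n \<and> R i}"
  "interp (mk_struct n R E) Edge = {[i, j] | i j. i < n \<and> j < n \<and> E i j}"
  by (simp_all add: mk_struct_def)

lemma mk_graph_simps [simp]:
  "pverts (mk_graph n E) = {..<n}" "parcs (mk_graph n E) = {(i, j). i < n \<and> j < n \<and> E i j}"
  by (simp_all add: mk_graph_def)

lemma all_vocab: "(\<forall>R. P R) \<longleftrightarrow> P Root \<and> P Edge"
proof safe
  fix R assume "P Root" "P Edge"
  then show "P R" by (cases R) auto
qed auto

lemma input_structure_mk_struct: "0 < n \<Longrightarrow> input_structure (mk_struct n R E)"
  by (auto simp: input_structure_def finite_structure_def all_vocab)

lemma input_structure_eq_mk_struct: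
  assumes "input_structure S"
  shows "S = mk_struct (card (univ S)) (\<lambda>i. [i] \<in> interp S Root) (\<lambda>i j. [i, j] \<in> interp S Edge)"
proof -
  define n where "n = card (univ S)"
  have u: "univ S = {..<n}" and fs: "finite_structure S"
    using assms unfolding input_structure_def n_def by blast+
  have r: "\<And>t. t \<in> interp S Root \<Longrightarrow> length t = 1 \<and> set t \<subseteq> univ S"
    and e: "\<And>t. t \<in> interp S Edge \<Longrightarrow> length t = 2 \<and> set t \<subseteq> univ S"
    using fs by (auto simp: finite_structure_def all_vocab)
  have r': "\<exists>i<n. t = [i]" if "t \<in> interp S Root" for t
    using r[OF that] u by (auto simp: length_Suc_conv)
  have e': "\<exists>i<n. \<exists>j<n. t = [i, j]" if "t \<in> interp S Edge" for t
    using e[OF that] u by (auto simp: length_Suc_conv numeral_2_eq_2)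
  have "interp S Root = {[i] | i. i < n \<and> [i] \<in> interp S Root}"
    using r' by blast
  moreover have "interp S Edge = {[i, j] | i j. i < n \<and> j < n \<and> [i, j] \<in> interp S Edge}"
    using e' by blast
  ultimately have i: "interp S R = interp (mk_struct n (\<lambda>i. [i] \<in> interp S Root) (\<lambda>i j. [i, j] \<in> interp S Edge)) R" for R
    by (cases R) (simp_all only: mk_struct_simps)
  show ?thesis
    unfolding n_def[symmetric]
  proof (rule struct.equality)
    show "univ S = univ (mk_struct n (\<lambda>i. [i] \<in> interp S Root) (\<lambda>i j. [i, j] \<in> interp S Edge))"
      using u by (simp only: mk_struct_simps)
  qed (rule ext, rule i, simp)
qed

lemma input_graph_mk_graph:
  "input_graph (mk_graph n E) \<longleftrightarrow> (\<forall>i<n. \<forall>j<n. E i j \<longrightarrow> i \<noteq> j \<and> E j i)"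
proof -
  have "pair_graph (mk_graph n E) \<longleftrightarrow> (\<forall>i<n. \<forall>j<n. E i j \<longrightarrow> i \<noteq> j \<and> E j i)"
  proof
    assume "pair_graph (mk_graph n E)"
    then interpret pair_graph "mk_graph n E" .
    show "\<forall>i<n. \<forall>j<n. E i j \<longrightarrow> i \<noteq> j \<and> E j i"
      using no_loops' arcs_symmetric by auto
  next
    assume *: "\<forall>i<n. \<forall>j<n. E i j \<longrightarrow> i \<noteq> j \<and> E j i"
    have "finite (parcs (mk_graph n E))"
      by (rule finite_subset[of _ "{..<n} \<times> {..<n}"]) auto
    then show "pair_graph (mk_graph n E)"
      using * by unfold_locales (auto simp: symmetric_def sym_def)
  qed
  then show ?thesis by (simp add: input_graph_def)
qed

lemma input_graph_eq_mk_graph: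
  assumes "input_graph G"
  shows "G = mk_graph (card (pverts G)) (\<lambda>i j. (i, j) \<in> parcs G)"
proof -
  define n where "n = card (pverts G)"
  have v: "pverts G = {..<n}" and "pair_graph G"
    using assms unfolding input_graph_def n_def by blast+
  then interpret pair_graph G by simp
  have a: "parcs G = {(i, j). i < n \<and> j < n \<and> (i, j) \<in> parcs G}"
    using v in_arcsD1 in_arcsD2 by blast
  show ?thesis
    unfolding n_def[symmetric]
  proof (rule pair_pre_digraph.equality)
    show "pverts G = pverts (mk_graph n (\<lambda>i j. (i, j) \<in> parcs G))"
      using v by (simp only: mk_graph_simps)
    show "parcs G = parcs (mk_graph n (\<lambda>i j. (i, j) \<in> parcs G))"
      using a by (simp only: mk_graph_simps)
  qed simp
qed

section \<open>Paths as arc lists and as injective maps\<close>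

lemma pawalk_verts_props:
  assumes "pcas u p v"
  shows "length (pawalk_verts u p) = Suc (length p)" "pawalk_verts u p ! 0 = u"
    "pawalk_verts u p ! length p = v"
    "i < length p \<Longrightarrow> p ! i = (pawalk_verts u p ! i, pawalk_verts u p ! Suc i)"
  using assms
proof (induction p arbitrary: u i)
  case (Cons e p)
  {
    case 1
    then show ?case using Cons(1) by auto
  next
    case 2
    then show ?case by auto
  next
    case 3
    then show ?case using Cons(3) by auto
  next
    case 4
    then show ?case using Cons(2)[of "snd e"] Cons(4)[of _ "snd e"] by (cases i) auto
  }
qed auto

lemma pcas_map_upt:
  assumes "a \<le> b"
  shows "pcas (h a) (map (\<lambda>i. (h i, h (Suc i))) [a..<b]) (h b) \<and>
    pawalk_verts (h a) (map (\<lambda>i. (h i, h (Suc i))) [a..<b]) = map h [a..<Suc b]"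
  using assms
proof (induction rule: inc_induct)
  case (step a)
  then show ?case by (simp add: upt_conv_Cons del: upt_Suc)
qed simp

lemma apath_iff_pth:
  "(\<exists>p. pre_digraph.apath (with_proj (mk_graph n E)) u p v \<and> length p = L) \<longleftrightarrow> (\<exists>h. pth n E L u v h)"
proof
  assume "\<exists>p. pre_digraph.apath (with_proj (mk_graph n E)) u p v \<and> length p = L"
  then obtain p where p: "u < n" "set p \<subseteq> parcs (mk_graph n E)" "pcas u p v" "distinct (pawalk_verts u p)" "length p = L"
    by (auto simp: pre_digraph.apath_def pre_digraph.awalk_def cas_with_proj_eq awalk_verts_with_proj_eq)
  let ?h = "\<lambda>i. pawalk_verts u p ! i"
  note w = pawalk_verts_props[OF p(3)]
  have arc: "?h i < n \<and> ?h (Suc i) < n \<and> E (?h i) (?h (Suc i))" if "i < L" for i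
    using w(4)[of i] that p(2,5) nth_mem[of i p] by auto
  have "?h i < n" if "i \<le> L" for i
    using that arc[of "i - 1"] w(2) p(1) by (cases i) auto
  moreover have "inj_on ?h {..L}"
    using p(4,5) w(1) by (auto simp: inj_on_def nth_eq_iff_index_eq)
  ultimately show "\<exists>h. pth n E L u v h"
    using w(2,3) arc p(5) unfolding pth_def by (intro exI[of _ ?h]) auto
next
  assume "\<exists>h. pth n E L u v h"
  then obtain h where h: "\<And>i. i \<le> L \<Longrightarrow> h i < n" "inj_on h {..L}" "h 0 = u" "h L = v"
    "\<And>i. i < L \<Longrightarrow> E (h i) (h (Suc i))" by (auto simp: pth_def)
  let ?p = "map (\<lambda>i. (h i, h (Suc i))) [0..<L]"
  have "set ?p \<subseteq> parcs (mk_graph n E)"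
    using h(1,5) by auto
  moreover have "distinct (pawalk_verts u ?p)"
    using pcas_map_upt[of 0 L h] h(2,3) by (simp add: distinct_map lessThan_Suc_atMost atLeast0LessThan del: upt_Suc)
  ultimately have "pre_digraph.apath (with_proj (mk_graph n E)) u ?p v"
    using pcas_map_upt[of 0 L h] h(1)[of 0] h(3,4)
    by (simp add: pre_digraph.apath_def pre_digraph.awalk_def cas_with_proj_eq awalk_verts_with_proj_eq)
  then show "\<exists>p. pre_digraph.apath (with_proj (mk_graph n E)) u p v \<and> length p = L"
    by (intro exI[of _ ?p]) simp
qed

lemma pth_prefix: "pth n E L u v h \<Longrightarrow> k \<le> L \<Longrightarrow> pth n E k u (h k) h"
  by (auto simp: pth_def inj_on_def)

lemma pth_length: "pth n E L u v h \<Longrightarrow> L < n"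
proof -
  assume "pth n E L u v h"
  then have "inj_on h {..L}" "h ` {..L} \<subseteq> {..<n}" by (auto simp: pth_def)
  then have "card {..L} \<le> card {..<n}" by (metis card_inj_on_le finite_lessThan)
  then show ?thesis by simp
qed

text \<open>A path of length at least \<open>l\<close> from \<open>s\<close> may be cut to length
  exactly \<open>l\<close>, since its other endpoint is not prescribed.\<close>

lemma long_or_exact_iff:
  "(\<exists>v p. pre_digraph.apath (with_proj (mk_graph n E)) s p v \<and> length p \<ge> l) \<or>
   (\<exists>p. pre_digraph.apath (with_proj (mk_graph n E)) s p t \<and> length p = k) \<longleftrightarrow> long_or_exact n E s t k l"
proof -
  have "(\<exists>v p. pre_digraph.apath (with_proj (mk_graph n E)) s p v \<and> length p \<ge> l) \<longleftrightarrow>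
      (\<exists>v L. l \<le> L \<and> (\<exists>p. pre_digraph.apath (with_proj (mk_graph n E)) s p v \<and> length p = L))"
    by blast
  also have "\<dots> \<longleftrightarrow> (\<exists>v h. pth n E l s v h)"
    unfolding apath_iff_pth using pth_prefix by blast
  finally show ?thesis unfolding apath_iff_pth long_or_exact_def by blast
qed

section \<open>Pattern structures and their embeddings\<close>

lemma input_structure_pat: "input_structure (pat k l)"
  by (simp add: pat_def input_structure_mk_struct)

text \<open>The Gaifman graph forgets directions, so the missing reverse of the arc from
  \<open>k\<close> to \<open>k + 1\<close> does not show in it.\<close>

lemma rooted_path_structure_pat: "rooted_path_structure (pat k l)"
proof -
  let ?p = "map (\<lambda>i. (i, Suc i)) [0..<l]"
  have arcs: "parcs (gaifman (pat k l)) = set ?p \<union> (set ?p)\<inverse>"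
  proof -
    have edge: "a \<noteq> b \<and> (\<exists>R. \<exists>t \<in> interp (pat k l) R. a \<in> set t \<and> b \<in> set t) \<longleftrightarrow>
        (a < l \<and> b = Suc a \<or> b < l \<and> a = Suc b)" for a b
    proof
      assume "a \<noteq> b \<and> (\<exists>R. \<exists>t \<in> interp (pat k l) R. a \<in> set t \<and> b \<in> set t)"
      then obtain R t where t: "t \<in> interp (pat k l) R" "a \<in> set t" "b \<in> set t" "a \<noteq> b" by blast
      show "a < l \<and> b = Suc a \<or> b < l \<and> a = Suc b"
        by (cases R) (use t in \<open>auto simp: pat_def\<close>)
    next
      assume "a < l \<and> b = Suc a \<or> b < l \<and> a = Suc b"
      then obtain i where i: "i < l" "a = i \<and> b = Suc i \<or> b = i \<and> a = Suc i" by metis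
      have "[i, Suc i] \<in> interp (pat k l) Edge" using i(1) by (auto simp: pat_def)
      moreover have "a \<in> set [i, Suc i]" "b \<in> set [i, Suc i]" "a \<noteq> b" using i(2) by auto
      ultimately show "a \<noteq> b \<and> (\<exists>R. \<exists>t \<in> interp (pat k l) R. a \<in> set t \<and> b \<in> set t)"
        by blast
    qed
    have "parcs (gaifman (pat k l)) = {(a, b). a < l \<and> b = Suc a \<or> b < l \<and> a = Suc b}"
      by (simp only: gaifman_def pair_pre_digraph.select_convs edge)
    also have "\<dots> = set ?p \<union> (set ?p)\<inverse>" by auto
    finally show ?thesis .
  qed
  have verts: "pverts (gaifman (pat k l)) = {..<Suc l}"
    by (simp add: gaifman_def pat_def)
  note upt = pcas_map_upt[of 0 l "\<lambda>i. i"]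
  have "pre_digraph.apath (with_proj (gaifman (pat k l))) 0 ?p l"
    using upt arcs verts
    by (simp add: pre_digraph.apath_def pre_digraph.awalk_def cas_with_proj_eq awalk_verts_with_proj_eq del: upt_Suc)
  moreover have "pverts (gaifman (pat k l)) = set (pre_digraph.awalk_verts (with_proj (gaifman (pat k l))) 0 ?p)"
    unfolding awalk_verts_with_proj_eq verts using upt by (simp add: atLeast0LessThan del: upt_Suc)
  ultimately have path: "path_graph (gaifman (pat k l)) 0 l"
    unfolding path_graph_def by (intro exI[of _ ?p] conjI arcs)
  have root: "interp (pat k l) Root = {[0]}" by (auto simp: pat_def)
  have "finite_structure (pat k l)"
    using input_structure_pat[of k l] unfolding input_structure_def by (rule conjunct1)
  then show ?thesis
    unfolding rooted_path_structure_def
    by (intro conjI exI[of _ 0] exI[of _ l] path root) simp_all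
qed

lemma univ_pat: "univ (pat k l) = {..l}"
  by (simp add: pat_def lessThan_Suc_atMost)

lemma embedding_pat:
  "embedding h (pat k l) (mk_struct n R E) \<longleftrightarrow> (\<forall>i\<le>l. h i < n) \<and> inj_on h {..l} \<and> R (h 0) \<and>
     (\<forall>i<l. E (h i) (h (Suc i)) \<and> (i \<noteq> k \<longrightarrow> E (h (Suc i)) (h i)))"
  (is "?L \<longleftrightarrow> ?R")
proof
  assume L: ?L
  have "h ` univ (pat k l) \<subseteq> univ (mk_struct n R E)"
    using L unfolding embedding_def homomorphism_def by (elim conjE)
  moreover have "inj_on h (univ (pat k l))"
    using L unfolding embedding_def homomorphism_def by (elim conjE)
  ultimately have h: "\<And>i. i \<le> l \<Longrightarrow> h i < n" "inj_on h {..l}"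
    unfolding univ_pat by auto
  have "\<forall>v. \<forall>t \<in> interp (pat k l) v. map h t \<in> interp (mk_struct n R E) v"
    using L unfolding embedding_def homomorphism_def by (elim conjE)
  note hom = this[rule_format]
  have "R (h 0)" using hom[of "[0]" Root] by (auto simp: pat_def)
  moreover have "E (h i) (h (Suc i))" if "i < l" for i
    using hom[of "[i, Suc i]" Edge] that by (auto simp: pat_def)
  moreover have "E (h (Suc i)) (h i)" if "i < l" "i \<noteq> k" for i
    using hom[of "[Suc i, i]" Edge] that by (auto simp: pat_def)
  ultimately show ?R using h by blast
next
  assume R: ?R
  have hom: "map h t \<in> interp (mk_struct n R E) v" if t: "t \<in> interp (pat k l) v" for v t
  proof (cases v)
    case Root
    then have "t = [0]" using t by (auto simp: pat_def)
    then show ?thesis using R Root by simp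
  next
    case Edge
    then obtain i where i: "i < l" "t = [i, Suc i] \<or> t = [Suc i, i] \<and> i \<noteq> k"
      using t by (auto simp: pat_def)
    then have "h i < n" "h (Suc i) < n" "E (h i) (h (Suc i))" "i \<noteq> k \<Longrightarrow> E (h (Suc i)) (h i)"
      using R by auto
    then show ?thesis using i(2) Edge by auto
  qed
  have "h ` univ (pat k l) \<subseteq> univ (mk_struct n R E)"
    using R unfolding univ_pat by auto
  moreover have "inj_on h (univ (pat k l))"
    using R unfolding univ_pat by (elim conjE)
  ultimately show ?L
    unfolding embedding_def homomorphism_def using hom by blast
qed

text \<open>The new vertices are those from \<open>n\<close> on. There are \<open>l - k\<close> of
  them because a path of length \<open>k\<close> in the graph accounts for \<open>k + 1\<close> of
  the \<open>l + 1\<close> vertices of the pattern. The arc from \<open>t\<close> to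
  \<open>n\<close> has no reverse.\<close>

definition extension :: "nat \<Rightarrow> (nat \<Rightarrow> nat \<Rightarrow> bool) \<Rightarrow> nat \<Rightarrow> nat \<Rightarrow> nat \<Rightarrow> nat \<Rightarrow> nat struct" where
  "extension n E s t k l = mk_struct (n + (l - k)) (\<lambda>i. i = s)
     (\<lambda>i j. i < n \<and> j < n \<and> E i j \<or> i = t \<and> j = n \<or> n \<le> i \<and> n \<le> j \<and> (j = Suc i \<or> i = Suc j))"

lemma embedding_extension:
  assumes sym: "\<And>i j. i < n \<Longrightarrow> j < n \<Longrightarrow> E i j \<Longrightarrow> E j i" and s: "s < n" and t: "t < n" and kl: "k < l"
  shows "(\<exists>h. embedding h (pat k l) (extension n E s t k l)) \<longleftrightarrow> long_or_exact n E s t k l"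
proof
  assume "long_or_exact n E s t k l"
  then consider v h where "pth n E l s v h" | h where "pth n E k s t h"
    unfolding long_or_exact_def by blast
  then show "\<exists>h. embedding h (pat k l) (extension n E s t k l)"
  proof cases
    case 1
    then have "embedding h (pat k l) (extension n E s t k l)"
      unfolding extension_def embedding_pat pth_def using sym by (auto simp: Suc_le_eq intro: trans_less_add1)
    then show ?thesis by blast
  next
    case 2
    \<comment> \<open>Position \<open>Suc k\<close> goes to \<open>n\<close>, the entry of the
      attached path, and the remaining positions follow that path.\<close>
    define h' where "h' i = (if i \<le> k then h i else n + (i - Suc k))" for i
    have h: "\<And>i. i \<le> k \<Longrightarrow> h i < n" "inj_on h {..k}" "h 0 = s" "h k = t" "\<And>i. i < k \<Longrightarrow> E (h i) (h (Suc i))"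
      using 2 by (auto simp: pth_def)
    have "inj_on h' {..l}"
    proof (rule inj_onI)
      fix i j assume "i \<in> {..l}" "j \<in> {..l}" "h' i = h' j"
      then show "i = j"
        using h(1)[of i] h(1)[of j] inj_onD[OF h(2), of i j] by (auto simp: h'_def split: if_splits)
    qed
    moreover have "h' i < n + (l - k)" if "i \<le> l" for i
      using h(1)[of i] that kl by (auto simp: h'_def)
    moreover have "(h' i < n \<and> h' (Suc i) < n \<and> E (h' i) (h' (Suc i)) \<or> h' i = t \<and> h' (Suc i) = n \<or>
        n \<le> h' i \<and> n \<le> h' (Suc i) \<and> (h' (Suc i) = Suc (h' i) \<or> h' i = Suc (h' (Suc i))))" for i
      using h(1)[of i] h(1)[of "Suc i"] h(4) h(5)[of i] by (cases "i < k"; cases "i = k") (auto simp: h'_def)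
    moreover have "(h' (Suc i) < n \<and> h' i < n \<and> E (h' (Suc i)) (h' i) \<or> h' (Suc i) = t \<and> h' i = n \<or>
        n \<le> h' (Suc i) \<and> n \<le> h' i \<and> (h' i = Suc (h' (Suc i)) \<or> h' (Suc i) = Suc (h' i)))" if "i \<noteq> k" for i
      using h(1)[of i] h(1)[of "Suc i"] h(5)[of i] sym[of "h i" "h (Suc i)"] that
      by (cases "i < k") (auto simp: h'_def)
    moreover have "h' 0 = s" by (simp add: h'_def h(3))
    ultimately have "embedding h' (pat k l) (extension n E s t k l)"
      unfolding extension_def embedding_pat by blast
    then show ?thesis by blast
  qed
next
  assume "\<exists>h. embedding h (pat k l) (extension n E s t k l)"
  then obtain h where "embedding h (pat k l) (extension n E s t k l)" ..
  then have h: "inj_on h {..l}" "h 0 = s"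
    and e: "\<And>i. i < l \<Longrightarrow> h i < n \<and> h (Suc i) < n \<and> E (h i) (h (Suc i)) \<or> h i = t \<and> h (Suc i) = n \<or> n \<le> h i \<and> n \<le> h (Suc i)"
    and e': "\<And>i. i < l \<Longrightarrow> i \<noteq> k \<Longrightarrow> h i < n \<and> h (Suc i) < n \<or> h (Suc i) = t \<and> h i = n \<or> n \<le> h (Suc i) \<and> n \<le> h i"
    unfolding extension_def embedding_pat by blast+
  show "long_or_exact n E s t k l"
  proof (cases "\<forall>i\<le>l. h i < n")
    case True
    then have "pth n E l s (h l) h"
      unfolding pth_def using h e by (auto simp: Suc_le_eq) (metis Suc_leI less_imp_le not_less)+
    then show ?thesis unfolding long_or_exact_def by blast
  next
    case False
    \<comment> \<open>The first position outside the graph. It is not 0, because the root is sent to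
      \<open>s\<close>.\<close>
    define m where "m = (LEAST i. \<not> h i < n)"
    have m: "\<not> h m < n" "\<And>i. i < m \<Longrightarrow> h i < n" "m \<le> l"
    proof -
      from False obtain i where i: "i \<le> l" "\<not> h i < n" by blast
      show "\<not> h m < n" unfolding m_def by (rule LeastI[of _ i]) (rule i)
      show "\<And>i. i < m \<Longrightarrow> h i < n" unfolding m_def using not_less_Least by blast
      show "m \<le> l" unfolding m_def using Least_le[of "\<lambda>i. \<not> h i < n" i] i by simp
    qed
    have "m \<noteq> 0" using m(1) h(2) s by (cases m) auto
    then obtain j where j: "m = Suc j" using not0_implies_Suc by blast
    have hj: "h j < n" "j < l" using m(2)[of j] m(3) j by auto
    then have "h j = t" using e[of j] m(1) j by auto
    \<comment> \<open>The arc used on leaving has no reverse in the extension, whereas the pattern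
      has both directions between \<open>j\<close> and \<open>Suc j\<close> unless \<open>j\<close>
      is \<open>k\<close>.\<close>
    moreover have "j = k" using e'[of j] hj m(1) t j by (cases "j = k") auto
    ultimately have "h k = t" "\<And>i. i \<le> k \<Longrightarrow> h i < n" using m(2) j by auto
    then have "pth n E k s t h"
      unfolding pth_def using h e kl
      by (auto simp: inj_on_def) (metis Suc_leI less_imp_le less_trans not_less)
    then show ?thesis unfolding long_or_exact_def by blast
  qed
qed

text \<open>Symmetric and loop-free whatever \<open>E\<close> is, hence always a legitimate graph to
  be submitted to the oracle.\<close>

definition colour_core :: "(nat \<Rightarrow> nat \<Rightarrow> bool) \<Rightarrow> (nat \<Rightarrow> bool) \<Rightarrow> bool \<Rightarrow> nat \<Rightarrow> nat \<Rightarrow> bool" where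
  "colour_core E \<chi> c i j \<longleftrightarrow> i \<noteq> j \<and> E i j \<and> E j i \<and> \<chi> i = c \<and> \<chi> j = c"

lemma embedding_from_colouring:
  assumes kl: "k < l" and s: "R s" "\<not> \<chi> s" and v: "v < n" "\<not> \<chi> v" and w: "w < n" "\<chi> w" and vw: "E v w"
    and 1: "long_or_exact n (colour_core E \<chi> False) s v k l"
    and 2: "l = Suc k \<or> long_or_exact n (colour_core E \<chi> True) w s 0 (l - Suc k)"
  shows "\<exists>h. embedding h (pat k l) (mk_struct n R E)"
proof -
  consider u h where "pth n (colour_core E \<chi> False) l s u h" | h where "pth n (colour_core E \<chi> False) k s v h"
    using 1 unfolding long_or_exact_def by blast
  then show ?thesis
  proof cases
    case 1
    then show ?thesis
      unfolding embedding_pat pth_def colour_core_def using s(1) by (intro exI[of _ h]) auto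
  next
    case 2
    then have p: "\<And>i. i \<le> k \<Longrightarrow> h i < n" "inj_on h {..k}" "h 0 = s" "h k = v"
      "\<And>i. i < k \<Longrightarrow> colour_core E \<chi> False (h i) (h (Suc i))"
      by (auto simp: pth_def)
    \<comment> \<open>Colours are only guaranteed at the ends of arcs. The first vertex needs the
      separate premise on \<open>s\<close>, since the path may have no arcs.\<close>
    have pc: "\<not> \<chi> (h i)" if "i \<le> k" for i
      using that p(5)[of "i - 1"] p(3) s(2) by (cases i) (auto simp: colour_core_def)
    let ?m = "l - Suc k"
    obtain g u where g: "pth n (colour_core E \<chi> True) ?m w u g"
    proof (cases "l = Suc k")
      \<comment> \<open>The second half of the pattern is then the single vertex \<open>w\<close>,
        which needs no query.\<close>
      case True
      then show ?thesis using w by (intro that[of w "\<lambda>_. w"]) (simp add: pth_def)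
    next
      case False
      \<comment> \<open>The alternative of an exact path of length 0 from \<open>w\<close> to
        \<open>s\<close> is impossible as these vertices have different colours. So a positive
        answer means a path of length \<open>l - Suc k\<close>.\<close>
      then show ?thesis
        using assms(10) s(2) w(2) that unfolding long_or_exact_def by (auto simp: pth_def)
    qed
    then have q: "\<And>i. i \<le> ?m \<Longrightarrow> g i < n" "inj_on g {..?m}" "g 0 = w"
      "\<And>i. i < ?m \<Longrightarrow> colour_core E \<chi> True (g i) (g (Suc i))"
      by (auto simp: pth_def)
    have qc: "\<chi> (g i)" if "i \<le> ?m" for i
      using that q(4)[of "i - 1"] q(3) w(2) by (cases i) (auto simp: colour_core_def)
    define f where "f i = (if i \<le> k then h i else g (i - Suc k))" for i
    have "inj_on f {..l}"
    proof (rule inj_onI)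
      fix i j assume ij: "i \<in> {..l}" "j \<in> {..l}" "f i = f j"
      then have le: "i - Suc k \<le> ?m" "j - Suc k \<le> ?m" by auto
      have "i = j" if "k < i" "k < j"
        using inj_onD[OF q(2), of "i - Suc k" "j - Suc k"] le ij(3) that by (simp add: f_def)
      then show "i = j"
        using inj_onD[OF p(2), of i j] pc[of i] pc[of j] qc[OF le(1)] qc[OF le(2)] ij(3)
        by (cases "i \<le> k"; cases "j \<le> k") (auto simp: f_def)
    qed
    moreover have "f i < n" if "i \<le> l" for i
      using p(1)[of i] q(1)[of "i - Suc k"] that by (auto simp: f_def)
    moreover have "E (f i) (f (Suc i)) \<and> (i \<noteq> k \<longrightarrow> E (f (Suc i)) (f i))" if "i < l" for i
    proof -
      consider "i < k" | "i = k" | "k < i" by linarith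
      then show ?thesis
      proof cases
        case 1
        then show ?thesis using p(5)[of i] by (auto simp: f_def colour_core_def)
      next
        case 2
        then show ?thesis using vw p(4) q(3) by (simp add: f_def)
      next
        case 3
        then have "Suc (i - Suc k) = i - k" by simp
        then show ?thesis using 3 q(4)[of "i - Suc k"] that by (auto simp: f_def colour_core_def)
      qed
    qed
    moreover have "R (f 0)" using p(3) s(1) by (simp add: f_def)
    ultimately show ?thesis unfolding embedding_pat by blast
  qed
qed

lemma colouring_from_embedding:
  assumes h: "embedding h (pat k l) (mk_struct n R E)" and kl: "k < l"
    and \<chi>: "\<And>i. i \<le> k \<Longrightarrow> \<not> \<chi> (h i)" "\<And>i. k < i \<Longrightarrow> i \<le> l \<Longrightarrow> \<chi> (h i)"
  shows "long_or_exact n (colour_core E \<chi> False) (h 0) (h k) k l"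
    "l \<noteq> Suc k \<Longrightarrow> long_or_exact n (colour_core E \<chi> True) (h (Suc k)) (h 0) 0 (l - Suc k)"
proof -
  have e: "\<And>i. i \<le> l \<Longrightarrow> h i < n" "inj_on h {..l}" "\<And>i. i < l \<Longrightarrow> E (h i) (h (Suc i))"
    "\<And>i. i < l \<Longrightarrow> i \<noteq> k \<Longrightarrow> E (h (Suc i)) (h i)"
    using h unfolding embedding_pat by blast+
  have ne: "h i \<noteq> h (Suc i)" if "i < l" for i
    using inj_onD[OF e(2), of i "Suc i"] that by auto
  have "pth n (colour_core E \<chi> False) k (h 0) (h k) h"
    unfolding pth_def colour_core_def using e ne \<chi>(1) kl by (auto simp: inj_on_def)
  then show "long_or_exact n (colour_core E \<chi> False) (h 0) (h k) k l"
    unfolding long_or_exact_def by blast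
  have "inj_on (\<lambda>i. h (Suc (k + i))) {..l - Suc k}"
    using kl by (intro inj_onI) (auto dest!: inj_onD[OF e(2)])
  then have "pth n (colour_core E \<chi> True) (l - Suc k) (h (Suc k)) (h l) (\<lambda>i. h (Suc (k + i)))"
    unfolding pth_def colour_core_def using e ne \<chi>(2) kl by auto
  then show "long_or_exact n (colour_core E \<chi> True) (h (Suc k)) (h 0) 0 (l - Suc k)"
    unfolding long_or_exact_def by blast
qed

section \<open>Encodings\<close>

text \<open>The final \<open>Sep\<close> makes blocks self-delimiting. The tails \<open>u\<close>
  and \<open>u'\<close> are carried through this and the following lemmas so that concatenated
  encodings can be decoded from the left.\<close>

lemma block_append_inj: "block bs @ u = block bs' @ u' \<longleftrightarrow> bs = bs' \<and> u = u'"
proof (induction bs arbitrary: bs')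
  case Nil
  show ?case by (cases bs') (auto simp: block_def)
next
  case (Cons b bs)
  then show ?case by (cases bs') (auto simp: block_def split: if_splits)
qed

lemma concat_blocks_append_inj:
  "concat (map (\<lambda>i. block (f i)) [0..<n]) @ u = concat (map (\<lambda>i. block (g i)) [0..<n]) @ u' \<longleftrightarrow>
   (\<forall>i<n. f i = g i) \<and> u = u'"
proof (induction n arbitrary: u u')
  case (Suc n)
  show ?case
    using Suc[of "block (f n) @ u" "block (g n) @ u'"] by (simp add: block_append_inj less_Suc_eq) blast
qed simp

lemma enc_matrix_append_inj:
  "enc_matrix n X @ u = enc_matrix n X' @ u' \<longleftrightarrow>
   (\<forall>i<n. \<forall>j<n. (i, j) \<in> X \<longleftrightarrow> (i, j) \<in> X') \<and> u = u'"
  unfolding enc_matrix_def concat_blocks_append_inj by (auto simp: map_eq_conv)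

lemma enc_matrix_cong:
  "(\<And>i j. i < n \<Longrightarrow> j < n \<Longrightarrow> (i, j) \<in> X \<longleftrightarrow> (i, j) \<in> X') \<Longrightarrow> enc_matrix n X = enc_matrix n X'"
  using enc_matrix_append_inj[of n X "[]" X' "[]"] by auto

lemma length_block: "length (block bs) = Suc (length bs)"
  by (simp add: block_def)

lemma length_enc_matrix: "length (enc_matrix n X) = n * Suc n"
  by (simp add: enc_matrix_def length_concat o_def length_block sum_list_triv)

text \<open>The first row reveals the dimension through its length; this requires that there is a
  row.\<close>

lemma enc_matrix_size_inj:
  assumes "enc_matrix n X @ u = enc_matrix n' X' @ u'" "0 < n" "0 < n'"
  shows "n = n'"
proof -
  have first: "\<exists>r. enc_matrix n X = block (map (\<lambda>j. (0, j) \<in> X) [0..<n]) @ r"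
    if "0 < n" for n and X :: "(nat \<times> nat) set"
  proof -
    define f where "f = (\<lambda>i. block (map (\<lambda>j. (i, j) \<in> X) [0..<n]))"
    have "enc_matrix n X = concat (map f [0..<n])"
      by (simp only: enc_matrix_def f_def)
    also have "\<dots> = f 0 @ concat (map f [Suc 0..<n])"
      using that by (simp add: upt_conv_Cons)
    finally show ?thesis unfolding f_def by (rule exI)
  qed
  obtain r where r: "enc_matrix n X = block (map (\<lambda>j. (0, j) \<in> X) [0..<n]) @ r"
    using first[OF assms(2)] by blast
  obtain r' where r': "enc_matrix n' X' = block (map (\<lambda>j. (0, j) \<in> X') [0..<n']) @ r'"
    using first[OF assms(3)] by blast
  have "map (\<lambda>j. (0, j) \<in> X) [0..<n] = map (\<lambda>j. (0, j) \<in> X') [0..<n']"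
    using assms(1) unfolding r r' append.assoc block_append_inj by (rule conjunct1)
  from arg_cong[OF this, of length] show ?thesis by simp
qed

lemma mk_struct_cong:
  assumes "\<And>i. i < n \<Longrightarrow> R i = R' i" "\<And>i j. i < n \<Longrightarrow> j < n \<Longrightarrow> E i j = E' i j"
  shows "mk_struct n R E = mk_struct n R' E'"
proof -
  have "{[i] | i. i < n \<and> R i} = {[i] | i. i < n \<and> R' i}"
    "{[i, j] | i j. i < n \<and> j < n \<and> E i j} = {[i, j] | i j. i < n \<and> j < n \<and> E' i j}"
    using assms by blast+
  then show ?thesis unfolding mk_struct_def by (simp only:)
qed

lemma mk_graph_cong:
  assumes "\<And>i j. i < n \<Longrightarrow> j < n \<Longrightarrow> E i j = E' i j"
  shows "mk_graph n E = mk_graph n E'"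
proof -
  have "{(i, j). i < n \<and> j < n \<and> E i j} = {(i, j). i < n \<and> j < n \<and> E' i j}"
    using assms by blast
  then show ?thesis unfolding mk_graph_def by (simp only:)
qed

lemma enc_structure_mk_struct:
  "enc_structure (mk_struct n R E) = block (map R [0..<n]) @ enc_matrix n {(i, j). E i j}"
proof -
  have "enc_matrix n {(i, j). [i, j] \<in> interp (mk_struct n R E) Edge} = enc_matrix n {(i, j). E i j}"
    by (rule enc_matrix_cong) auto
  moreover have "map (\<lambda>i. [i] \<in> interp (mk_struct n R E) Root) [0..<n] = map R [0..<n]"
    by auto
  ultimately show ?thesis
    unfolding enc_structure_def Let_def by (simp only: mk_struct_simps(1) card_lessThan)
qed

lemma enc_structure_append_inj:
  assumes "input_structure A" "input_structure A'" "enc_structure A @ u = enc_structure A' @ u'"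
  shows "A = A' \<and> u = u'"
proof -
  obtain n R E where A: "A = mk_struct n R E"
    by (rule that[OF input_structure_eq_mk_struct[OF assms(1)]])
  obtain n' R' E' where A': "A' = mk_struct n' R' E'"
    by (rule that[OF input_structure_eq_mk_struct[OF assms(2)]])
  have 1: "map R [0..<n] = map R' [0..<n']"
    "enc_matrix n {(i, j). E i j} @ u = enc_matrix n' {(i, j). E' i j} @ u'"
    using assms(3) by (simp_all add: A A' enc_structure_mk_struct block_append_inj)
  have n: "n = n'" using arg_cong[OF 1(1), of length] by simp
  then show ?thesis
    using 1 unfolding A A' n enc_matrix_append_inj by (auto intro!: mk_struct_cong)
qed

lemma enc_emb_inj:
  assumes "input_structure A" "input_structure A'" "input_structure B" "input_structure B'"
    "enc_emb A B = enc_emb A' B'"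
  shows "A = A' \<and> B = B'"
proof -
  have 1: "A = A' \<and> [Sep] @ enc_structure B = [Sep] @ enc_structure B'"
    by (rule enc_structure_append_inj[OF assms(1,2)]) (rule assms(5)[unfolded enc_emb_def])
  then have "enc_structure B @ [] = enc_structure B' @ []"
    by simp
  then show ?thesis
    using 1 enc_structure_append_inj[OF assms(3,4)] by blast
qed

lemma p_emb_param:
  assumes "input_structure A" "input_structure B"
  shows "snd (p_emb \<A>) (enc_emb A B) = card (univ A)"
proof -
  have "(THE m. \<exists>A' B'. input_structure A' \<and> input_structure B' \<and> enc_emb A B = enc_emb A' B' \<and>
      m = card (univ A')) = card (univ A)"
    using assms enc_emb_inj by (intro the_equality) blast+
  moreover have "\<exists>A' B'. input_structure A' \<and> input_structure B' \<and> enc_emb A B = enc_emb A' B'"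
    using assms by blast
  ultimately show ?thesis
    unfolding p_emb_def snd_conv by (simp only: if_True)
qed

lemma p_emb_mem:
  assumes "input_structure A" "input_structure B"
  shows "enc_emb A B \<in> fst (p_emb \<A>) \<longleftrightarrow> A \<in> \<A> \<and> (\<exists>h. embedding h A B)"
  using assms enc_emb_inj unfolding p_emb_def fst_conv by blast

lemma enc_emb_not_Nil: "enc_emb A B \<noteq> []"
  by (simp add: enc_emb_def)

text \<open>The empty word is what the reductions submit for a guess that does not fit the input: it
  is a no-instance and its parameter respects every bound.\<close>

lemma p_emb_Nil: "[] \<notin> fst (p_emb \<A>)" "snd (p_emb \<A>) [] = 0"
  by (auto simp: p_emb_def enc_emb_not_Nil[symmetric])

section \<open>Canonical numerals and longshort instances\<close>

lemma digits_val_binary: "digits_val (binary n) = n"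
proof (induction n rule: less_induct)
  case (less n)
  show ?case
  proof (cases "n = 0")
    case False
    then have "digits_val (binary n) = of_bool (odd n) + 2 * digits_val (binary (n div 2))"
      by (subst binary.simps) simp
    then show ?thesis using less[of "n div 2"] False by (simp add: mod_2_eq_odd[symmetric] add.commute)
  qed (simp add: binary.simps)
qed

lemma binary_inj: "binary m = binary n \<longleftrightarrow> m = n"
  by (metis digits_val_binary)

lemma last_binary: "binary n = [] \<or> last (binary n)"
proof (induction n rule: less_induct)
  case (less n)
  then show ?case
  proof (cases "n = 0")
    case False
    then have "n = 1 \<or> n div 2 > 0" "n div 2 < n" by auto
    then have "binary (n div 2) \<noteq> [] \<or> n = 1"
      by (subst binary.simps) auto
    then show ?thesis using less[of "n div 2"] False \<open>n div 2 < n\<close>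
      by (subst (1 2) binary.simps) (auto simp: binary.simps[of 0])
  qed (simp add: binary.simps)
qed

text \<open>Numerals are characterized by their leading digit. This allows recognizing the encoding
  of a number without computing the number.\<close>

lemma binary_digits_val: "bs = [] \<or> last bs \<Longrightarrow> binary (digits_val bs) = bs"
proof (induction bs)
  case Nil
  show ?case by (simp add: binary.simps)
next
  case (Cons b bs)
  have "bs = [] \<or> last bs" using Cons.prems by (auto split: if_splits)
  then have IH: "binary (digits_val bs) = bs" by (rule Cons.IH)
  have "digits_val (b # bs) \<noteq> 0"
  proof (cases bs)
    case Nil
    then show ?thesis using Cons.prems by simp
  next
    case (Cons c cs)
    have "digits_val bs \<noteq> 0"
    proof
      assume "digits_val bs = 0"
      then have "bs = binary 0" using IH by (simp only:)
      then show False using Cons by (simp add: binary.simps)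
    qed
    then show ?thesis by simp
  qed
  then show ?case
    using IH by (subst binary.simps) auto
qed

lemma enc_longshort_mk_graph:
  "enc_longshort (mk_graph n E) s t k l = enc_matrix n {(i, j). E i j} @ [Sep] @
     block (binary s) @ block (binary t) @ block (binary k) @ block (binary l)"
proof -
  have "enc_matrix n (parcs (mk_graph n E)) = enc_matrix n {(i, j). E i j}"
    by (rule enc_matrix_cong) auto
  then show ?thesis by (simp add: enc_longshort_def)
qed

lemma longshort_instance_mk_graph:
  "longshort_instance (mk_graph n E) s t k l \<longleftrightarrow>
     (\<forall>i<n. \<forall>j<n. E i j \<longrightarrow> i \<noteq> j \<and> E j i) \<and> s < n \<and> t < n \<and> k < l"
  by (simp add: longshort_instance_def input_graph_mk_graph)

lemma longshort_instance_eq_mk_graph: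
  "longshort_instance G s t k l \<Longrightarrow> \<exists>n E. G = mk_graph n E"
  unfolding longshort_instance_def by (elim conjE) (intro exI, erule input_graph_eq_mk_graph)

lemma enc_longshort_inj:
  assumes "longshort_instance G s t k l" "longshort_instance G' s' t' k' l'"
    "enc_longshort G s t k l = enc_longshort G' s' t' k' l'"
  shows "G = G' \<and> s = s' \<and> t = t' \<and> k = k' \<and> l = l'"
proof -
  obtain n E where G: "G = mk_graph n E"
    using longshort_instance_eq_mk_graph[OF assms(1)] by blast
  obtain n' E' where G': "G' = mk_graph n' E'"
    using longshort_instance_eq_mk_graph[OF assms(2)] by blast
  have "0 < n" "0 < n'"
    using assms(1,2) by (auto simp: G G' longshort_instance_mk_graph)
  note eq = assms(3)[unfolded G G' enc_longshort_mk_graph]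
  have n: "n = n'" by (rule enc_matrix_size_inj[OF eq]) fact+
  have 1: "\<forall>i<n. \<forall>j<n. E i j = E' i j"
    "block (binary s) @ block (binary t) @ block (binary k) @ block (binary l) =
     block (binary s') @ block (binary t') @ block (binary k') @ block (binary l')"
    using eq unfolding n enc_matrix_append_inj by simp_all
  have "block (binary l) = block (binary l') \<longleftrightarrow> l = l'"
    using block_append_inj[of "binary l" "[]" "binary l'" "[]"] by (simp add: binary_inj)
  then have "s = s' \<and> t = t' \<and> k = k' \<and> l = l'"
    using 1(2) by (simp add: block_append_inj binary_inj)
  moreover have "G = G'"
    using 1(1) unfolding G G' n by (auto intro: mk_graph_cong)
  ultimately show ?thesis by blast
qed

lemma p_longshort_param:
  assumes "longshort_instance G s t k l"
  shows "snd p_longshort (enc_longshort G s t k l) = l"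
proof -
  have "(THE l'. \<exists>G' s' t' k'. longshort_instance G' s' t' k' l' \<and>
      enc_longshort G s t k l = enc_longshort G' s' t' k' l') = l"
  proof (rule the_equality)
    show "\<exists>G' s' t' k'. longshort_instance G' s' t' k' l \<and> enc_longshort G s t k l = enc_longshort G' s' t' k' l"
      using assms by blast
    show "l' = l" if "\<exists>G' s' t' k'. longshort_instance G' s' t' k' l' \<and>
      enc_longshort G s t k l = enc_longshort G' s' t' k' l'" for l'
      using that enc_longshort_inj[OF assms] by blast
  qed
  moreover have "\<exists>G' s' t' k' l'. longshort_instance G' s' t' k' l' \<and>
      enc_longshort G s t k l = enc_longshort G' s' t' k' l'"
    using assms by blast
  ultimately show ?thesis
    unfolding p_longshort_def snd_conv by (simp only: if_True)
qed

lemma p_longshort_mem: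
  assumes "longshort_instance (mk_graph n E) s t k l"
  shows "enc_longshort (mk_graph n E) s t k l \<in> fst p_longshort \<longleftrightarrow> long_or_exact n E s t k l"
  unfolding long_or_exact_iff[symmetric]
proof
  assume "enc_longshort (mk_graph n E) s t k l \<in> fst p_longshort"
  then obtain G' s' t' k' l' where *: "enc_longshort (mk_graph n E) s t k l = enc_longshort G' s' t' k' l'"
    "longshort_instance G' s' t' k' l'"
    "(\<exists>v p. pre_digraph.apath (with_proj G') s' p v \<and> length p \<ge> l') \<or>
     (\<exists>p. pre_digraph.apath (with_proj G') s' p t' \<and> length p = k')"
    unfolding p_longshort_def fst_conv by blast
  then show "(\<exists>v p. pre_digraph.apath (with_proj (mk_graph n E)) s p v \<and> l \<le> length p) \<or>
     (\<exists>p. pre_digraph.apath (with_proj (mk_graph n E)) s p t \<and> length p = k)"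
    using enc_longshort_inj[OF assms *(2,1)] by blast
next
  assume "(\<exists>v p. pre_digraph.apath (with_proj (mk_graph n E)) s p v \<and> l \<le> length p) \<or>
     (\<exists>p. pre_digraph.apath (with_proj (mk_graph n E)) s p t \<and> length p = k)"
  then show "enc_longshort (mk_graph n E) s t k l \<in> fst p_longshort"
    using assms unfolding p_longshort_def fst_conv by blast
qed

lemma p_longshort_Nil: "[] \<notin> fst p_longshort" "snd p_longshort [] = 0"
  by (auto simp: p_longshort_def enc_longshort_def)

section \<open>A small family of colourings\<close>

text \<open>Parallel bit extraction: the bits of \<open>v\<close> at the positions selected by the
  mask \<open>M\<close> are packed together, the lowest position becoming the most significant
  one.\<close>

definition compress_upto :: "nat \<Rightarrow> nat \<Rightarrow> nat \<Rightarrow> nat" where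
  "compress_upto M v = rec_nat 0 (\<lambda>t r. if odd (M div 2 ^ t) then 2 * r + (v div 2 ^ t) mod 2 else r)"

definition compress :: "nat \<Rightarrow> nat \<Rightarrow> nat" where
  "compress M v = compress_upto M v (bit_length M)"

definition colour :: "nat \<Rightarrow> nat \<Rightarrow> nat \<Rightarrow> bool" where
  "colour M T v = odd (T div 2 ^ compress M v)"

lemma compress_upto_Suc:
  "compress_upto M v (Suc j) = (if odd (M div 2 ^ j) then 2 * compress_upto M v j + (v div 2 ^ j) mod 2
     else compress_upto M v j)"
  by (simp add: compress_upto_def)

lemma compress_upto_less: "compress_upto M v j < 2 ^ card {t. t < j \<and> odd (M div 2 ^ t)}"
proof (induction j)
  case 0
  show ?case by (simp add: compress_upto_def)
next
  case (Suc j)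
  have "{t. t < Suc j \<and> odd (M div 2 ^ t)} =
      (if odd (M div 2 ^ j) then insert j {t. t < j \<and> odd (M div 2 ^ t)} else {t. t < j \<and> odd (M div 2 ^ t)})"
    by (auto simp: less_Suc_eq)
  moreover have "(v div 2 ^ j) mod 2 < 2" by simp
  ultimately show ?case
    using Suc by (auto simp: compress_upto_Suc simp del: mod_less_divisor)
qed

lemma compress_upto_inj:
  assumes "compress_upto M v j = compress_upto M u j" "t < j" "odd (M div 2 ^ t)"
  shows "odd (v div 2 ^ t) = odd (u div 2 ^ t)"
  using assms
proof (induction j)
  case (Suc j)
  show ?case
  proof (cases "odd (M div 2 ^ j)")
    case True
    have "(v div 2 ^ j) mod 2 < 2" "(u div 2 ^ j) mod 2 < 2" by simp_all
    moreover have "2 * compress_upto M v j + (v div 2 ^ j) mod 2 = 2 * compress_upto M u j + (u div 2 ^ j) mod 2"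
      using Suc.prems(1) True by (simp add: compress_upto_Suc)
    moreover have "a = c \<and> b = d" if "b < 2" "d < 2" "2 * a + b = 2 * c + d" for a b c d :: nat
      using that by presburger
    ultimately have "compress_upto M v j = compress_upto M u j \<and> (v div 2 ^ j) mod 2 = (u div 2 ^ j) mod 2"
      by blast
    then show ?thesis
      using Suc by (cases "t = j") (auto simp: odd_iff_mod_2_eq_one)
  next
    case False
    then show ?thesis
      using Suc by (cases "t = j") (auto simp: compress_upto_Suc)
  qed
qed simp

lemma bits_eqI:
  assumes "u < 2 ^ B" "v < 2 ^ B" "\<And>t. t < B \<Longrightarrow> odd (u div 2 ^ t) = odd (v div 2 ^ t)"
  shows "u = (v :: nat)"
proof (rule bit_eqI)
  fix t
  show "bit u t = bit v t"
  proof (cases "t < B")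
    case True
    then show ?thesis using assms(3) by (simp add: bit_iff_odd)
  next
    case False
    then have "(2::nat) ^ B \<le> 2 ^ t" by (intro power_increasing) auto
    then have "u < 2 ^ t" "v < 2 ^ t" using assms(1,2) by linarith+
    then show ?thesis by (simp add: bit_iff_odd)
  qed
qed

text \<open>A weak form of Bondy's theorem. Each new element costs at most one position: as
  \<open>J\<close> already separates \<open>S\<close>, at most one member \<open>s\<close> of
  \<open>S\<close> agrees with \<open>a\<close> on \<open>J\<close>, and one further bit tells these
  two apart.\<close>

lemma distinguishing_positions:
  fixes S :: "nat set"
  assumes "finite S" "S \<subseteq> {..<2 ^ B}"
  shows "\<exists>J \<subseteq> {..<B}. card J \<le> card S \<and>
    (\<forall>u \<in> S. \<forall>v \<in> S. u \<noteq> v \<longrightarrow> (\<exists>t \<in> J. odd (u div 2 ^ t) \<noteq> odd (v div 2 ^ t)))"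
  using assms
proof (induction S)
  case empty
  then show ?case by (intro exI[of _ "{}"]) simp
next
  case (insert a S)
  then obtain J where J: "J \<subseteq> {..<B}" "card J \<le> card S"
    "\<And>u v. u \<in> S \<Longrightarrow> v \<in> S \<Longrightarrow> u \<noteq> v \<Longrightarrow> \<exists>t \<in> J. odd (u div 2 ^ t) \<noteq> odd (v div 2 ^ t)"
    by auto
  have fin: "finite J" using J(1) finite_subset by blast
  show ?case
  proof (cases "\<exists>s \<in> S. \<forall>t \<in> J. odd (a div 2 ^ t) = odd (s div 2 ^ t)")
    case False
    then have "\<exists>t \<in> J. odd (u div 2 ^ t) \<noteq> odd (v div 2 ^ t)"
      if "u \<in> insert a S" "v \<in> insert a S" "u \<noteq> v" for u v
      using J(3)[of u v] that by (metis insertE)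
    then show ?thesis
      using J insert.hyps by (intro exI[of _ J]) auto
  next
    case True
    then obtain s where s: "s \<in> S" "\<And>t. t \<in> J \<Longrightarrow> odd (a div 2 ^ t) = odd (s div 2 ^ t)" by blast
    have "a \<noteq> s" "a < 2 ^ B" "s < 2 ^ B" using s(1) insert by auto
    then obtain t0 where t0: "t0 < B" "odd (a div 2 ^ t0) \<noteq> odd (s div 2 ^ t0)"
      using bits_eqI by blast
    \<comment> \<open>An element other than \<open>s\<close> is separated from \<open>s\<close> by
      \<open>J\<close>, hence also from \<open>a\<close>, which looks like \<open>s\<close> on
      \<open>J\<close>.\<close>
    have a: "\<exists>t \<in> insert t0 J. odd (a div 2 ^ t) \<noteq> odd (v div 2 ^ t)" if "v \<in> S" for v
      using J(3)[OF s(1) that] s(2) t0(2) by (cases "v = s") auto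
    have "\<exists>t \<in> insert t0 J. odd (u div 2 ^ t) \<noteq> odd (v div 2 ^ t)"
      if "u \<in> insert a S" "v \<in> insert a S" "u \<noteq> v" for u v
      using J(3)[of u v] a[of u] a[of v] that by auto
    moreover have "card (insert t0 J) \<le> card (insert a S)"
      using J(2) insert.hyps card_insert_le_m1[of "Suc (card S)" J t0] by simp
    ultimately show ?thesis
      using J(1) t0(1) by (intro exI[of _ "insert t0 J"]) auto
  qed
qed

lemma odd_digits_val: "odd (digits_val bs div 2 ^ t) \<longleftrightarrow> t < length bs \<and> bs ! t"
proof (induction bs arbitrary: t)
  case (Cons b bs)
  show ?case
  proof (cases t)
    case (Suc t')
    have "(of_bool b + 2 * digits_val bs) div 2 ^ Suc t' = digits_val bs div 2 ^ t'"
      by (simp add: div_mult2_eq)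
    then show ?thesis using Cons[of t'] Suc by simp
  qed simp
qed simp

lemma digits_val_less: "digits_val bs < 2 ^ length bs"
  by (induction bs) (auto simp: of_bool_def)

text \<open>The mask of a distinguishing set makes \<open>compress M\<close> injective on the given
  vertices with values below \<open>2 ^ K\<close>, so every partition of them is described by a
  table of \<open>2 ^ K\<close> bits. Only the table depends exponentially on \<open>K\<close>; the
  mask has as many bits as a vertex.\<close>

lemma colouring_family:
  assumes fin: "finite X" "finite Y" and disj: "X \<inter> Y = {}" and sub: "X \<union> Y \<subseteq> {..<n}"
    and K: "card (X \<union> Y) \<le> K"
  shows "\<exists>M T. M < 2 ^ bit_length n \<and> T < 2 ^ 2 ^ K \<and> (\<forall>v \<in> X. \<not> colour M T v) \<and> (\<forall>v \<in> Y. colour M T v)"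
proof -
  let ?B = "bit_length n"
  have n: "n < 2 ^ ?B" using bit_length_le_iff by blast
  have "X \<union> Y \<subseteq> {..<2 ^ ?B}" using sub n by fastforce
  then have "\<exists>J \<subseteq> {..<?B}. card J \<le> card (X \<union> Y) \<and> (\<forall>u \<in> X \<union> Y. \<forall>v \<in> X \<union> Y. u \<noteq> v \<longrightarrow>
      (\<exists>t \<in> J. odd (u div 2 ^ t) \<noteq> odd (v div 2 ^ t)))"
    by (rule distinguishing_positions[rotated]) (use fin in simp)
  then obtain J where J': "J \<subseteq> {..<?B}" "card J \<le> card (X \<union> Y)"
    and J3: "\<forall>u \<in> X \<union> Y. \<forall>v \<in> X \<union> Y. u \<noteq> v \<longrightarrow> (\<exists>t \<in> J. odd (u div 2 ^ t) \<noteq> odd (v div 2 ^ t))"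
    by (elim exE conjE)
  note J = J'(1) order_trans[OF J'(2) K] J3[rule_format]
  define M where "M = digits_val (map (\<lambda>t. t \<in> J) [0..<?B])"
  have M: "odd (M div 2 ^ t) \<longleftrightarrow> t \<in> J" for t
    unfolding M_def odd_digits_val using J(1) by auto
  have "M < 2 ^ ?B" unfolding M_def using digits_val_less[of "map (\<lambda>t. t \<in> J) [0..<?B]"] by simp
  have small: "compress M v < 2 ^ K" for v
  proof -
    have "card {t. t < bit_length M \<and> odd (M div 2 ^ t)} \<le> card J"
      using J(1) by (intro card_mono) (auto simp: M intro: finite_subset)
    then have "(2::nat) ^ card {t. t < bit_length M \<and> odd (M div 2 ^ t)} \<le> 2 ^ K"
      using J(2) by (intro power_increasing) auto
    with compress_upto_less[of M v "bit_length M"] show ?thesis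
      unfolding compress_def by (rule less_le_trans)
  qed
  have inj: "u = v" if uv: "u \<in> X \<union> Y" "v \<in> X \<union> Y" "compress M u = compress M v" for u v
  proof (rule ccontr)
    assume "u \<noteq> v"
    then obtain t where t: "t \<in> J" "odd (u div 2 ^ t) \<noteq> odd (v div 2 ^ t)" using J(3)[OF uv(1,2)] by blast
    then have "odd (M div 2 ^ t)" by (simp add: M)
    moreover from this have "t < bit_length M" unfolding less_bit_length_iff by (metis even_zero)
    ultimately show False
      using compress_upto_inj[of M u "bit_length M" v t] uv(3) t(2) unfolding compress_def by blast
  qed
  \<comment> \<open>The table marks the codes of the vertices in \<open>Y\<close>. Injectivity
    ensures that no vertex of \<open>X\<close> shares such a code.\<close>
  define T where "T = digits_val (map (\<lambda>c. c \<in> compress M ` Y) [0..<2 ^ K])"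
  have "T < 2 ^ 2 ^ K" unfolding T_def using digits_val_less[of "map (\<lambda>c. c \<in> compress M ` Y) [0..<2 ^ K]"] by simp
  moreover have "colour M T v \<longleftrightarrow> compress M v \<in> compress M ` Y" for v
    unfolding colour_def T_def odd_digits_val using small[of v] by simp
  moreover have "compress M v \<in> compress M ` Y \<longleftrightarrow> v \<in> Y" if "v \<in> X \<union> Y" for v
    using inj[OF that] by auto
  ultimately have "\<forall>v \<in> X. \<not> colour M T v" "\<forall>v \<in> Y. colour M T v" "T < 2 ^ 2 ^ K"
    using disj by auto
  then show ?thesis using \<open>M < 2 ^ ?B\<close> by blast
qed

text \<open>There are thus only linearly many masks, so a mask can be guessed like a vertex.\<close>

lemma power_bit_length_le: "2 ^ bit_length n \<le> 2 * n + 1"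
proof (cases "n = 0")
  case False
  then have "0 < bit_length n" by (simp add: less_bit_length_iff)
  then obtain b where b: "bit_length n = Suc b" using gr0_implies_Suc by blast
  then have "n div 2 ^ b \<noteq> 0" using less_bit_length_iff[of b n] by simp
  then have "2 ^ b \<le> n" by (simp add: div_eq_0_iff not_less)
  then show ?thesis by (simp add: b)
qed simp

lemma lsf_compress:
  assumes M: "lsf vs M" and v: "lsf vs v"
  shows "lsf vs (\<lambda>x a. compress (M x a) (v x a))"
  unfolding compress_def compress_upto_def
proof (rule lsf_rec[OF lsf_zero lsf_bit_length[OF M]])
  show "lsf (ext (ext vs)) (\<lambda>x q. if odd (M x (snd (snd q)) div 2 ^ fst q)
      then 2 * fst (snd q) + v x (snd (snd q)) div 2 ^ fst q mod 2 else fst (snd q))"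
    by (intro lsf_if lsp_odd lsf_shift lsf_add lsf_mult lsf_mod lsf_const lsf_weaken[OF lsf_weaken[OF M]]
        lsf_weaken[OF lsf_weaken[OF v]] lsf_ext_first lsf_weaken[OF lsf_ext_first])
  \<comment> \<open>Extracted values have at most as many bits as the mask, and hence are at most
    \<open>2 * M + 1\<close> by \<open>power_bit_length_le\<close>.\<close>
  show "polyb vs (\<lambda>x a. 2 * M x a + 1)"
    by (intro polyb_add polyb_mult polyb_const lsf_polyb[OF M])
  fix x a i assume "i \<le> bit_length (M x a)"
  moreover have "{t. t < i \<and> odd (M x a div 2 ^ t)} \<subseteq> {..<i}" by auto
  ultimately have "card {t. t < i \<and> odd (M x a div 2 ^ t)} \<le> bit_length (M x a)"
    using card_mono[of "{..<i}" "{t. t < i \<and> odd (M x a div 2 ^ t)}"] by simp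
  then have "(2::nat) ^ card {t. t < i \<and> odd (M x a div 2 ^ t)} \<le> 2 ^ bit_length (M x a)"
    by (intro power_increasing) auto
  then show "rec_nat 0 (\<lambda>t r. if odd (M x a div 2 ^ t) then 2 * r + v x a div 2 ^ t mod 2 else r) i \<le> 2 * M x a + 1"
    using compress_upto_less[of "M x a" "v x a" i] power_bit_length_le[of "M x a"]
    unfolding compress_upto_def by linarith
qed

lemma lsp_colour: "lsf vs M \<Longrightarrow> lsf vs T \<Longrightarrow> lsf vs v \<Longrightarrow> lsp vs (\<lambda>x a. colour (M x a) (T x a) (v x a))"
  unfolding colour_def by (intro lsp_odd lsf_shift lsf_compress)

section \<open>Reading instances off the input word\<close>

text \<open>Positional notation in base \<open>b\<close>. The digits carry the guesses that are
  polynomial in the input; what remains above them is unbounded and carries the colour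
  table.\<close>

lemma tuple_code:
  fixes b T :: nat
  assumes "\<forall>d \<in> set ds. d < b"
  shows "\<exists>i. i div b ^ length ds = T \<and> (\<forall>j < length ds. i div b ^ j mod b = ds ! j)"
  using assms
proof (induction ds)
  case Nil
  show ?case by (intro exI[of _ T]) simp
next
  case (Cons d ds)
  then obtain i where i: "i div b ^ length ds = T" "\<And>j. j < length ds \<Longrightarrow> i div b ^ j mod b = ds ! j"
    by auto
  have d: "d < b" using Cons.prems by simp
  have div: "(d + b * i) div b = i" using d by simp
  have s: "(d + b * i) div b ^ Suc j = i div b ^ j" for j
    by (simp add: div_mult2_eq div)
  have dig: "(d + b * i) div b ^ j mod b = (d # ds) ! j" if "j < length (d # ds)" for j
  proof (cases j)
    case 0
    then show ?thesis using d by simp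
  next
    case (Suc j')
    then show ?thesis using i(2)[of j'] that by (simp only: s) simp
  qed
  have "(d + b * i) div b ^ length (d # ds) = T"
    using i(1) s[of "length ds"] by (simp only: list.size add_Suc_right add_0_right)
  then show ?case using dig by blast
qed

lemma sym_code_append: "sym_code (u @ v) (length u + i) = sym_code v i"
  by (simp add: sym_code_def nth_append)

lemma sym_code_block: "i < length bs \<Longrightarrow> sym_code (block bs @ u) i = of_bool (bs ! i)"
  by (simp add: sym_code_def block_def nth_append)

lemma sym_code_matrix:
  assumes "i < n" "j < n"
  shows "sym_code (enc_matrix n X @ u) (i * Suc n + j) = of_bool ((i, j) \<in> X)"
proof -
  have "block (map (\<lambda>j. (i, j) \<in> X) [0..<n]) =
      map (\<lambda>j. if j < n then if (i, j) \<in> X then One else Zero else Sep) [0..<Suc n]" for i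
    by (rule nth_equalityI) (auto simp: block_def nth_append less_Suc_eq simp del: upt_Suc)
  then have m: "enc_matrix n X = map (\<lambda>p. if p mod Suc n < n then if (p div Suc n, p mod Suc n) \<in> X then One
      else Zero else Sep) [0..<n * Suc n]"
    unfolding enc_matrix_def by (simp only: concat_map_uniform)
  have "i * Suc n + j < Suc i * Suc n" using assms by simp
  also have "\<dots> \<le> n * Suc n" using assms by (intro mult_le_mono1) simp
  finally have lt: "i * Suc n + j < n * Suc n" .
  have "(i * Suc n + j) div Suc n = i" "(i * Suc n + j) mod Suc n = j"
    using assms(2) by (simp_all only: div_mult_self3 mod_mult_self3) simp_all
  then show ?thesis
    using lt assms(2) unfolding sym_code_def m by (simp add: nth_append del: mult_Suc_right mult_Suc)
qed

text \<open>A row occupies \<open>Suc n\<close> symbols because of its separator. If the input is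
  not an encoding with the guessed \<open>n\<close>, the values are meaningless, which the
  comparison of the input with the new encoding detects.\<close>

definition bit_at :: "sym list \<Rightarrow> nat \<Rightarrow> nat \<Rightarrow> nat \<Rightarrow> nat \<Rightarrow> bool" where
  "bit_at x p n i j \<longleftrightarrow> sym_code x (p + (i * Suc n + j)) = 1"

lemma lsp_bit_at:
  "lsf vs p \<Longrightarrow> lsf vs n \<Longrightarrow> lsf vs i \<Longrightarrow> lsf vs j \<Longrightarrow> lsp vs (\<lambda>x a. bit_at x (p x a) (n x a) (i x a) (j x a))"
  unfolding bit_at_def by (intro lsp_eq lsf_sym lsf_add lsf_mult lsf_Suc lsf_const)

lemma lsf_power_const: "lsf vs F \<Longrightarrow> lsf vs (\<lambda>x a. F x a ^ m)"
  by (induction m) (auto intro: lsf_const lsf_mult)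

subsection \<open>From long or exact paths to embeddings\<close>

text \<open>The encoding in front of \<open>l\<close>. The adjacency matrix is read back from the
  input, so that only four numbers have to be guessed for this part.\<close>

definition ls_prefix :: "sym list \<Rightarrow> nat \<Rightarrow> nat \<Rightarrow> nat \<Rightarrow> nat \<Rightarrow> sym list" where
  "ls_prefix x n s t k = enc_matrix n {(i, j). bit_at x 0 n i j} @ [Sep] @
     block (binary s) @ block (binary t) @ block (binary k)"

text \<open>Describes a block with a canonical numeral by its symbols: bits, the most significant of
  them set, then the separator. The last conjunct is void for the number 0, whose numeral is
  empty.\<close>

definition ends_in_number :: "sym list \<Rightarrow> nat \<Rightarrow> bool" where
  "ends_in_number x p \<longleftrightarrow> p < length x \<and> sym_code x (length x - 1) = 2 \<and>
     (\<forall>j < length x - 1. p \<le> j \<longrightarrow> sym_code x j < 2) \<and> (p < length x - 1 \<longrightarrow> sym_code x (length x - 2) = 1)"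

lemma ends_in_number_iff:
  assumes "take (length u) x = u"
  shows "ends_in_number x (length u) \<longleftrightarrow> (\<exists>l. x = u @ block (binary l))"
proof -
  obtain v where x: "x = u @ v" using assms by (metis append_take_drop_id)
  have "ends_in_number x (length u) \<longleftrightarrow> (\<exists>l. v = block (binary l))"
  proof (cases v rule: rev_cases)
    case Nil
    then show ?thesis by (simp add: x ends_in_number_def block_def)
  next
    case (snoc w s)
    have len: "length x - 1 = length u + length w" "length x = Suc (length u + length w)"
      by (simp_all add: x snoc)
    have c: "sym_code x (length u + j) = sym_code v j" for j unfolding x by (rule sym_code_append)
    have all: "(\<forall>j < length x - 1. length u \<le> j \<longrightarrow> sym_code x j < 2) \<longleftrightarrow> (\<forall>j < length w. sym_code v j < 2)"
    proof (intro iffI allI impI)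
      fix j assume "\<forall>j < length x - 1. length u \<le> j \<longrightarrow> sym_code x j < 2" "j < length w"
      then show "sym_code v j < 2" using c[of j] len(1) by (metis le_add1 nat_add_left_cancel_less)
    next
      fix j assume *: "\<forall>j < length w. sym_code v j < 2" "j < length x - 1" "length u \<le> j"
      then obtain j' where "j = length u + j'" using le_Suc_ex by blast
      then show "sym_code x j < 2" using * c[of j'] len(1) by simp
    qed
    have w: "sym_code v j = sym_code w j" if "j < length w" for j
      using that by (simp add: snoc sym_code_def nth_append)
    have s: "sym_code x (length x - 1) = 2 \<longleftrightarrow> s = Sep"
    proof -
      have "sym_code v (length w) = (case s of Zero \<Rightarrow> 0 | One \<Rightarrow> 1 | Sep \<Rightarrow> 2)"
        by (simp add: snoc sym_code_def nth_append)
      then show ?thesis unfolding len(1) c by (cases s) auto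
    qed
    have l: "(length u < length x - 1 \<longrightarrow> sym_code x (length x - 2) = 1) \<longleftrightarrow> (w \<noteq> [] \<longrightarrow> last w = One)"
    proof (cases w rule: rev_cases)
      case (snoc w' s')
      then have "length x - 2 = length u + length w'" using len by simp
      then show ?thesis
        using snoc len(1) c[of "length w'"] w[of "length w'"]
        by (cases s') (auto simp: sym_code_def nth_append)
    qed (simp add: len)
    have "sym_code w j < 2 \<longleftrightarrow> w ! j \<noteq> Sep" if "j < length w" for j
      using that by (cases "w ! j") (auto simp: sym_code_def)
    then have wb: "(\<forall>j < length w. sym_code w j < 2) \<longleftrightarrow> Sep \<notin> set w"
      by (auto simp: in_set_conv_nth)
    have bits: "map (\<lambda>b. if b then One else Zero) (map (\<lambda>s. s = One) w) = w" if "Sep \<notin> set w"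
    proof -
      have "(if y = One then One else Zero) = y" if "y \<in> set w" for y
      proof -
        have "y \<noteq> Sep" using that \<open>Sep \<notin> set w\<close> by blast
        then show ?thesis by (cases y) auto
      qed
      then show ?thesis unfolding map_map o_def by (rule map_idI)
    qed
    have "ends_in_number x (length u) \<longleftrightarrow> s = Sep \<and> Sep \<notin> set w \<and> (w \<noteq> [] \<longrightarrow> last w = One)"
      unfolding ends_in_number_def s l all using w wb[symmetric] len(2) by auto
    also have "\<dots> \<longleftrightarrow> (\<exists>l. v = block (binary l))"
    proof
      assume *: "s = Sep \<and> Sep \<notin> set w \<and> (w \<noteq> [] \<longrightarrow> last w = One)"
      let ?bs = "map (\<lambda>s. s = One) w"
      have "?bs = [] \<or> last ?bs" using * by (cases "w = []") (simp_all add: last_map)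
      then have "binary (digits_val ?bs) = ?bs" by (rule binary_digits_val)
      then have "v = block (binary (digits_val ?bs))"
        using * bits by (simp add: snoc block_def del: map_map)
      then show "\<exists>l. v = block (binary l)" by blast
    next
      assume "\<exists>l. v = block (binary l)"
      then obtain l where "v = block (binary l)" by blast
      then have "s = Sep" "w = map (\<lambda>b. if b then One else Zero) (binary l)"
        by (simp_all add: snoc block_def)
      then show "s = Sep \<and> Sep \<notin> set w \<and> (w \<noteq> [] \<longrightarrow> last w = One)"
        using last_binary[of l] by (auto simp: last_map)
    qed
    finally show ?thesis .
  qed
  then show ?thesis by (simp add: x)
qed

text \<open>The number \<open>l\<close> may be exponential in the length of the input. It is therefore cut off at
  a value that exceeds the number of vertices.\<close>

definition ls_match :: "sym list \<Rightarrow> nat \<Rightarrow> nat \<Rightarrow> nat \<Rightarrow> nat \<Rightarrow> nat \<Rightarrow> bool" where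
  "ls_match x n s t k l \<longleftrightarrow> take (length (ls_prefix x n s t k)) x = ls_prefix x n s t k \<and>
     (l < Suc (length x) \<and> x = ls_prefix x n s t k @ block (binary l) \<or>
      l = Suc (length x) \<and> ends_in_number x (length (ls_prefix x n s t k)) \<and>
      \<not> (\<exists>l' < Suc (length x). x = ls_prefix x n s t k @ block (binary l')))"

lemma ls_match_iff:
  "ls_match x n s t k l \<longleftrightarrow>
     (\<exists>l'. x = ls_prefix x n s t k @ block (binary l') \<and> l = min l' (Suc (length x)))"
  (is "?L \<longleftrightarrow> ?R")
proof -
  let ?u = "ls_prefix x n s t k"
  have inj: "l1 = l2" if "x = ?u @ block (binary l1)" "x = ?u @ block (binary l2)" for l1 l2
  proof -
    have "block (binary l1) @ [] = block (binary l2) @ []"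
      using that by (metis same_append_eq append_Nil2)
    then show ?thesis unfolding block_append_inj binary_inj by simp
  qed
  have pre: "take (length ?u) x = ?u" if "x = ?u @ v" for v
    using that by (metis append_eq_conv_conj)
  show ?thesis
  proof
    assume L: ?L
    then have p: "take (length ?u) x = ?u" unfolding ls_match_def by (rule conjunct1)
    from L consider "l < Suc (length x)" "x = ?u @ block (binary l)"
      | l' where "l = Suc (length x)" "x = ?u @ block (binary l')"
        "\<not> (\<exists>l' < Suc (length x). x = ?u @ block (binary l'))"
      unfolding ls_match_def ends_in_number_iff[OF p] by blast
    then show ?R
    proof cases
      case 1
      then show ?thesis by (intro exI[of _ l]) simp
    next
      case 2
      then have "\<not> l' < Suc (length x)" by blast
      then show ?thesis using 2 by (intro exI[of _ l']) simp
    qed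
  next
    assume ?R
    then obtain l' where l': "x = ?u @ block (binary l')" "l = min l' (Suc (length x))" by blast
    note p = pre[OF l'(1)]
    show ?L
    proof (cases "l' < Suc (length x)")
      case True
      then show ?thesis unfolding ls_match_def using p l' by simp
    next
      case False
      then have "l = Suc (length x)" using l'(2) by simp
      moreover have "\<not> (\<exists>l'' < Suc (length x). x = ?u @ block (binary l''))"
        using inj[OF l'(1)] False by blast
      ultimately show ?thesis
        unfolding ls_match_def ends_in_number_iff[OF p] using p l'(1) by blast
    qed
  qed
qed

definition ls_query :: "sym list \<Rightarrow> nat \<Rightarrow> nat \<Rightarrow> nat \<Rightarrow> nat \<Rightarrow> nat \<Rightarrow> sym list" where
  "ls_query x n s t k l = (if s < n \<and> t < n \<and> k < l \<and>
       (\<forall>i<n. \<forall>j<n. bit_at x 0 n i j \<longrightarrow> i \<noteq> j \<and> bit_at x 0 n j i) \<and> ls_match x n s t k l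
     then enc_emb (pat k l) (extension n (bit_at x 0 n) s t k l) else [])"

lemma lsw_ls_query:
  assumes N: "lsf vs n" and S: "lsf vs s" and T: "lsf vs t" and K: "lsf vs k" and L: "lsf vs l"
  shows "lsw vs (\<lambda>x a. ls_query x (n x a) (s x a) (t x a) (k x a) (l x a))"
proof -
  note w0 = N S T K L
  note w1 = w0[THEN lsf_weaken]
  note w2 = w1[THEN lsf_weaken]
  note e = lsf_ext_first lsf_weaken[OF lsf_ext_first]
  note leaves = w0 w1 w2 e lsf_const lsf_length
  have pre: "lsw vs (\<lambda>x a. ls_prefix x (n x a) (s x a) (t x a) (k x a))"
    unfolding ls_prefix_def
    by (intro lsw_append lsw_matrix lsw_single lsw_binary lsp_bit_at leaves)
  note pre1 = lsw_weaken[OF pre]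
  have match: "lsp vs (\<lambda>x a. ls_match x (n x a) (s x a) (t x a) (k x a) (l x a))"
    unfolding ls_match_def ends_in_number_def
    by (intro lsp_conj lsp_disj lsp_not lsp_imp lsp_ex lsp_all lsp_prefix lsp_word_eq lsp_eq lsp_le lsp_less
        lsw_append lsw_binary lsf_sym lsf_diff lsf_Suc lsw_length pre pre1 leaves
        lsf_weaken[OF lsw_length[OF pre]])
  show ?thesis
    unfolding ls_query_def enc_emb_def pat_def extension_def enc_structure_mk_struct
    by (intro lsw_if lsw_append lsw_block lsw_matrix lsw_single lsw_nil lsp_conj lsp_disj lsp_not lsp_imp lsp_all
        lsp_eq lsp_le lsp_less lsf_add lsf_diff lsf_Suc lsp_bit_at match leaves)
qed

definition pattern_class :: "nat struct set" where
  "pattern_class = {pat k l | k l. k < l}"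

lemma input_structure_extension: "k < l \<Longrightarrow> input_structure (extension n E s t k l)"
  unfolding extension_def by (rule input_structure_mk_struct) simp

lemma long_or_exact_cong:
  assumes "\<And>i j. i < n \<Longrightarrow> j < n \<Longrightarrow> E i j = E' i j"
  shows "long_or_exact n E s t k l = long_or_exact n E' s t k l"
proof -
  have p: "pth n E L u v h = pth n E' L u v h" for L u v h
  proof -
    have "\<forall>i\<le>L. h i < n \<Longrightarrow> i < L \<Longrightarrow> E (h i) (h (Suc i)) = E' (h i) (h (Suc i))" for i
      using assms by simp
    then show ?thesis unfolding pth_def by blast
  qed
  show ?thesis unfolding long_or_exact_def p ..
qed

text \<open>No path has \<open>n\<close> or more edges, so all values of \<open>l\<close> beyond
  \<open>n\<close> make the long alternative equally impossible.\<close>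

lemma long_or_exact_bound:
  assumes "k < l" "n < l'"
  shows "long_or_exact n E s t k (min l l') = long_or_exact n E s t k l"
proof (cases "l \<le> l'")
  case False
  then have "\<not> pth n E l s v h" "\<not> pth n E l' s v h" for v h
    using pth_length[of n E l s v h] pth_length[of n E l' s v h] assms by auto
  then show ?thesis using False by (simp add: long_or_exact_def min_def)
qed (simp add: min_def)

lemma ls_query_mem:
  assumes "ls_query x n s t k l \<in> fst (p_emb pattern_class)"
  shows "x \<in> fst p_longshort \<and> k < l \<and> l \<le> snd p_longshort x"
proof -
  have c: "s < n" "t < n" "k < l" "\<And>i j. i < n \<Longrightarrow> j < n \<Longrightarrow> bit_at x 0 n i j \<Longrightarrow> i \<noteq> j \<and> bit_at x 0 n j i"
    "ls_match x n s t k l" and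
    mem: "enc_emb (pat k l) (extension n (bit_at x 0 n) s t k l) \<in> fst (p_emb pattern_class)"
    using assms p_emb_Nil(1)[of pattern_class] unfolding ls_query_def by (auto split: if_splits)
  obtain l' where l': "x = ls_prefix x n s t k @ block (binary l')" "l = min l' (Suc (length x))"
    using c(5) unfolding ls_match_iff by blast
  have x: "x = enc_longshort (mk_graph n (bit_at x 0 n)) s t k l'"
    unfolding enc_longshort_mk_graph by (rule l'(1)[unfolded ls_prefix_def append.assoc])
  have inst: "longshort_instance (mk_graph n (bit_at x 0 n)) s t k l'"
    unfolding longshort_instance_mk_graph using c l'(2) by auto
  have "n * Suc n \<le> length x"
    using arg_cong[OF x, of length] unfolding enc_longshort_mk_graph by (simp add: length_enc_matrix)
  moreover have "n \<le> n * Suc n" by simp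
  ultimately have n: "n < Suc (length x)" by linarith
  have "\<exists>h. embedding h (pat k l) (extension n (bit_at x 0 n) s t k l)"
    using mem p_emb_mem[OF input_structure_pat input_structure_extension[OF c(3)]] by blast
  then have "long_or_exact n (bit_at x 0 n) s t k l"
    using embedding_extension[of n "bit_at x 0 n" s t k l] c by blast
  then have "long_or_exact n (bit_at x 0 n) s t k l'"
    using long_or_exact_bound[OF _ n, of k l'] l'(2) c(3) by simp
  then have "enc_longshort (mk_graph n (bit_at x 0 n)) s t k l' \<in> fst p_longshort"
    unfolding p_longshort_mem[OF inst] .
  moreover have "snd p_longshort (enc_longshort (mk_graph n (bit_at x 0 n)) s t k l') = l'"
    by (rule p_longshort_param[OF inst])
  ultimately show ?thesis using c(3) l'(2) unfolding x[symmetric] by simp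
qed

lemma ls_query_param:
  "snd (p_emb pattern_class) (ls_query x n s t k l) \<le> Suc (snd p_longshort x)"
proof (cases "ls_query x n s t k l = []")
  case True
  then show ?thesis by (simp add: p_emb_Nil)
next
  case False
  then have c: "s < n" "t < n" "k < l" "\<And>i j. i < n \<Longrightarrow> j < n \<Longrightarrow> bit_at x 0 n i j \<Longrightarrow> i \<noteq> j \<and> bit_at x 0 n j i"
    "ls_match x n s t k l" and
    q: "ls_query x n s t k l = enc_emb (pat k l) (extension n (bit_at x 0 n) s t k l)"
    unfolding ls_query_def by (auto split: if_splits)
  obtain l' where l': "x = ls_prefix x n s t k @ block (binary l')" "l = min l' (Suc (length x))"
    using c(5) unfolding ls_match_iff by blast
  have x: "x = enc_longshort (mk_graph n (bit_at x 0 n)) s t k l'"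
    unfolding enc_longshort_mk_graph by (rule l'(1)[unfolded ls_prefix_def append.assoc])
  have inst: "longshort_instance (mk_graph n (bit_at x 0 n)) s t k l'"
    unfolding longshort_instance_mk_graph using c l'(2) by auto
  have "snd p_longshort (enc_longshort (mk_graph n (bit_at x 0 n)) s t k l') = l'"
    by (rule p_longshort_param[OF inst])
  then have "snd p_longshort x = l'" unfolding x[symmetric] .
  moreover have "card (univ (pat k l)) = Suc l" by (simp add: pat_def)
  ultimately show ?thesis
    unfolding q p_emb_param[OF input_structure_pat input_structure_extension[OF c(3)]] using l'(2) by simp
qed

lemma ls_query_complete:
  assumes "x \<in> fst p_longshort"
  shows "\<exists>n s t k l. n < length x + 2 \<and> s < length x + 2 \<and> t < length x + 2 \<and> k < length x + 2 \<and>
    l < length x + 2 \<and> ls_query x n s t k l \<in> fst (p_emb pattern_class)"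
proof -
  obtain G s t k l' where G: "x = enc_longshort G s t k l'" "longshort_instance G s t k l'"
    using assms unfolding p_longshort_def fst_conv by blast
  obtain n E where GE: "G = mk_graph n E"
    using longshort_instance_eq_mk_graph[OF G(2)] by blast
  note x = G(1)[unfolded GE] and inst = G(2)[unfolded GE]
  have le: "long_or_exact n E s t k l'"
    using assms unfolding x p_longshort_mem[OF inst] .
  have i: "\<And>i j. i < n \<Longrightarrow> j < n \<Longrightarrow> E i j \<Longrightarrow> i \<noteq> j \<and> E j i" "s < n" "t < n" "k < l'"
    using inst unfolding longshort_instance_mk_graph by blast+
  have E: "bit_at x 0 n i j = E i j" if "i < n" "j < n" for i j
    unfolding bit_at_def add_0 x enc_longshort_mk_graph sym_code_matrix[OF that] by simp
  have "n * Suc n \<le> length x"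
    using arg_cong[OF x, of length] unfolding enc_longshort_mk_graph by (simp add: length_enc_matrix)
  moreover have "n \<le> n * Suc n" by simp
  ultimately have n: "n < Suc (length x)" by linarith
  \<comment> \<open>For a yes-instance \<open>k\<close> is below \<open>n\<close>, either by the
    exact path or because \<open>k\<close> is less than the length of the long one. Hence
    \<open>k\<close>, though given in binary, is within the range of the guesses.\<close>
  have kn: "k < n" using le pth_length i(4) unfolding long_or_exact_def by (meson less_trans)
  let ?l = "min l' (Suc (length x))"
  have kl: "k < ?l" using i(4) kn n by simp
  have "enc_matrix n {(i, j). bit_at x 0 n i j} = enc_matrix n {(i, j). E i j}"
    by (rule enc_matrix_cong) (simp add: E)
  then have "ls_prefix x n s t k @ block (binary l') = x"
    unfolding x[unfolded enc_longshort_mk_graph, symmetric]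
    by (simp only: ls_prefix_def append.assoc x[unfolded enc_longshort_mk_graph, symmetric])
  from this[symmetric] have match: "ls_match x n s t k ?l" unfolding ls_match_iff by blast
  have "\<forall>i<n. \<forall>j<n. bit_at x 0 n i j \<longrightarrow> i \<noteq> j \<and> bit_at x 0 n j i"
    using i(1) E by simp
  then have q: "ls_query x n s t k ?l = enc_emb (pat k ?l) (extension n (bit_at x 0 n) s t k ?l)"
    unfolding ls_query_def using match kl i by simp
  have "long_or_exact n E s t k ?l"
    using le long_or_exact_bound[OF i(4) n] by simp
  then have "long_or_exact n (bit_at x 0 n) s t k ?l"
    using long_or_exact_cong[of n "bit_at x 0 n" E, OF E] by simp
  then have "\<exists>h. embedding h (pat k ?l) (extension n (bit_at x 0 n) s t k ?l)"
    using embedding_extension[of n "bit_at x 0 n" s t k ?l] i E kl by blast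
  moreover have "pat k ?l \<in> pattern_class" using kl unfolding pattern_class_def by blast
  ultimately have "ls_query x n s t k ?l \<in> fst (p_emb pattern_class)"
    unfolding q p_emb_mem[OF input_structure_pat input_structure_extension[OF kl]] by blast
  moreover have "?l < length x + 2" by simp
  moreover have "n < length x + 2" "s < length x + 2" "t < length x + 2" "k < length x + 2" using n i kn by simp_all
  ultimately show ?thesis by blast
qed

lemma less_of_div_eq_0: "i div c = 0 \<Longrightarrow> 0 < c \<Longrightarrow> i < (c :: nat)"
  by (simp add: div_eq_0_iff)

definition digit_of :: "nat \<Rightarrow> nat \<Rightarrow> nat \<Rightarrow> nat" where
  "digit_of b m i = i div b ^ m mod b"

lemma lsf_digit_of: "lsf vs b \<Longrightarrow> lsf vs i \<Longrightarrow> lsf vs (\<lambda>x a. digit_of (b x a) m (i x a))"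
  unfolding digit_of_def by (intro lsf_mod lsf_div lsf_power_const)

lemma longshort_reducible_to_emb: "pl_turing_reducible p_longshort (p_emb pattern_class)"
proof -
  \<comment> \<open>The query does not depend on which of the two questions is asked: a single
    question per guess is enough, and it is simply repeated.\<close>
  let ?W = "\<lambda>x i. ls_query x (digit_of (length x + 2) 0 i) (digit_of (length x + 2) 1 i)
     (digit_of (length x + 2) 2 i) (digit_of (length x + 2) 3 i) (digit_of (length x + 2) 4 i)"
  have i: "lsf [fst, snd] (\<lambda>x. snd)" "lsf [\<lambda>i. i] (\<lambda>x i. i)" by (rule lsf_var, simp)+
  have "pl_turing_reducible (fst p_longshort, snd p_longshort) (fst (p_emb pattern_class), snd (p_emb pattern_class))"
  \<comment> \<open>Five numbers are guessed, each at most \<open>Suc (length x)\<close>, the cap on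
    \<open>l\<close>; hence the fifth power. The parameter of a query grows by 1 since the pattern
    has one more vertex than edges.\<close>
  proof (rule oracle_reduction[where W = "\<lambda>x q. ?W x (snd q)" and live = "\<lambda>x i. i < (length x + 2) ^ 5"
        and N = "\<lambda>x. (length x + 2) ^ 5" and h = "\<lambda>k. 0" and c = 5 and g = "\<lambda>k. k + 1"])
    show "lsw [fst, snd] (\<lambda>x q. ?W x (snd q))"
      by (intro lsw_ls_query lsf_digit_of lsf_add lsf_length lsf_const i)
    show "lsp [\<lambda>i. i] (\<lambda>x i. i < (length x + 2) ^ 5)"
      by (intro lsp_less lsf_power_const lsf_add lsf_length lsf_const i)
    show "computable (\<lambda>k. 0)" by (rule computable_const)
    show "computable (\<lambda>k. k + 1)" by (intro computable_add computable_id computable_const)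
    fix x
    show "x \<in> fst p_longshort \<longleftrightarrow> (\<exists>i < (length x + 2) ^ 5. ?W x (snd (0, i)) \<in> fst (p_emb pattern_class) \<and>
        ?W x (snd (1, i)) \<in> fst (p_emb pattern_class))"
    proof
      assume "x \<in> fst p_longshort"
      then obtain n s t k l where q: "n < length x + 2" "s < length x + 2" "t < length x + 2" "k < length x + 2"
        "l < length x + 2" "ls_query x n s t k l \<in> fst (p_emb pattern_class)"
        using ls_query_complete by blast
      have "\<forall>d \<in> set [n, s, t, k, l]. d < length x + 2" using q by simp
      from tuple_code[OF this, of 0] obtain i where i: "i div (length x + 2) ^ length [n, s, t, k, l] = 0"
        "\<And>j. j < length [n, s, t, k, l] \<Longrightarrow> i div (length x + 2) ^ j mod (length x + 2) = [n, s, t, k, l] ! j"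
        by blast
      have len: "length [n, s, t, k, l] = 5" by simp
      have "digit_of (length x + 2) j i = [n, s, t, k, l] ! j" if "j < 5" for j
        unfolding digit_of_def by (rule i(2)) (use that in simp)
      from this[of 0] this[of 1] this[of 2] this[of 3] this[of 4]
      have "?W x i \<in> fst (p_emb pattern_class)" using q(6) by simp
      moreover have "i < (length x + 2) ^ 5"
        by (rule less_of_div_eq_0[OF i(1)[unfolded len]]) simp
      ultimately show "\<exists>i < (length x + 2) ^ 5. ?W x (snd (0, i)) \<in> fst (p_emb pattern_class) \<and>
        ?W x (snd (1, i)) \<in> fst (p_emb pattern_class)" by auto
    next
      assume "\<exists>i < (length x + 2) ^ 5. ?W x (snd (0, i)) \<in> fst (p_emb pattern_class) \<and>
        ?W x (snd (1, i)) \<in> fst (p_emb pattern_class)"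
      then show "x \<in> fst p_longshort" using ls_query_mem by fastforce
    qed
    show "snd (p_emb pattern_class) (?W x (snd (q, i))) \<le> snd p_longshort x + 1" for q i
      using ls_query_param by simp
  qed simp_all
  then show ?thesis by simp
qed

subsection \<open>From embeddings to long or exact paths\<close>

text \<open>The length of the encoding of a path structure and a separator.\<close>

definition target_pos :: "nat \<Rightarrow> nat" where
  "target_pos l = Suc (Suc (Suc l) * Suc (Suc l))"

definition root_at :: "sym list \<Rightarrow> nat \<Rightarrow> nat \<Rightarrow> bool" where
  "root_at x l i \<longleftrightarrow> sym_code x (target_pos l + i) = 1"

definition edge_at :: "sym list \<Rightarrow> nat \<Rightarrow> nat \<Rightarrow> nat \<Rightarrow> nat \<Rightarrow> bool" where
  "edge_at x l n = bit_at x (target_pos l + Suc n) n"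

definition emb_match :: "sym list \<Rightarrow> nat \<Rightarrow> nat \<Rightarrow> nat \<Rightarrow> bool" where
  "emb_match x k l n \<longleftrightarrow> k < l \<and> 0 < n \<and>
     x = enc_emb (pat k l) (mk_struct n (root_at x l) (edge_at x l n))"

text \<open>The guesses are the root image \<open>s\<close>, the images \<open>v\<close> and
  \<open>w\<close> of the ends of the directed edge, the mask and the table. In the second question
  the target \<open>s\<close> has the wrong colour, so length 0 cannot be realized. If
  \<open>l = Suc k\<close>, the second question would have bound 0 and be no instance, so the first
  one is repeated.\<close>

definition emb_query :: "sym list \<Rightarrow> nat \<Rightarrow> nat \<Rightarrow> nat \<Rightarrow> nat \<Rightarrow> nat \<Rightarrow> nat \<Rightarrow> nat \<Rightarrow> nat \<Rightarrow> nat \<Rightarrow> sym list" where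
  "emb_query x q k l n s v w M T =
     (if emb_match x k l n \<and> s < n \<and> v < n \<and> w < n \<and> root_at x l s \<and> edge_at x l n v w \<and>
         \<not> colour M T s \<and> \<not> colour M T v \<and> colour M T w
      then if q = 0 \<or> l = Suc k
        then enc_longshort (mk_graph n (colour_core (edge_at x l n) (colour M T) False)) s v k l
        else enc_longshort (mk_graph n (colour_core (edge_at x l n) (colour M T) True)) w s 0 (l - Suc k)
      else [])"

lemma lsp_root_at: "lsf vs l \<Longrightarrow> lsf vs i \<Longrightarrow> lsp vs (\<lambda>x a. root_at x (l x a) (i x a))"
  unfolding root_at_def target_pos_def
  by (intro lsp_eq lsf_sym lsf_add lsf_mult lsf_Suc lsf_const)

lemma lsp_edge_at:
  "lsf vs l \<Longrightarrow> lsf vs n \<Longrightarrow> lsf vs i \<Longrightarrow> lsf vs j \<Longrightarrow>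
   lsp vs (\<lambda>x a. edge_at x (l x a) (n x a) (i x a) (j x a))"
  unfolding edge_at_def target_pos_def
  by (intro lsp_bit_at lsf_add lsf_mult lsf_Suc lsf_const)

lemma lsp_emb_match:
  assumes K: "lsf vs k" and L: "lsf vs l" and N: "lsf vs n"
  shows "lsp vs (\<lambda>x a. emb_match x (k x a) (l x a) (n x a))"
proof -
  note w0 = K L N
  note w1 = w0[THEN lsf_weaken]
  note w2 = w1[THEN lsf_weaken]
  note e = lsf_ext_first lsf_weaken[OF lsf_ext_first]
  note leaves = w0 w1 w2 e lsf_const
  show ?thesis
    unfolding emb_match_def enc_emb_def pat_def enc_structure_mk_struct
    by (intro lsp_conj lsp_disj lsp_not lsp_less lsp_word_eq lsw_append lsw_block lsw_matrix lsw_single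
        lsp_eq lsf_Suc lsp_root_at lsp_edge_at leaves)
qed

lemma lsp_colour_core:
  assumes "lsp vs (\<lambda>x a. E x a (i x a) (j x a))" "lsp vs (\<lambda>x a. E x a (j x a) (i x a))"
    "lsf vs M" "lsf vs T" "lsf vs i" "lsf vs j"
  shows "lsp vs (\<lambda>x a. colour_core (E x a) (colour (M x a) (T x a)) c (i x a) (j x a))"
proof -
  have "lsp vs (\<lambda>x a. colour (M x a) (T x a) (i x a) = c)" "lsp vs (\<lambda>x a. colour (M x a) (T x a) (j x a) = c)"
    using lsp_colour[OF assms(3,4,5)] lsp_colour[OF assms(3,4,6)] by (cases c; simp add: lsp_not)+
  then show ?thesis
    unfolding colour_core_def by (intro lsp_conj lsp_not lsp_eq assms)
qed

lemma lsw_emb_query: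
  assumes q: "lsf vs q" and K: "lsf vs k" and L: "lsf vs l" and N: "lsf vs n" and S: "lsf vs s" and v: "lsf vs v"
    and w: "lsf vs w" and M: "lsf vs M" and T: "lsf vs T"
  shows "lsw vs (\<lambda>x a. emb_query x (q x a) (k x a) (l x a) (n x a) (s x a) (v x a) (w x a) (M x a) (T x a))"
proof -
  note w0 = q K L N S v w M T
  note w1 = w0[THEN lsf_weaken]
  note w2 = w1[THEN lsf_weaken]
  note e = lsf_ext_first lsf_weaken[OF lsf_ext_first]
  note leaves = w0 w1 w2 e lsf_const
  show ?thesis
    unfolding emb_query_def enc_longshort_mk_graph
    by (intro lsw_if lsp_conj lsp_disj lsp_not lsp_less lsp_eq lsp_emb_match lsp_root_at lsp_edge_at lsp_colour
        lsw_append lsw_matrix lsp_colour_core lsw_single lsw_nil lsw_binary lsf_diff lsf_Suc leaves)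
qed

text \<open>With \<open>l + 1\<close> vertices, the root block has \<open>l + 2\<close> symbols and
  the matrix \<open>l + 1\<close> rows of \<open>l + 2\<close> symbols, which makes a square; the
  separator adds 1.\<close>

lemma length_enc_pat: "length (enc_structure (pat k l) @ [Sep]) = target_pos l"
  unfolding pat_def enc_structure_mk_struct by (simp add: length_block length_enc_matrix target_pos_def)

text \<open>The target structure need not be guessed: its relations sit at positions that are
  determined by \<open>l\<close> and \<open>n\<close>, and on an encoding reading them there gives
  back \<open>R\<close> and \<open>E\<close>.\<close>

lemma emb_match_complete:
  assumes x: "x = enc_emb (pat k l) (mk_struct n R E)" and kl: "k < l" and n: "0 < n"
  shows "emb_match x k l n" "mk_struct n (root_at x l) (edge_at x l n) = mk_struct n R E"
proof -
  let ?u = "enc_structure (pat k l) @ [Sep]" and ?r = "block (map R [0..<n])"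
  have x': "x = ?u @ (?r @ enc_matrix n {(i, j). E i j})" "x = (?u @ ?r) @ (enc_matrix n {(i, j). E i j} @ [])"
    unfolding x enc_emb_def enc_structure_mk_struct by simp_all
  have r: "root_at x l i = R i" if "i < n" for i
    unfolding root_at_def length_enc_pat[of k l, symmetric]
    using sym_code_append[of ?u "?r @ enc_matrix n {(i, j). E i j}" i, folded x'(1)] that
      sym_code_block[of i "map R [0..<n]"] by simp
  have p: "target_pos l + Suc n = length (?u @ ?r)"
    unfolding length_append[of ?u] length_enc_pat by (simp add: length_block)
  have e: "edge_at x l n i j = E i j" if "i < n" "j < n" for i j
    unfolding edge_at_def bit_at_def p
    using sym_code_append[of "?u @ ?r" "enc_matrix n {(i, j). E i j} @ []" "i * Suc n + j", folded x'(2)]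
      sym_code_matrix[OF that, of "{(i, j). E i j}" "[]"] by simp
  show m: "mk_struct n (root_at x l) (edge_at x l n) = mk_struct n R E"
    by (rule mk_struct_cong) (simp_all only: r e)
  show "emb_match x k l n"
    unfolding emb_match_def m using kl n x by blast
qed

lemma emb_match_param:
  assumes "emb_match x k l n"
  shows "snd (p_emb pattern_class) x = Suc l"
proof -
  have x: "x = enc_emb (pat k l) (mk_struct n (root_at x l) (edge_at x l n))" and n: "0 < n"
    using assms unfolding emb_match_def by blast+
  have "snd (p_emb pattern_class) (enc_emb (pat k l) (mk_struct n (root_at x l) (edge_at x l n))) = Suc l"
    unfolding p_emb_param[OF input_structure_pat input_structure_mk_struct[OF n]] by (simp add: pat_def)
  then show ?thesis unfolding x[symmetric] .
qed

lemma emb_match_mem: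
  assumes "emb_match x k l n"
  shows "x \<in> fst (p_emb pattern_class) \<longleftrightarrow> (\<exists>h. embedding h (pat k l) (mk_struct n (root_at x l) (edge_at x l n)))"
proof -
  have x: "x = enc_emb (pat k l) (mk_struct n (root_at x l) (edge_at x l n))" and n: "0 < n" and kl: "k < l"
    using assms unfolding emb_match_def by blast+
  have "pat k l \<in> pattern_class" using kl unfolding pattern_class_def by blast
  then have "enc_emb (pat k l) (mk_struct n (root_at x l) (edge_at x l n)) \<in> fst (p_emb pattern_class) \<longleftrightarrow>
      (\<exists>h. embedding h (pat k l) (mk_struct n (root_at x l) (edge_at x l n)))"
    using p_emb_mem[OF input_structure_pat input_structure_mk_struct[OF n]] by blast
  then show ?thesis unfolding x[symmetric] .
qed

lemma emb_match_length:
  assumes "emb_match x k l n"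
  shows "l < length x" "n < length x"
proof -
  have x: "x = enc_emb (pat k l) (mk_struct n (root_at x l) (edge_at x l n))"
    using assms unfolding emb_match_def by blast
  have "length x = target_pos l + Suc n * Suc n"
    using arg_cong[OF x, of length]
    unfolding enc_emb_def append_assoc[symmetric] length_append[of "_ @ [Sep]"] length_enc_pat
    unfolding enc_structure_mk_struct by (simp add: length_block length_enc_matrix)
  then show "l < length x" "n < length x" by (simp_all add: target_pos_def)
qed

lemma longshort_instance_colour_core:
  "longshort_instance (mk_graph n (colour_core E \<chi> c)) s t k l \<longleftrightarrow> s < n \<and> t < n \<and> k < l"
  unfolding longshort_instance_mk_graph by (auto simp: colour_core_def)

lemma emb_query_cases:
  assumes "emb_query x q k l n s v w M T \<noteq> []"
  shows "emb_match x k l n" "s < n" "v < n" "w < n" "root_at x l s" "edge_at x l n v w"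
    "\<not> colour M T s" "\<not> colour M T v" "colour M T w"
    "emb_query x q k l n s v w M T =
      (if q = 0 \<or> l = Suc k
       then enc_longshort (mk_graph n (colour_core (edge_at x l n) (colour M T) False)) s v k l
       else enc_longshort (mk_graph n (colour_core (edge_at x l n) (colour M T) True)) w s 0 (l - Suc k))"
proof -
  let ?C = "emb_match x k l n \<and> s < n \<and> v < n \<and> w < n \<and> root_at x l s \<and> edge_at x l n v w \<and>
    \<not> colour M T s \<and> \<not> colour M T v \<and> colour M T w"
  have C: ?C
  proof (rule ccontr)
    assume "\<not> ?C"
    then show False using assms unfolding emb_query_def if_not_P[OF \<open>\<not> ?C\<close>] by simp
  qed
  then show "emb_match x k l n" "s < n" "v < n" "w < n" "root_at x l s" "edge_at x l n v w"
    "\<not> colour M T s" "\<not> colour M T v" "colour M T w"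
    by blast+
  show "emb_query x q k l n s v w M T =
      (if q = 0 \<or> l = Suc k
       then enc_longshort (mk_graph n (colour_core (edge_at x l n) (colour M T) False)) s v k l
       else enc_longshort (mk_graph n (colour_core (edge_at x l n) (colour M T) True)) w s 0 (l - Suc k))"
    unfolding emb_query_def if_P[OF C] ..
qed

lemma emb_query_param:
  "snd p_longshort (emb_query x q k l n s v w M T) \<le> snd (p_emb pattern_class) x"
proof (cases "emb_query x q k l n s v w M T = []")
  case True
  then show ?thesis by (simp add: p_longshort_Nil)
next
  case False
  note c = emb_query_cases[OF False]
  have kl: "k < l" using c(1) unfolding emb_match_def by blast
  let ?G = "\<lambda>b. mk_graph n (colour_core (edge_at x l n) (colour M T) b)"
  have "longshort_instance (?G False) s v k l"
    unfolding longshort_instance_colour_core using c(2,3) kl by simp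
  moreover have "longshort_instance (?G True) w s 0 (l - Suc k)" if "l \<noteq> Suc k"
    unfolding longshort_instance_colour_core using c(2,4) kl that by simp
  ultimately have "snd p_longshort (emb_query x q k l n s v w M T) \<le> l"
    unfolding c(10) using p_longshort_param by simp
  then show ?thesis unfolding emb_match_param[OF c(1)] by simp
qed

lemma emb_query_mem:
  assumes "emb_query x 0 k l n s v w M T \<in> fst p_longshort" "emb_query x 1 k l n s v w M T \<in> fst p_longshort"
  shows "x \<in> fst (p_emb pattern_class)"
proof -
  have ne: "emb_query x 0 k l n s v w M T \<noteq> []" "emb_query x 1 k l n s v w M T \<noteq> []"
    using assms p_longshort_Nil(1) by auto
  note c = emb_query_cases[OF ne(1)] and c' = emb_query_cases(10)[OF ne(2)]
  have kl: "k < l" using c(1) unfolding emb_match_def by blast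
  let ?G = "\<lambda>b. mk_graph n (colour_core (edge_at x l n) (colour M T) b)"
  have "longshort_instance (?G False) s v k l"
    unfolding longshort_instance_colour_core using c(2,3) kl by simp
  then have 1: "long_or_exact n (colour_core (edge_at x l n) (colour M T) False) s v k l"
    using assms(1) p_longshort_mem unfolding c(10) by simp
  have 2: "l = Suc k \<or> long_or_exact n (colour_core (edge_at x l n) (colour M T) True) w s 0 (l - Suc k)"
  proof (cases "l = Suc k")
    case False
    then have "longshort_instance (?G True) w s 0 (l - Suc k)"
      unfolding longshort_instance_colour_core using c(2,4) kl by simp
    then show ?thesis
      using assms(2) p_longshort_mem False unfolding c' by simp
  qed simp
  show ?thesis
    unfolding emb_match_mem[OF c(1)]
    by (rule embedding_from_colouring[where \<chi> = "colour M T", OF kl _ _ _ _ _ _ _ 1 2]) (rule c)+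
qed

lemma emb_query_complete:
  assumes "x \<in> fst (p_emb pattern_class)"
  shows "\<exists>k l n s v w M T. emb_match x k l n \<and> k < length x \<and> l < length x \<and> n < length x \<and> s < length x \<and>
    v < length x \<and> w < length x \<and> M < 2 * length x + 2 \<and> T < 2 ^ 2 ^ Suc l \<and>
    emb_query x 0 k l n s v w M T \<in> fst p_longshort \<and> emb_query x 1 k l n s v w M T \<in> fst p_longshort"
proof -
  obtain A B where AB: "x = enc_emb A B" "A \<in> pattern_class" "input_structure B" "\<exists>h. embedding h A B"
    using assms unfolding p_emb_def fst_conv by blast
  obtain k l where kl: "A = pat k l" "k < l" using AB(2) unfolding pattern_class_def by blast
  obtain n R E where B: "B = mk_struct n R E"
    by (rule that[OF input_structure_eq_mk_struct[OF AB(3)]])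
  have "univ B \<noteq> {}" using AB(3) unfolding input_structure_def finite_structure_def by blast
  then have n: "0 < n" unfolding B by (cases n) simp_all
  have m: "emb_match x k l n" by (rule emb_match_complete(1)[OF AB(1)[unfolded kl(1) B] kl(2) n])
  obtain h where h: "embedding h (pat k l) (mk_struct n (root_at x l) (edge_at x l n))"
    using assms emb_match_mem[OF m] by blast
  have e: "\<And>i. i \<le> l \<Longrightarrow> h i < n" "inj_on h {..l}" "root_at x l (h 0)"
    "\<And>i. i < l \<Longrightarrow> edge_at x l n (h i) (h (Suc i))"
    using h unfolding embedding_pat by blast+
  have disj: "h ` {..k} \<inter> h ` {Suc k..l} = {}"
  proof -
    have "h i \<noteq> h j" if "i \<le> k" "Suc k \<le> j" "j \<le> l" for i j
      using inj_onD[OF e(2), of i j] that kl(2) by auto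
    then show ?thesis by fastforce
  qed
  have sub: "h ` {..k} \<union> h ` {Suc k..l} \<subseteq> {..<n}"
    using e(1) kl(2) by auto
  have card: "card (h ` {..k} \<union> h ` {Suc k..l}) \<le> Suc l"
  proof -
    have "h ` {..k} \<union> h ` {Suc k..l} \<subseteq> h ` {..l}" using kl(2) by auto
    then have "card (h ` {..k} \<union> h ` {Suc k..l}) \<le> card (h ` {..l})" by (intro card_mono) auto
    also have "\<dots> \<le> card {..l}" by (rule card_image_le) simp
    finally show ?thesis by simp
  qed
  from colouring_family[OF finite_imageI finite_imageI disj sub card, OF finite_atMost finite_atLeastAtMost]
  obtain M T where MT: "M < 2 ^ bit_length n" "T < 2 ^ 2 ^ Suc l"
    "\<forall>v \<in> h ` {..k}. \<not> colour M T v" "\<forall>v \<in> h ` {Suc k..l}. colour M T v"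
    by (elim exE conjE)
  let ?\<chi> = "colour M T"
  have \<chi>: "\<And>i. i \<le> k \<Longrightarrow> \<not> ?\<chi> (h i)" "\<And>i. k < i \<Longrightarrow> i \<le> l \<Longrightarrow> ?\<chi> (h i)"
    using MT(3,4) by auto
  have cond: "h 0 < n" "h k < n" "h (Suc k) < n" "edge_at x l n (h k) (h (Suc k))"
    "\<not> ?\<chi> (h 0)" "\<not> ?\<chi> (h k)" "?\<chi> (h (Suc k))"
    using e \<chi> kl(2) by simp_all
  let ?E = "edge_at x l n"
  have q: "emb_query x q k l n (h 0) (h k) (h (Suc k)) M T = (if q = 0 \<or> l = Suc k
      then enc_longshort (mk_graph n (colour_core ?E ?\<chi> False)) (h 0) (h k) k l
      else enc_longshort (mk_graph n (colour_core ?E ?\<chi> True)) (h (Suc k)) (h 0) 0 (l - Suc k))" for q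
    unfolding emb_query_def using m cond e(3) by simp
  have 1: "enc_longshort (mk_graph n (colour_core ?E ?\<chi> False)) (h 0) (h k) k l \<in> fst p_longshort"
  proof -
    have "longshort_instance (mk_graph n (colour_core ?E ?\<chi> False)) (h 0) (h k) k l"
      unfolding longshort_instance_colour_core using cond kl(2) by simp
    from p_longshort_mem[OF this] show ?thesis
      using colouring_from_embedding(1)[where \<chi> = ?\<chi>, OF h kl(2) \<chi>] by (rule iffD2)
  qed
  have 2: "enc_longshort (mk_graph n (colour_core ?E ?\<chi> True)) (h (Suc k)) (h 0) 0 (l - Suc k) \<in> fst p_longshort"
    if "l \<noteq> Suc k"
  proof -
    have "longshort_instance (mk_graph n (colour_core ?E ?\<chi> True)) (h (Suc k)) (h 0) 0 (l - Suc k)"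
      unfolding longshort_instance_colour_core using cond kl(2) that by simp
    from p_longshort_mem[OF this] show ?thesis
      using colouring_from_embedding(2)[where \<chi> = ?\<chi>, OF h kl(2) \<chi> that] by (rule iffD2)
  qed
  have "emb_query x q k l n (h 0) (h k) (h (Suc k)) M T \<in> fst p_longshort" for q
    unfolding q using 1 2 by simp
  \<comment> \<open>The mask is the largest guess besides the table and dictates the base
    \<open>2 * length x + 2\<close> of the tuple code.\<close>
  moreover have "M < 2 * length x + 2"
    using MT(1) power_bit_length_le[of n] emb_match_length(2)[OF m] by linarith
  moreover have "h 0 < length x" "h k < length x" "h (Suc k) < length x" "k < length x" "l < length x" "n < length x"
    using cond(1-3) emb_match_length[OF m] kl(2) by simp_all
  ultimately show ?thesis
    using m MT(2)
    by - (rule exI[of _ k], rule exI[of _ l], rule exI[of _ n], rule exI[of _ "h 0"], rule exI[of _ "h k"],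
        rule exI[of _ "h (Suc k)"], rule exI[of _ M], rule exI[of _ T], intro conjI)
qed

definition emb_live :: "sym list \<Rightarrow> nat \<Rightarrow> bool" where
  "emb_live x i \<longleftrightarrow> i div (2 * length x + 2) ^ 7 = 0 \<or>
     (\<exists>k < length x. \<exists>l < length x. \<exists>n < length x. emb_match x k l n \<and>
        bit_length (bit_length (i div (2 * length x + 2) ^ 7)) \<le> Suc (Suc l))"

text \<open>The exact number of live tables. For an instance the parameter is \<open>Suc l\<close>,
  so the exponent is \<open>2 ^ (l + 2) - 1\<close>, the largest bit length whose own bit length is
  at most \<open>l + 2\<close>.\<close>

definition table_bound :: "sym list \<Rightarrow> nat" where
  "table_bound x = (if \<exists>k l n. emb_match x k l n then 2 ^ (2 ^ Suc (snd (p_emb pattern_class) x) - 1) else 1)"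

lemma emb_live_iff: "emb_live x i \<longleftrightarrow> i < table_bound x * (2 * length x + 2) ^ 7"
proof -
  let ?b = "(2 * length x + 2) ^ 7"
  let ?T = "i div ?b"
  have b: "0 < ?b" by simp
  have bl: "bit_length (bit_length t) \<le> Suc (Suc l) \<longleftrightarrow> t < 2 ^ (2 ^ Suc (Suc l) - 1)" for t l
  proof -
    have "bit_length (bit_length t) \<le> Suc (Suc l) \<longleftrightarrow> bit_length t < 2 ^ Suc (Suc l)"
      by (rule bit_length_le_iff)
    also have "\<dots> \<longleftrightarrow> bit_length t \<le> 2 ^ Suc (Suc l) - 1"
    proof -
      have "0 < (2::nat) ^ Suc (Suc l)" by (rule zero_less_power) simp
      then show ?thesis by linarith
    qed
    also have "\<dots> \<longleftrightarrow> t < 2 ^ (2 ^ Suc (Suc l) - 1)" by (rule bit_length_le_iff)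
    finally show ?thesis .
  qed
  have "emb_live x i \<longleftrightarrow> ?T < table_bound x"
  proof (cases "\<exists>k l n. emb_match x k l n")
    case True
    then obtain k l n where m: "emb_match x k l n" by blast
    have tb: "table_bound x = 2 ^ (2 ^ Suc (Suc l) - 1)"
      unfolding table_bound_def emb_match_param[OF m] using True by (simp only: if_True)
    have kx: "k < length x" using m emb_match_length(1)[OF m] unfolding emb_match_def by (meson less_trans)
    have "emb_live x i \<longleftrightarrow> ?T = 0 \<or> bit_length (bit_length ?T) \<le> Suc (Suc l)"
    proof
      assume "emb_live x i"
      then consider "?T = 0" | k' l' n' where "emb_match x k' l' n'" "bit_length (bit_length ?T) \<le> Suc (Suc l')"
        unfolding emb_live_def by (elim disjE exE conjE) (rule that(1), assumption, rule that(2), assumption+)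
      then show "?T = 0 \<or> bit_length (bit_length ?T) \<le> Suc (Suc l)"
      proof cases
        case 2
        then have "l' = l" using emb_match_param[OF m] emb_match_param[OF 2(1)] by (metis Suc_inject)
        then show ?thesis using 2(2) by (simp only: simp_thms)
      qed (simp only: simp_thms)
    next
      assume "?T = 0 \<or> bit_length (bit_length ?T) \<le> Suc (Suc l)"
      then show "emb_live x i"
        unfolding emb_live_def using m kx emb_match_length[OF m] by blast
    qed
    also have "\<dots> \<longleftrightarrow> ?T < table_bound x"
    proof -
      have "?T < 2 ^ (2 ^ Suc (Suc l) - 1)" if "?T = 0" unfolding that by (rule zero_less_power) simp
      then show ?thesis unfolding tb bl by blast
    qed
    finally show ?thesis .
  next
    case False
    then have "table_bound x = 1" unfolding table_bound_def by (simp only: if_False)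
    moreover have "emb_live x i \<longleftrightarrow> ?T = 0" unfolding emb_live_def using False by blast
    ultimately show ?thesis by (simp only: less_one)
  qed
  also have "\<dots> \<longleftrightarrow> i < table_bound x * ?b"
    by (rule div_less_iff_less_mult[OF b])
  finally show ?thesis .
qed

lemma lsp_emb_live: "lsp [\<lambda>i. i] emb_live"
proof -
  have i: "lsf [\<lambda>i. i] (\<lambda>x i. i)" by (rule lsf_var) simp
  have T: "lsf [\<lambda>i. i] (\<lambda>x i. i div (2 * length x + 2) ^ 7)"
    by (intro lsf_div lsf_power_const lsf_add lsf_mult lsf_length lsf_const i)
  note T3 = T[THEN lsf_weaken, THEN lsf_weaken, THEN lsf_weaken]
  show ?thesis
    unfolding emb_live_def
    by (intro lsp_disj lsp_eq lsp_ex lsp_conj lsp_emb_match lsp_le lsf_bit_length lsf_Suc T T3 lsf_const lsf_length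
        lsf_ext_first lsf_weaken[OF lsf_ext_first] lsf_weaken[OF lsf_weaken[OF lsf_ext_first]])
qed

lemma emb_reducible_to_longshort: "pl_turing_reducible (p_emb pattern_class) p_longshort"
proof -
  let ?b = "\<lambda>x :: sym list. 2 * length x + 2"
  let ?W = "\<lambda>x q i. emb_query x q (digit_of (?b x) 0 i) (digit_of (?b x) 1 i) (digit_of (?b x) 2 i)
     (digit_of (?b x) 3 i) (digit_of (?b x) 4 i) (digit_of (?b x) 5 i) (digit_of (?b x) 6 i) (i div ?b x ^ 7)"
  let ?N = "\<lambda>x. table_bound x * ?b x ^ 7"
  have v: "lsf [fst, snd] (\<lambda>x. fst)" "lsf [fst, snd] (\<lambda>x. snd)" by (rule lsf_var, simp)+
  have "pl_turing_reducible (fst (p_emb pattern_class), snd (p_emb pattern_class)) (fst p_longshort, snd p_longshort)"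
  \<comment> \<open>Seven guesses lie below the table. In \<open>h\<close> the power covers
    \<open>table_bound\<close>, and the 7 comes from replacing the base
    \<open>2 * length x + 2\<close> by \<open>length x + 2\<close>. Queries have bound at most
    \<open>l\<close>, which is less than the parameter.\<close>
  proof (rule oracle_reduction[where W = "\<lambda>x a. ?W x (fst a) (snd a)" and live = emb_live
        and N = ?N and h = "\<lambda>k. 2 ^ (k + 1) + 7" and c = 7 and g = "\<lambda>k. k"])
    show "lsw [fst, snd] (\<lambda>x a. ?W x (fst a) (snd a))"
      by (intro lsw_emb_query lsf_digit_of lsf_add lsf_mult lsf_div lsf_power_const lsf_length lsf_const v)
    show "lsp [\<lambda>i. i] emb_live" by (rule lsp_emb_live)
    show "computable (\<lambda>k. 2 ^ (k + 1) + 7)"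
      by (intro computable_add computable_exp2 computable_id computable_const)
    show "computable (\<lambda>k. k)" by (rule computable_id)
    fix x
    show "emb_live x i \<longleftrightarrow> i < ?N x" for i by (rule emb_live_iff)
    have "0 < table_bound x" by (simp add: table_bound_def)
    then show "0 < ?N x" by simp
    have "table_bound x \<le> 2 ^ 2 ^ (snd (p_emb pattern_class) x + 1)"
    proof -
      have "(2::nat) ^ (2 ^ Suc (snd (p_emb pattern_class) x) - 1) \<le> 2 ^ 2 ^ (snd (p_emb pattern_class) x + 1)"
        by (rule power_increasing) simp_all
      moreover have "(1::nat) \<le> 2 ^ 2 ^ (snd (p_emb pattern_class) x + 1)" by (rule one_le_power) simp
      ultimately show ?thesis unfolding table_bound_def by (simp only: split: if_split) blast
    qed
    moreover have "?b x ^ 7 \<le> 2 ^ 7 * (length x + 2) ^ 7"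
      unfolding power_mult_distrib[symmetric] by (rule power_mono) simp_all
    ultimately show "?N x \<le> 2 ^ (2 ^ (snd (p_emb pattern_class) x + 1) + 7) * (length x + 2) ^ 7"
      unfolding power_add[of 2 _ 7] mult.assoc by (rule mult_mono) simp_all
    show "x \<in> fst (p_emb pattern_class) \<longleftrightarrow> (\<exists>i < ?N x. ?W x (fst (0, i)) (snd (0, i)) \<in> fst p_longshort \<and>
        ?W x (fst (1, i)) (snd (1, i)) \<in> fst p_longshort)"
      unfolding fst_conv snd_conv
    proof
      assume "x \<in> fst (p_emb pattern_class)"
      from emb_query_complete[OF this] obtain k l n s v w M T where q: "emb_match x k l n"
        "k < length x" "l < length x" "n < length x" "s < length x" "v < length x" "w < length x"
        "M < ?b x" "T < 2 ^ 2 ^ Suc l" "emb_query x 0 k l n s v w M T \<in> fst p_longshort"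
        "emb_query x 1 k l n s v w M T \<in> fst p_longshort"
        by (elim exE conjE)
      let ?ds = "[k, l, n, s, v, w, M]"
      have "\<forall>d \<in> set ?ds. d < ?b x" using q(2-8) by simp
      from tuple_code[OF this, of T] obtain i where i: "i div ?b x ^ length ?ds = T"
        "\<And>j. j < length ?ds \<Longrightarrow> i div ?b x ^ j mod ?b x = ?ds ! j"
        by blast
      have len: "length ?ds = 7" by simp
      have "digit_of (?b x) j i = ?ds ! j" if "j < 7" for j
        unfolding digit_of_def by (rule i(2)) (use that in simp)
      from this[of 0] this[of 1] this[of 2] this[of 3] this[of 4] this[of 5] this[of 6]
      have d: "digit_of (?b x) 0 i = k" "digit_of (?b x) 1 i = l" "digit_of (?b x) 2 i = n"
        "digit_of (?b x) 3 i = s" "digit_of (?b x) 4 i = v" "digit_of (?b x) 5 i = w" "digit_of (?b x) 6 i = M"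
        by simp_all
      have "bit_length (bit_length T) \<le> Suc (Suc l)"
      proof -
        \<comment> \<open>The bit length of \<open>T\<close> may equal \<open>2 ^ Suc l\<close>,
          which itself has bit length \<open>Suc (Suc l)\<close>; this explains the second successor
          in \<open>emb_live\<close>.\<close>
        have "bit_length T \<le> 2 ^ Suc l" using q(9) bit_length_le_iff by blast
        also have "(2::nat) ^ Suc l < 2 ^ Suc (Suc l)" by (rule power_strict_increasing) simp_all
        finally show ?thesis using bit_length_le_iff by blast
      qed
      then have "emb_live x i"
        unfolding emb_live_def i(1)[unfolded len] using q(1-4) by blast
      then have "i < ?N x" unfolding emb_live_iff .
      moreover have "?W x 0 i \<in> fst p_longshort" "?W x 1 i \<in> fst p_longshort"
        unfolding d i(1)[unfolded len] by (rule q)+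
      ultimately show "\<exists>i < ?N x. ?W x 0 i \<in> fst p_longshort \<and> ?W x 1 i \<in> fst p_longshort"
        by (intro exI[of _ i] conjI)
    next
      assume "\<exists>i < ?N x. ?W x 0 i \<in> fst p_longshort \<and> ?W x 1 i \<in> fst p_longshort"
      then show "x \<in> fst (p_emb pattern_class)" by (elim exE conjE) (rule emb_query_mem)
    qed
    show "snd p_longshort (?W x (fst (q, i)) (snd (q, i))) \<le> snd (p_emb pattern_class) x" for q i
      by (rule emb_query_param)
  qed
  then show ?thesis by simp
qed

theorem theorem6p1:
  shows "\<exists>\<A> :: nat struct set.
           (\<forall>P \<in> \<A>. rooted_path_structure P \<and> input_structure P) \<and>
           pl_turing_reducible (p_emb \<A>) p_longshort \<and>
           pl_turing_reducible p_longshort (p_emb \<A>)"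
proof (intro exI conjI)
  show "\<forall>P \<in> pattern_class. rooted_path_structure P \<and> input_structure P"
    using rooted_path_structure_pat input_structure_pat by (auto simp: pattern_class_def)
qed (rule emb_reducible_to_longshort, rule longshort_reducible_to_emb)

end
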